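(* There is an absolute constant $C$ such that the following holds. Let $A$ be the (complex-valued) coefficient of a Krein system with solution $(P,P_* )$ and orthogonality measure $\sigma$, and suppose that $A(r)\log(2+r)\in L^2(\mathbb{R}^+)$. Then for every $\rho>0$, $$\int_{\mathbb{R}}\left(\sup_{\rho<r_1<r_2}\left|\int_{r_1}^{r_2}A(x)P(x,k)\,dx\right|\right)^2\frac{d\sigma(k)}{1+k^2}=\int_{\mathbb{R}}\left(\sup_{\rho<r_1<r_2}\left|P_*(r_2,k)-P_*(r_1,k)\right|\right)^2\frac{d\sigma(k)}{1+k^2}$$ $$\le C\left(1+\|A\|_{L^2(\mathbb{R}^+)}^2\right)\int_\rho^\infty|A(r)|^2\log^2(2+r)\,dr .$$ Moreover, for Lebesgue a.e. $k\in\mathbb{R}$, the limit $\Pi(k)=\lim_{r\to\infty}P_*(r,k)$ exists.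
   Context: $\mathbb{R}^+=[0,\infty)$. The Krein system with coefficient $A\in L^2_{\rm loc}(\mathbb{R}^+)$ is the Cauchy problem $$\begin{cases}P'(r,k)=ikP(r,k)-\overline{A(r)}\,P_*(r,k),& P(0,k)=1,\\ P_*'(r,k)=-A(r)P(r,k),& P_*(0,k)=1,\end{cases}\qquad k\in\mathbb{C},\ r\ge0,$$ where $'$ is the derivative in $r$; it has a unique solution $(P(r,k),P_*(r,k))$ (absolutely continuous in $r$). By a theorem of Krein there is a measure $\sigma$ on $\mathbb{R}$ (the orthogonality, or spectral, measure of the system) with $\int_{\mathbb{R}}\frac{d\sigma(k)}{1+k^2}<\infty$ and $$\int_{\mathbb{R}}\left|\int_0^a f(r)P(r,k)\,dr\right|^2d\sigma(k)=\int_0^a|f(r)|^2dr$$ for every $f\in L^2(\mathbb{R}^+)$ and every $a>0$. *)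

theory Defs
  imports "HOL-Analysis.Analysis"
begin

text \<open>Absolute continuity of a function on an interval, in the usual epsilon-delta form. The finite
  families of non-overlapping compact subintervals are the library's divisions. (The library
  constant \<open>absolutely_continuous\<close> is about measures.)\<close>

definition abs_continuous_on :: "real set \<Rightarrow> (real \<Rightarrow> 'a::real_normed_vector) \<Rightarrow> bool" where
  "abs_continuous_on S f \<longleftrightarrow>
     (\<forall>\<epsilon>>0. \<exists>\<delta>>0. \<forall>D T. D division_of T \<and> T \<subseteq> S \<and> (\<Sum>K\<in>D. Sup K - Inf K) < \<delta> \<longrightarrow>
        (\<Sum>K\<in>D. norm (f (Sup K) - f (Inf K))) < \<epsilon>)"

definition square_integrable_on :: "(real \<Rightarrow> complex) \<Rightarrow> real set \<Rightarrow> bool"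
    (infix \<open>square'_integrable'_on\<close> 46) where
  "f square_integrable_on S \<longleftrightarrow>
     set_borel_measurable lebesgue S f \<and> set_integrable lebesgue S (\<lambda>x. (cmod (f x))\<^sup>2)"

definition L2_norm_on :: "real set \<Rightarrow> (real \<Rightarrow> complex) \<Rightarrow> real" where
  "L2_norm_on S f = sqrt (LINT x:S|lebesgue. (cmod (f x))\<^sup>2)"

text \<open>The half-line is \<open>{0..}\<close>; values of \<open>A\<close>, \<open>P\<close> and \<open>Ps\<close> (the function \<open>P\<^sub>*\<close>) at negative
  arguments are irrelevant. As the coefficient is only locally square integrable, the differential
  equations hold for almost every \<open>r\<close>, the solution being locally absolutely continuous.\<close>

definition krein_system ::
    "(real \<Rightarrow> complex) \<Rightarrow> (real \<Rightarrow> complex \<Rightarrow> complex) \<Rightarrow> (real \<Rightarrow> complex \<Rightarrow> complex) \<Rightarrow> bool" where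
  "krein_system A P Ps \<longleftrightarrow>
     (\<forall>a>0. A square_integrable_on {0..a}) \<and>
     (\<forall>k. P 0 k = 1 \<and> Ps 0 k = 1 \<and>
        (\<forall>a>0. abs_continuous_on {0..a} (\<lambda>r. P r k) \<and> abs_continuous_on {0..a} (\<lambda>r. Ps r k)) \<and>
        (AE r in lebesgue. r \<ge> 0 \<longrightarrow>
           ((\<lambda>r. P r k) has_vector_derivative \<i> * k * P r k - cnj (A r) * Ps r k)
             (at r within {0..}) \<and>
           ((\<lambda>r. Ps r k) has_vector_derivative - A r * P r k) (at r within {0..})))"

text \<open>The integrals against \<open>\<sigma>\<close> are taken in \<open>ennreal\<close>, so that the isometry includes the
  finiteness of its left-hand side.\<close>

definition orthogonality_measure :: "(real \<Rightarrow> complex \<Rightarrow> complex) \<Rightarrow> real measure \<Rightarrow> bool" where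
  "orthogonality_measure P \<sigma> \<longleftrightarrow>
     sets \<sigma> = sets borel \<and>
     (\<integral>\<^sup>+k. ennreal (1 / (1 + k\<^sup>2)) \<partial>\<sigma>) < \<infinity> \<and>
     (\<forall>f a. f square_integrable_on {0..} \<and> a > 0 \<longrightarrow>
        (\<integral>\<^sup>+k. ennreal ((cmod (LINT r:{0..a}|lebesgue. f r * P r (of_real k)))\<^sup>2) \<partial>\<sigma>) =
        ennreal (LINT r:{0..a}|lebesgue. (cmod (f r))\<^sup>2))"

end

theory Submission
  imports Defs
begin

text \<open>By the isometry, the increments of \<open>P\<^sub>*\<close> over a grid of unit intervals are orthogonal in
  \<open>L\<^sup>2(\<sigma>)\<close>, so the Rademacher--Menshov argument controls their partial sums at the cost of the
  logarithm. Inside a unit interval the increment is at most \<open>\<parallel>A\<parallel> \<parallel>P(\<cdot>, k)\<parallel>\<close> by Cauchy--Schwarz, and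
  \<open>\<integral> \<bar>P(r, k)\<bar>\<^sup>2 / (1 + k\<^sup>2) d\<sigma> \<le> C (1 + \<parallel>A\<parallel>\<^sup>2)\<close> follows from the Christoffel--Darboux formula at \<open>\<i>\<close>.
  This gives the maximal inequality and convergence \<open>\<sigma>\<close>-almost everywhere.

  Convergence Lebesgue-almost everywhere needs that \<open>\<sigma>\<close>-null sets are Lebesgue null, which is half of
  Szego's theorem: since \<open>A \<in> L\<^sup>2\<close>, the function \<open>P(\<cdot>, \<i>)\<close> is in \<open>L\<^sup>2\<close>, so evaluation at \<open>\<i>\<close> is bounded in
  the \<open>L\<^sup>2(\<sigma>)\<close>-norm on the closed span of the \<open>P(r, \<cdot>)\<close>. That span contains enough bounded analytic
  functions to include outer functions that are huge on a given set of positive length.\<close>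

text \<open>The measure \<sigma> is known only through the isometry and its finite weighted mass, so
  facts about it have to be carried over from functions of r. Exponentials need not be square
  integrable against \<sigma>, whereas the integrals \<open>exp_int T k\<close> decay like 1/|k| on
  the real line and are. That these lie in the closed span of the \<open>P r\<close> is not visible
  from the isometry. It comes from a linear integral equation in (T, s) for the products
  \<open>exp_int T k * P s k\<close>, whose free term is an integral of \<open>P\<close>. Picard
  iteration yields approximations of the form \<integral> f P, with one f for all complex k, and
  \<open>P\<close> at T = s = 0 is 1. For r in a bounded interval \<open>P\<close> is bounded
  uniformly in real k, so the iteration converges in L^2(\<sigma>), and it also converges at \<i>.
  Since \<sigma> does not see the point \<i>, approximation is always measured by the L^2(\<sigma>)
  distance together with the difference of the values at \<i>.\<close>

section \<open>Absolutely continuous functions\<close>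

lemma abs_continuous_onD:
  assumes "abs_continuous_on S f" "\<epsilon> > 0"
  obtains \<delta> where "\<delta> > 0"
    "\<And>D T. D division_of T \<Longrightarrow> T \<subseteq> S \<Longrightarrow> (\<Sum>K\<in>D. Sup K - Inf K) < \<delta> \<Longrightarrow>
       (\<Sum>K\<in>D. norm (f (Sup K) - f (Inf K))) < \<epsilon>"
  using assms unfolding abs_continuous_on_def by meson

lemma division_of_real_cases:
  fixes T :: "real set"
  assumes "D division_of T" "K \<in> D"
  obtains u v where "u \<le> v" "K = {u..v}" "Sup K = v" "Inf K = u" "u \<in> T" "v \<in> T"
proof -
  obtain u v where K: "K = cbox u v" using division_ofD(4)[OF assms] by blast
  have "K \<noteq> {}" using division_ofD(3)[OF assms] .
  then have "u \<le> v" using K by simp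
  moreover have "K \<subseteq> T" using division_ofD(2)[OF assms] .
  ultimately show ?thesis using that[of u v] K by (simp add: subset_iff)
qed

lemma abs_continuous_on_imp_continuous_on:
  fixes f :: "real \<Rightarrow> 'a::real_normed_vector"
  assumes "abs_continuous_on {a..b} f"
  shows "continuous_on {a..b} f"
  unfolding continuous_on_iff
proof (intro ballI allI impI)
  fix x e :: real assume x: "x \<in> {a..b}" and e: "e > 0"
  obtain d where d: "d > 0" "\<And>D T. D division_of T \<Longrightarrow> T \<subseteq> {a..b} \<Longrightarrow> (\<Sum>K\<in>D. Sup K - Inf K) < d \<Longrightarrow>
       (\<Sum>K\<in>D. norm (f (Sup K) - f (Inf K))) < e"
    by (rule abs_continuous_onD[OF assms e], rule that) blast+
  have *: "norm (f v - f u) < e" if "u \<in> {a..b}" "v \<in> {a..b}" "u \<le> v" "v - u < d" for u v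
    using d(2)[of "{{u..v}}" "{u..v}"] that division_of_self[of u v] by (auto simp: cbox_interval)
  show "\<exists>d>0. \<forall>x'\<in>{a..b}. dist x' x < d \<longrightarrow> dist (f x') (f x) < e"
  proof (intro exI[of _ d] conjI ballI impI)
    fix y assume y: "y \<in> {a..b}" "dist y x < d"
    show "dist (f y) (f x) < e"
      using *[of x y] *[of y x] x y by (cases "x \<le> y") (auto simp: dist_norm norm_minus_commute)
  qed (use d in auto)
qed

lemma abs_continuous_on_subset:
  "abs_continuous_on S f \<Longrightarrow> T \<subseteq> S \<Longrightarrow> abs_continuous_on T f"
  unfolding abs_continuous_on_def by (meson order_trans)

text \<open>Common source of the closure properties below: differences, conjugates, products and
  Lipschitz functions all have increments dominated by those of two absolutely continuous functions,
  and the smaller of the two deltas serves both.\<close>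

lemma abs_continuous_on_bounded_increments:
  fixes f :: "real \<Rightarrow> 'a::real_normed_vector" and h :: "real \<Rightarrow> 'b::real_normed_vector"
    and g :: "real \<Rightarrow> 'c::real_normed_vector"
  assumes f: "abs_continuous_on S f" and g: "abs_continuous_on S g" and "B > 0"
    and h: "\<And>u v. u \<in> S \<Longrightarrow> v \<in> S \<Longrightarrow> u \<le> v \<Longrightarrow> norm (h v - h u) \<le> B * (norm (f v - f u) + norm (g v - g u))"
  shows "abs_continuous_on S h"
  unfolding abs_continuous_on_def
proof (intro allI impI)
  fix e :: real assume e: "e > 0"
  then have e': "e / (2 * B) > 0" using \<open>B > 0\<close> by simp
  obtain d1 where d1: "d1 > 0" "\<And>D T. D division_of T \<Longrightarrow> T \<subseteq> S \<Longrightarrow> (\<Sum>K\<in>D. Sup K - Inf K) < d1 \<Longrightarrow>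
       (\<Sum>K\<in>D. norm (f (Sup K) - f (Inf K))) < e / (2*B)"
    by (rule abs_continuous_onD[OF f e'], rule that) blast+
  obtain d2 where d2: "d2 > 0" "\<And>D T. D division_of T \<Longrightarrow> T \<subseteq> S \<Longrightarrow> (\<Sum>K\<in>D. Sup K - Inf K) < d2 \<Longrightarrow>
       (\<Sum>K\<in>D. norm (g (Sup K) - g (Inf K))) < e / (2*B)"
    by (rule abs_continuous_onD[OF g e'], rule that) blast+
  show "\<exists>\<delta>>0. \<forall>D T. D division_of T \<and> T \<subseteq> S \<and> (\<Sum>K\<in>D. Sup K - Inf K) < \<delta> \<longrightarrow>
        (\<Sum>K\<in>D. norm (h (Sup K) - h (Inf K))) < e"
  proof (intro exI[of _ "min d1 d2"] conjI allI impI; (elim conjE)?)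
    fix D T assume D: "D division_of T" "T \<subseteq> S" "(\<Sum>K\<in>D. Sup K - Inf K) < min d1 d2"
    have "(\<Sum>K\<in>D. norm (h (Sup K) - h (Inf K)))
        \<le> (\<Sum>K\<in>D. B * (norm (f (Sup K) - f (Inf K)) + norm (g (Sup K) - g (Inf K))))"
    proof (rule sum_mono)
      fix K assume "K \<in> D"
      then obtain u v where "u \<le> v" "Sup K = v" "Inf K = u" "u \<in> T" "v \<in> T"
        using division_of_real_cases[OF D(1)] by metis
      then show "norm (h (Sup K) - h (Inf K)) \<le> B * (norm (f (Sup K) - f (Inf K)) + norm (g (Sup K) - g (Inf K)))"
        using h D(2) by auto
    qed
    also have "\<dots> = B * ((\<Sum>K\<in>D. norm (f (Sup K) - f (Inf K))) + (\<Sum>K\<in>D. norm (g (Sup K) - g (Inf K))))"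
      by (simp add: sum_distrib_left sum.distrib distrib_left)
    also have "\<dots> < B * (e / (2*B) + e / (2*B))"
      using D d1(2)[OF D(1,2)] d2(2)[OF D(1,2)] \<open>B > 0\<close>
      by (intro mult_strict_left_mono add_strict_mono) auto
    also have "\<dots> = e" using \<open>B > 0\<close> by simp
    finally show "(\<Sum>K\<in>D. norm (h (Sup K) - h (Inf K))) < e" .
  qed (use d1 d2 in auto)
qed

lemma abs_continuous_on_lipschitz:
  fixes f :: "real \<Rightarrow> 'a::real_normed_vector"
  assumes "\<And>u v. u \<in> S \<Longrightarrow> v \<in> S \<Longrightarrow> u \<le> v \<Longrightarrow> norm (f v - f u) \<le> B * (v - u)"
  shows "abs_continuous_on S f"
proof -
  have id: "abs_continuous_on S (\<lambda>x::real. x)"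
    unfolding abs_continuous_on_def
  proof (intro allI impI)
    fix e :: real assume "e > 0"
    then show "\<exists>\<delta>>0. \<forall>D T. D division_of T \<and> T \<subseteq> S \<and> (\<Sum>K\<in>D. Sup K - Inf K) < \<delta> \<longrightarrow>
        (\<Sum>K\<in>D. norm (Sup K - Inf K)) < e"
    proof (intro exI[of _ e] conjI allI impI; (elim conjE)?)
      fix D T assume D: "D division_of T" "T \<subseteq> S" "(\<Sum>K\<in>D. Sup K - Inf K) < e"
      have "(\<Sum>K\<in>D. norm (Sup K - Inf K)) = (\<Sum>K\<in>D. Sup K - Inf K)"
      proof (rule sum.cong[OF refl])
        fix K assume "K \<in> D"
        then obtain u v where "u \<le> v" "Sup K = v" "Inf K = u"
          using division_of_real_cases[OF D(1)] by metis
        then show "norm (Sup K - Inf K) = Sup K - Inf K" by simp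
      qed
      then show "(\<Sum>K\<in>D. norm (Sup K - Inf K)) < e" using D by simp
    qed auto
  qed
  show ?thesis
  \<comment> \<open>The criterion asks for a positive constant, which \<open>B\<close> may fail to
    be.\<close>
  proof (rule abs_continuous_on_bounded_increments[OF id id, where B = "max B 1"])
    fix u v assume *: "u \<in> S" "v \<in> S" "u \<le> v"
    have "norm (f v - f u) \<le> B * (v - u)" using assms[OF *] .
    also have "\<dots> \<le> max B 1 * (v - u)" using * by (intro mult_right_mono) auto
    also have "\<dots> \<le> max B 1 * (norm (v - u) + norm (v - u))" using * by (intro mult_left_mono) auto
    finally show "norm (f v - f u) \<le> max B 1 * (norm (v - u) + norm (v - u))" .
  qed auto
qed

lemma abs_continuous_on_diff:
  fixes f g :: "real \<Rightarrow> 'a::real_normed_vector"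
  assumes "abs_continuous_on S f" "abs_continuous_on S g"
  shows "abs_continuous_on S (\<lambda>x. f x - g x)"
proof (rule abs_continuous_on_bounded_increments[OF assms, where B = 1])
  fix u v
  have "f v - g v - (f u - g u) = (f v - f u) - (g v - g u)" by simp
  then show "norm (f v - g v - (f u - g u)) \<le> 1 * (norm (f v - f u) + norm (g v - g u))"
    by (metis mult_1 norm_triangle_ineq4)
qed auto

lemma abs_continuous_on_cnj:
  assumes "abs_continuous_on S f"
  shows "abs_continuous_on S (\<lambda>x. cnj (f x))"
  by (rule abs_continuous_on_bounded_increments[OF assms assms, where B = 1])
    (auto simp flip: complex_cnj_diff)

lemma abs_continuous_on_mult:
  fixes f g :: "real \<Rightarrow> 'a::real_normed_algebra"
  assumes f: "abs_continuous_on {a..b} f" and g: "abs_continuous_on {a..b} g"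
  shows "abs_continuous_on {a..b} (\<lambda>x. f x * g x)"
proof -
  have "bounded (f ` {a..b})" "bounded (g ` {a..b})"
    using abs_continuous_on_imp_continuous_on[OF f] abs_continuous_on_imp_continuous_on[OF g]
    by (auto intro!: compact_imp_bounded compact_continuous_image)
  then obtain F G where F: "\<And>x. x \<in> {a..b} \<Longrightarrow> norm (f x) \<le> F" and G: "\<And>x. x \<in> {a..b} \<Longrightarrow> norm (g x) \<le> G"
    by (metis bounded_iff imageI)
  define B where "B = max 1 (max F G)"
  have B: "B > 0" "\<And>x. x \<in> {a..b} \<Longrightarrow> norm (f x) \<le> B" "\<And>x. x \<in> {a..b} \<Longrightarrow> norm (g x) \<le> B"
    using F G by (auto simp: B_def le_max_iff_disj)
  show ?thesis
  proof (rule abs_continuous_on_bounded_increments[OF f g, where B = B])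
    fix u v assume uv: "u \<in> {a..b}" "v \<in> {a..b}" "u \<le> v"
    have "f v * g v - f u * g u = (f v - f u) * g v + f u * (g v - g u)" by (simp add: algebra_simps)
    then have "norm (f v * g v - f u * g u) \<le> norm (f v - f u) * norm (g v) + norm (f u) * norm (g v - g u)"
      by (metis norm_triangle_le add_mono norm_mult_ineq)
    also have "\<dots> \<le> norm (f v - f u) * B + B * norm (g v - g u)"
      using B uv by (intro add_mono mult_mono) (auto intro: less_imp_le)
    finally show "norm (f v * g v - f u * g u) \<le> B * (norm (f v - f u) + norm (g v - g u))"
      by (simp add: algebra_simps)
  qed (use B in auto)
qed

text \<open>On the exceptional null set the gauge is an open set of small measure, so that absolute
  continuity controls the increments there; elsewhere it is the usual derivative gauge.\<close>

theorem fundamental_theorem_of_calculus_abs_continuous: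
  fixes f :: "real \<Rightarrow> 'a::banach"
  assumes "a \<le> b" and ac: "abs_continuous_on {a..b} f" and N: "negligible N"
    and der: "\<And>x. x \<in> {a..b} - N \<Longrightarrow> (f has_vector_derivative g x) (at x within {a..b})"
  shows "(g has_integral (f b - f a)) {a..b}"
proof -
  \<comment> \<open>With the value 0 on \<open>N\<close>, a tag in \<open>N\<close> contributes only
    the increment of \<open>f\<close>, which absolute continuity makes small. Altering the integrand
    on \<open>N\<close> does not change the integral.\<close>
  define g0 where "g0 x = (if x \<in> N then 0 else g x)" for x
  have "(g0 has_integral (f b - f a)) {a..b}"
    unfolding has_integral_real
  proof (intro allI impI)
    fix e :: real assume e: "e > 0"
    \<comment> \<open>The \<open>+ 1\<close> keeps the denominator positive when
      \<open>a = b\<close>.\<close>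
    define e' where "e' = e / (2 * (b - a + 1))"
    have e': "e' > 0" using e \<open>a \<le> b\<close> by (simp add: e'_def)
    obtain \<delta> where \<delta>: "\<delta> > 0" "\<And>D T. D division_of T \<Longrightarrow> T \<subseteq> {a..b} \<Longrightarrow> (\<Sum>K\<in>D. Sup K - Inf K) < \<delta> \<Longrightarrow>
       (\<Sum>K\<in>D. norm (f (Sup K) - f (Inf K))) < e / 2"
      by (rule abs_continuous_onD[OF ac half_gt_zero[OF e]], rule that) blast+
    have "N \<in> null_sets lebesgue" using N by (simp add: negligible_iff_null_sets)
    then obtain U where U: "open U" "N \<subseteq> U" "U - N \<in> lmeasurable" "emeasure lebesgue (U - N) < ennreal \<delta>"
      using sets_lebesgue_outer_open[of N \<delta>] \<delta>(1) by (auto simp: null_sets_def)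
    have Um: "U \<in> lmeasurable"
    proof -
      have "U = (U - N) \<union> N" using U by auto
      moreover have "N \<in> lmeasurable" using N by (simp add: negligible_iff_measure)
      ultimately show ?thesis using U(3) by (metis fmeasurable.Un)
    qed
    have "measure lebesgue (U - N) < \<delta>"
      using U(3,4) \<delta>(1) by (simp add: emeasure_eq_measure2 ennreal_less_iff)
    then have mU: "measure lebesgue U < \<delta>"
      using measure_Diff_null_set[of U lebesgue N] \<open>N \<in> null_sets lebesgue\<close> Um by (simp add: fmeasurableD)
    have "\<forall>x. \<exists>d>0. x \<in> {a..b} - N \<longrightarrow>
         (\<forall>y\<in>{a..b}. norm (y-x) < d \<longrightarrow> norm (f y - f x - (y-x) *\<^sub>R g x) \<le> e' * norm (y-x))"
      using der[unfolded has_vector_derivative_def has_derivative_within_alt] e' by (metis zero_less_one)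
    then obtain d where d: "\<And>x. 0 < d x"
                 "\<And>x y. \<lbrakk>x \<in> {a..b} - N; y \<in> {a..b}; norm (y-x) < d x\<rbrakk>
                        \<Longrightarrow> norm (f y - f x - (y-x) *\<^sub>R g x) \<le> e' * norm (y-x)"
      by metis
    define \<gamma> where "\<gamma> x = (if x \<in> N then U else ball x (d x))" for x
    have gauge: "gauge \<gamma>" using d(1) U by (auto simp: gauge_def \<gamma>_def)
    have small: "norm ((\<Sum>(x,k)\<in>p. measure lborel k *\<^sub>R g0 x) - (f b - f a)) < e"
      if p: "p tagged_division_of {a..b}" and fine: "\<gamma> fine p" for p
    proof -
      have finp: "finite p" using p by auto
      define p1 where "p1 = {(x,K)\<in>p. x \<in> N}"
      define p2 where "p2 = p - p1"
      \<comment> \<open>The case split fixes the value on the empty set, where \<open>Sup\<close>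
        and \<open>Inf\<close> carry no information: the passage from tagged pairs to intervals
        demands that degenerate boxes contribute 0.\<close>
      define \<Delta> where "\<Delta> K = (if K = {} then 0 else f (Sup K) - f (Inf K))" for K
      have p12: "p = p1 \<union> p2" "p1 \<inter> p2 = {}" "finite p1" "finite p2" using finp by (auto simp: p1_def p2_def intro: finite_subset)
      have interval: "\<exists>u v. u \<le> v \<and> K = {u..v} \<and> x \<in> {u..v} \<and> {u..v} \<subseteq> {a..b}" if xKp: "(x,K) \<in> p" for x K
      proof -
        obtain u v where "K = cbox u v" using tagged_division_ofD(4)[OF p xKp] by blast
        moreover have "x \<in> K" "K \<subseteq> {a..b}" using tagged_division_ofD(2,3)[OF p xKp] by auto
        ultimately show ?thesis by (intro exI[of _ u] exI[of _ v]) auto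
      qed
      have "(\<Sum>(x,K)\<in>p. \<Delta> K) = (\<Sum>(x,K)\<in>p. f (Sup K) - f (Inf K))"
        using interval by (intro sum.cong) (fastforce simp: \<Delta>_def)+
      then have ba: "f b - f a = (\<Sum>(x,K)\<in>p. \<Delta> K)" "b - a = (\<Sum>(x,K)\<in>p. Sup K - Inf K)"
        using additive_tagged_division_1[OF \<open>a \<le> b\<close> p, of f] additive_tagged_division_1[OF \<open>a \<le> b\<close> p, of "\<lambda>x. x"] by auto
      have p1part: "p1 tagged_partial_division_of {a..b}"
        using p unfolding tagged_division_of_def by (auto simp: p1_def intro: tagged_partial_division_subset)
      have p1div: "p1 tagged_division_of \<Union>(snd ` p1)"
        by (rule tagged_partial_division_of_Union_self[OF p1part])
      have div1: "(snd ` p1) division_of \<Union>(snd ` p1)"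
        by (rule division_of_tagged_division[OF p1div])
      have sub: "\<Union>(snd ` p1) \<subseteq> {a..b}" using interval by (fastforce simp: p1_def)
      have len: "(\<Sum>K\<in>snd ` p1. Sup K - Inf K) = (\<Sum>K\<in>snd ` p1. measure lebesgue K)"
      proof (rule sum.cong[OF refl])
        fix K assume "K \<in> snd ` p1"
        then obtain u v where "u \<le> v" "K = {u..v}" using interval by (force simp: p1_def)
        then show "Sup K - Inf K = measure lebesgue K" by simp
      qed
      also have "\<dots> = measure lebesgue (\<Union>(snd ` p1))" by (rule content_division[OF div1])
      also have "\<dots> \<le> measure lebesgue U"
      proof (rule measure_mono_fmeasurable)
        show "\<Union>(snd ` p1) \<subseteq> U" using fine by (fastforce simp: p1_def fine_def \<gamma>_def)
        show "\<Union>(snd ` p1) \<in> sets lebesgue"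
          using lmeasurable_division[OF div1] by (simp add: fmeasurableD)
      qed (rule Um)
      finally have "(\<Sum>K\<in>snd ` p1. norm (f (Sup K) - f (Inf K))) < e / 2"
        using mU by (intro \<delta>(2)[OF div1 sub]) auto
      moreover have "(\<Sum>K\<in>snd ` p1. norm (\<Delta> K)) = (\<Sum>K\<in>snd ` p1. norm (f (Sup K) - f (Inf K)))"
        using division_ofD(3)[OF div1] by (intro sum.cong) (auto simp: \<Delta>_def)
      moreover have "(\<Sum>(x,K)\<in>p1. norm (\<Delta> K)) = (\<Sum>K\<in>snd ` p1. norm (\<Delta> K))"
      proof (rule sum.over_tagged_division_lemma[OF p1div])
        fix u v :: real assume "box u v = {}"
        then have "v \<le> u" by simp
        then show "norm (\<Delta> (cbox u v)) = 0" by (cases "u = v") (auto simp: \<Delta>_def)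
      qed
      ultimately have S1: "(\<Sum>(x,K)\<in>p1. norm (\<Delta> K)) < e / 2" by simp
      \<comment> \<open>Straddle estimate: the tag lies between the end points, so the errors at the
        two ends add up to exactly \<open>e'\<close> times the length.\<close>
      have S2: "norm (measure lborel K *\<^sub>R g0 x - \<Delta> K) \<le> e' * (Sup K - Inf K)" if xK: "(x,K) \<in> p2" for x K
      proof -
        have xp: "(x,K) \<in> p" and xN: "x \<notin> N" using xK by (auto simp: p2_def p1_def)
        obtain u v where uv: "u \<le> v" "K = {u..v}" "x \<in> {u..v}" "{u..v} \<subseteq> {a..b}" using interval[OF xp] by blast
        have "K \<subseteq> \<gamma> x" using fine xp by (auto simp: fine_def)
        then have ball: "K \<subseteq> ball x (d x)" using xN by (simp add: \<gamma>_def)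
        have uK: "u \<in> ball x (d x)" "v \<in> ball x (d x)" using uv(1) by (intro subsetD[OF ball]; simp add: uv(2))+
        have "norm ((v - u) *\<^sub>R g x - (f v - f u)) = norm (f u - f x - (u - x) *\<^sub>R g x - (f v - f x - (v - x) *\<^sub>R g x))"
          by (auto simp: algebra_simps)
        also have "\<dots> \<le> norm (f u - f x - (u - x) *\<^sub>R g x) + norm (f v - f x - (v - x) *\<^sub>R g x)"
          by (rule norm_triangle_ineq4)
        also have "\<dots> \<le> e' * norm (u - x) + e' * norm (v - x)"
          using uK uv xN by (intro add_mono d(2)) (auto simp: dist_norm norm_minus_commute)
        also have "\<dots> = e' * (v - u)" using uv by (simp add: algebra_simps)
        finally show ?thesis using uv xN by (simp add: \<Delta>_def g0_def)
      qed
      have "norm ((\<Sum>(x,k)\<in>p. measure lborel k *\<^sub>R g0 x) - (f b - f a))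
          = norm (\<Sum>(x,K)\<in>p. measure lborel K *\<^sub>R g0 x - \<Delta> K)"
        unfolding ba by (simp add: sum_subtractf case_prod_unfold)
      also have "\<dots> \<le> (\<Sum>(x,K)\<in>p. norm (measure lborel K *\<^sub>R g0 x - \<Delta> K))"
        by (rule order_trans[OF norm_sum]) (simp add: case_prod_unfold)
      also have "\<dots> = (\<Sum>(x,K)\<in>p1. norm (measure lborel K *\<^sub>R g0 x - \<Delta> K)) + (\<Sum>(x,K)\<in>p2. norm (measure lborel K *\<^sub>R g0 x - \<Delta> K))"
        using p12 by (simp add: sum.union_disjoint)
      also have "(\<Sum>(x,K)\<in>p1. norm (measure lborel K *\<^sub>R g0 x - \<Delta> K)) = (\<Sum>(x,K)\<in>p1. norm (\<Delta> K))"
        by (rule sum.cong) (auto simp: p1_def g0_def)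
      also have "(\<Sum>(x,K)\<in>p2. norm (measure lborel K *\<^sub>R g0 x - \<Delta> K)) \<le> (\<Sum>(x,K)\<in>p2. e' * (Sup K - Inf K))"
        by (rule sum_mono) (use S2 in auto)
      also have "(\<Sum>(x,K)\<in>p2. e' * (Sup K - Inf K)) \<le> (\<Sum>(x,K)\<in>p. e' * (Sup K - Inf K))"
      proof (rule sum_mono2[OF finp])
        fix y assume "y \<in> p - p2"
        moreover obtain x K where "y = (x, K)" by (cases y)
        ultimately obtain u v where "y = (x, {u..v})" "u \<le> v" using interval by blast
        then show "0 \<le> (case y of (x, K) \<Rightarrow> e' * (Sup K - Inf K))" using e' by simp
      qed (simp add: p2_def)
      also have "\<dots> = e' * (b - a)" unfolding ba(2) by (simp add: sum_distrib_left case_prod_unfold)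
      also have "\<dots> \<le> e / 2" using e \<open>a \<le> b\<close> by (simp add: e'_def field_simps)
      finally show ?thesis using S1 by simp
    qed
    show "\<exists>\<gamma>. gauge \<gamma> \<and> (\<forall>\<D>. \<D> tagged_division_of {a..b} \<and> \<gamma> fine \<D> \<longrightarrow>
        norm ((\<Sum>(x,k)\<in>\<D>. measure lborel k *\<^sub>R g0 x) - (f b - f a)) < e)"
      using gauge small by (intro exI[of _ \<gamma>] conjI allI impI) simp_all
  qed
  then show ?thesis
    by (rule has_integral_spike[OF N, rotated]) (auto simp: g0_def)
qed

text \<open>Turns the gauge integral into a Lebesgue integral. The gauge theorem does not provide
  absolute integrability of \<open>g\<close>, so each caller supplies it.\<close>

lemma set_integral_abs_continuous_derivative:
  fixes f g :: "real \<Rightarrow> 'a::euclidean_space"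
  assumes "a \<le> b" "abs_continuous_on {a..b} f" "set_integrable lborel {a..b} g"
    and der: "AE x in lebesgue. x \<in> {a..b} \<longrightarrow> (f has_vector_derivative g x) (at x within {a..b})"
  shows "(LINT x:{a..b}|lborel. g x) = f b - f a"
proof -
  obtain N where N: "N \<in> null_sets lebesgue"
    "\<And>x. x \<in> space lebesgue - N \<Longrightarrow> x \<in> {a..b} \<longrightarrow> (f has_vector_derivative g x) (at x within {a..b})"
    using AE_E3[OF der] by blast
  have "(g has_integral (f b - f a)) {a..b}"
    by (rule fundamental_theorem_of_calculus_abs_continuous[OF assms(1,2), of N])
      (use N in \<open>auto simp: negligible_iff_null_sets\<close>)
  then show ?thesis
    using set_borel_integral_eq_integral(2)[OF assms(3)] by (simp add: integral_unique)
qed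

section \<open>Krein systems\<close>

lemma Cauchy_Schwarz_integral:
  fixes f g :: "'a \<Rightarrow> real"
  assumes [measurable]: "f \<in> borel_measurable M" "g \<in> borel_measurable M"
    and f: "integrable M (\<lambda>x. (f x)\<^sup>2)" and g: "integrable M (\<lambda>x. (g x)\<^sup>2)"
  shows "integrable M (\<lambda>x. f x * g x)"
    and "(\<integral>x. f x * g x \<partial>M)\<^sup>2 \<le> (\<integral>x. (f x)\<^sup>2 \<partial>M) * (\<integral>x. (g x)\<^sup>2 \<partial>M)"
proof -
  have ab: "\<bar>a * b\<bar> \<le> a\<^sup>2 + b\<^sup>2" for a b :: real
  proof -
    have "2 * (\<bar>a\<bar> * \<bar>b\<bar>) \<le> \<bar>a\<bar>\<^sup>2 + \<bar>b\<bar>\<^sup>2" using sum_squares_bound[of "\<bar>a\<bar>" "\<bar>b\<bar>"] by simp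
    moreover have "0 \<le> \<bar>a\<bar> * \<bar>b\<bar>" by simp
    ultimately show ?thesis unfolding abs_mult power2_abs by linarith
  qed
  show int: "integrable M (\<lambda>x. f x * g x)"
    by (rule Bochner_Integration.integrable_bound[OF Bochner_Integration.integrable_add[OF f g]]) (use ab in \<open>auto simp: abs_mult\<close>)
  define F where "F = (\<integral>x. (f x)\<^sup>2 \<partial>M)"
  define G where "G = (\<integral>x. (g x)\<^sup>2 \<partial>M)"
  define I where "I = (\<integral>x. f x * g x \<partial>M)"
  \<comment> \<open>The integral of (t f + g)^2 as a quadratic polynomial in t. Its nonnegativity at
    one suitable t settles each of the two cases.\<close>
  have quad: "0 \<le> t\<^sup>2 * F + 2 * t * I + G" for t
  proof -
    have "0 \<le> (\<integral>x. (t * f x + g x)\<^sup>2 \<partial>M)" by simp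
    also have "\<dots> = (\<integral>x. t\<^sup>2 * (f x)\<^sup>2 + 2 * t * (f x * g x) + (g x)\<^sup>2 \<partial>M)"
      by (simp add: power2_sum power_mult_distrib algebra_simps)
    also have "\<dots> = t\<^sup>2 * F + 2 * t * I + G"
      unfolding F_def G_def I_def using f g int by simp
    finally show ?thesis .
  qed
  have F: "F \<ge> 0" by (simp add: F_def)
  have "I\<^sup>2 \<le> F * G"
  proof (cases "F = 0")
    case True
    have "I = 0"
    proof (rule ccontr)
      assume "I \<noteq> 0"
      \<comment> \<open>With \<open>F = 0\<close>, the polynomial takes the value -1 at this
        point.\<close>
      then show False using quad[of "-(G + 1) / (2 * I)"] True by (simp add: field_simps)
    qed
    then show ?thesis using True by simp
  next
    case False
    then have "F > 0" using F by simp
    moreover have "(- I / F)\<^sup>2 * F + 2 * (- I / F) * I + G = G - I\<^sup>2 / F"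
      using False by (simp add: field_simps power2_eq_square)
    ultimately have "I\<^sup>2 / F \<le> G" using quad[of "- I / F"] by simp
    then show ?thesis using \<open>F > 0\<close> by (simp add: pos_divide_le_eq mult.commute)
  qed
  then show "(\<integral>x. f x * g x \<partial>M)\<^sup>2 \<le> (\<integral>x. (f x)\<^sup>2 \<partial>M) * (\<integral>x. (g x)\<^sup>2 \<partial>M)"
    by (simp add: F_def G_def I_def)
qed

lemma Cauchy_Schwarz_set_integral:
  fixes f g :: "'a \<Rightarrow> real"
  assumes m: "set_borel_measurable M S f" "set_borel_measurable M S g"
    and f: "set_integrable M S (\<lambda>x. (f x)\<^sup>2)" and g: "set_integrable M S (\<lambda>x. (g x)\<^sup>2)"
  shows "set_integrable M S (\<lambda>x. f x * g x)"
    and "(LINT x:S|M. f x * g x)\<^sup>2 \<le> (LINT x:S|M. (f x)\<^sup>2) * (LINT x:S|M. (g x)\<^sup>2)"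
proof -
  have eq: "(indicator S x * a) * (indicator S x * b) = indicator S x * (a * b)" for x and a b :: real
    by (simp add: indicator_def)
  have eq2: "(indicator S x * a)\<^sup>2 = indicator S x * a\<^sup>2" for x and a :: real
    by (simp add: indicator_def)
  show "set_integrable M S (\<lambda>x. f x * g x)"
    using Cauchy_Schwarz_integral(1)[of "\<lambda>x. indicator S x * f x" M "\<lambda>x. indicator S x * g x"] assms
    by (simp add: set_integrable_def set_borel_measurable_def eq eq2)
  show "(LINT x:S|M. f x * g x)\<^sup>2 \<le> (LINT x:S|M. (f x)\<^sup>2) * (LINT x:S|M. (g x)\<^sup>2)"
    using Cauchy_Schwarz_integral(2)[of "\<lambda>x. indicator S x * f x" M "\<lambda>x. indicator S x * g x"] assms
    by (simp add: set_integrable_def set_borel_measurable_def set_lebesgue_integral_def eq eq2)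
qed

lemma set_integrable_norm_cancel:
  fixes f :: "'a \<Rightarrow> 'b::{second_countable_topology,banach}"
  assumes "set_borel_measurable M S f" "set_integrable M S (\<lambda>x. norm (f x))"
  shows "set_integrable M S f"
proof -
  have "integrable M (\<lambda>x. norm (indicat_real S x *\<^sub>R f x))"
    using assms(2) by (simp add: set_integrable_def)
  then show ?thesis
    using assms(1) unfolding set_integrable_def set_borel_measurable_def by (rule integrable_norm_iff[THEN iffD1, rotated])
qed

lemma set_integrable_mult_continuous_on:
  fixes f g :: "real \<Rightarrow> 'a::{real_normed_algebra,second_countable_topology,banach}"
  assumes f: "set_integrable lborel {a..b} f" and g: "continuous_on {a..b} g"
  shows "set_integrable lborel {a..b} (\<lambda>x. f x * g x)"
proof -
  obtain B where B: "\<And>x. x \<in> {a..b} \<Longrightarrow> norm (g x) \<le> B"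
    using compact_imp_bounded[OF compact_continuous_image[OF g compact_Icc]] by (metis bounded_iff imageI)
  have "set_borel_measurable lborel {a..b} g"
    unfolding set_borel_measurable_def using borel_measurable_continuous_on_indicator[OF _ g] by simp
  moreover have "set_borel_measurable lborel {a..b} f"
    using f unfolding set_integrable_def set_borel_measurable_def by (rule borel_measurable_integrable)
  ultimately have m: "(\<lambda>x. (indicator {a..b} x *\<^sub>R f x) * (indicator {a..b} x *\<^sub>R g x)) \<in> borel_measurable lborel"
    unfolding set_borel_measurable_def by measurable
  have eq: "(\<lambda>x. (indicator {a..b} x *\<^sub>R f x) * (indicator {a..b} x *\<^sub>R g x)) = (\<lambda>x. indicator {a..b} x *\<^sub>R (f x * g x))"
    by (auto simp: indicator_def)
  have fn: "integrable lborel (\<lambda>x. B * norm (indicator {a..b} x *\<^sub>R f x))"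
    using f unfolding set_integrable_def by (intro integrable_mult_right integrable_norm)
  show ?thesis
    unfolding set_integrable_def
  proof (rule Bochner_Integration.integrable_bound[OF fn])
    show "(\<lambda>x. indicator {a..b} x *\<^sub>R (f x * g x)) \<in> borel_measurable lborel" using m unfolding eq .
    show "AE x in lborel. norm (indicator {a..b} x *\<^sub>R (f x * g x)) \<le> norm (B * norm (indicator {a..b} x *\<^sub>R f x))"
    proof (rule AE_I2)
      fix x
      show "norm (indicator {a..b} x *\<^sub>R (f x * g x)) \<le> norm (B * norm (indicator {a..b} x *\<^sub>R f x))"
      proof (cases "x \<in> {a..b}")
        case True
        have "norm (f x * g x) \<le> norm (f x) * norm (g x)" by (rule norm_mult_ineq)
        also have "\<dots> \<le> norm (f x) * \<bar>B\<bar>" using B[OF True] by (intro mult_left_mono) auto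
        finally show ?thesis using True by (simp add: abs_mult mult.commute)
      qed simp
    qed
  qed
qed

lemma set_integrable_subinterval:
  fixes f :: "real \<Rightarrow> 'a::{second_countable_topology,banach}"
  assumes "set_integrable lborel S f" "{a..b} \<subseteq> S"
  shows "set_integrable lborel {a..b} f"
  using set_integrable_subset[OF assms(1) _ assms(2)] by simp

lemma set_integral_norm_mono:
  fixes f :: "'a \<Rightarrow> 'b::{second_countable_topology,banach}"
  assumes "set_integrable M S f" "set_integrable M S g" "\<And>x. x \<in> S \<Longrightarrow> norm (f x) \<le> g x"
  shows "norm (LINT x:S|M. f x) \<le> (LINT x:S|M. g x)"
proof -
  have "norm (LINT x:S|M. f x) \<le> (LINT x:S|M. norm (f x))"
    unfolding set_lebesgue_integral_def
    by (rule order_trans[OF integral_norm_bound]) (auto intro!: integral_mono_AE simp: integrable_norm assms(1)[unfolded set_integrable_def])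
  also have "\<dots> \<le> (LINT x:S|M. g x)"
    using assms by (intro set_integral_mono set_integrable_norm) auto
  finally show ?thesis .
qed

lemma set_integral_mono_subset:
  fixes f :: "'a \<Rightarrow> real"
  assumes "set_integrable M T f" "S \<subseteq> T" "S \<in> sets M" "\<And>x. x \<in> T \<Longrightarrow> f x \<ge> 0"
  shows "(LINT x:S|M. f x) \<le> (LINT x:T|M. f x)"
  unfolding set_lebesgue_integral_def
proof (rule integral_mono)
  show "integrable M (\<lambda>x. indicat_real S x *\<^sub>R f x)"
    using set_integrable_subset[OF assms(1,3,2)] by (simp add: set_integrable_def)
  show "integrable M (\<lambda>x. indicat_real T x *\<^sub>R f x)" using assms(1) by (simp add: set_integrable_def)
  show "indicat_real S x *\<^sub>R f x \<le> indicat_real T x *\<^sub>R f x" for x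
    using assms(2,4) by (auto simp: indicator_def)
qed

lemma set_integral_Icc_diff:
  fixes f :: "real \<Rightarrow> real"
  assumes "a \<le> b" "b \<le> c" "set_integrable lborel {a..c} f"
  shows "(LINT x:{b..c}|lborel. f x) = (LINT x:{a..c}|lborel. f x) - (LINT x:{a..b}|lborel. f x)"
proof -
  have i: "set_integrable lborel {a..b} f" "set_integrable lborel {b..c} f"
    using assms by (auto intro!: set_integrable_subinterval[OF assms(3)])
  have "(LINT x:{a..c}|lborel. f x) = (LINT x:{a..b} \<union> {b..c}|lborel. f x)"
    using assms by (simp add: ivl_disj_un_two_touch)
  also have "\<dots> = (LINT x:{a..b}|lborel. f x) + (LINT x:{b..c}|lborel. f x)"
  proof (rule set_integral_Un_AE[OF _ _ _ i])
    show "AE x in lborel. \<not> (x \<in> {a..b} \<and> x \<in> {b..c})"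
      using AE_lborel_singleton[of b] by eventually_elim auto
  qed auto
  finally show ?thesis by simp
qed

lemma continuous_on_atLeast:
  fixes f :: "real \<Rightarrow> 'a::topological_space"
  assumes "\<And>a. a > 0 \<Longrightarrow> continuous_on {0..a} f"
  shows "continuous_on {0..} f"
  unfolding continuous_on_eq_continuous_within
proof
  fix x :: real assume x: "x \<in> {0..}"
  have "continuous (at x within {0..x+1}) f"
    using assms[of "x+1"] x by (simp add: continuous_on_eq_continuous_within)
  moreover have "at x within {0..x+1} = at x within {0..}"
    by (rule at_within_nhd[where S = "{..<x+1}"]) auto
  ultimately show "continuous (at x within {0..}) f" by simp
qed

lemma set_integrable_continuous_on:
  fixes f :: "real \<Rightarrow> 'a::{second_countable_topology,banach}"
  shows "continuous_on {a..b} f \<Longrightarrow> set_integrable lborel {a..b} f"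
  by (rule borel_integrable_atLeastAtMost')

lemma borel_measurable_cnj [measurable]: "cnj \<in> borel_measurable borel"
  by (intro borel_measurable_continuous_onI continuous_intros)

section \<open>The Krein system with a Borel coefficient in L^2\<close>

locale krein =
  fixes A :: "real \<Rightarrow> complex" and P Ps :: "real \<Rightarrow> complex \<Rightarrow> complex"
  assumes A_borel [measurable]: "A \<in> borel_measurable borel"
    and A_L2: "set_integrable lborel {0..} (\<lambda>x. (cmod (A x))\<^sup>2)"
    and krein: "krein_system A P Ps"
begin

definition "normA2 = (LINT x:{0..}|lborel. (cmod (A x))\<^sup>2)"

lemma normA2_nonneg: "normA2 \<ge> 0"
  unfolding normA2_def set_lebesgue_integral_def by (rule Bochner_Integration.integral_nonneg) (simp add: indicator_def)

lemma initial_values: "P 0 k = 1" "Ps 0 k = 1"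
  using krein by (auto simp: krein_system_def)

lemma P_abs_continuous:
  shows "abs_continuous_on {0..a} (\<lambda>r. P r k)" "abs_continuous_on {0..a} (\<lambda>r. Ps r k)"
proof -
  have *: "abs_continuous_on {0..max a 1} (\<lambda>r. P r k)" "abs_continuous_on {0..max a 1} (\<lambda>r. Ps r k)"
    using krein unfolding krein_system_def by (meson less_max_iff_disj zero_less_one)+
  show "abs_continuous_on {0..a} (\<lambda>r. P r k)" by (rule abs_continuous_on_subset[OF *(1)]) simp
  show "abs_continuous_on {0..a} (\<lambda>r. Ps r k)" by (rule abs_continuous_on_subset[OF *(2)]) simp
qed

lemma P_abs_continuous':
  assumes "0 \<le> a"
  shows "abs_continuous_on {a..b} (\<lambda>r. P r k)" "abs_continuous_on {a..b} (\<lambda>r. Ps r k)"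
  by (rule abs_continuous_on_subset[OF P_abs_continuous(1)[of b]]; use assms in simp)
    (rule abs_continuous_on_subset[OF P_abs_continuous(2)[of b]]; use assms in simp)

lemma P_continuous: "continuous_on {0..} (\<lambda>r. P r k)" "continuous_on {0..} (\<lambda>r. Ps r k)"
  using P_abs_continuous by (auto intro!: continuous_on_atLeast abs_continuous_on_imp_continuous_on)

lemma P_continuous':
  assumes "0 \<le> a"
  shows "continuous_on {a..b} (\<lambda>r. P r k)" "continuous_on {a..b} (\<lambda>r. Ps r k)"
  by (rule continuous_on_subset[OF P_continuous(1)]; use assms in auto)
    (rule continuous_on_subset[OF P_continuous(2)]; use assms in auto)

lemma krein_derivatives:
  assumes "0 \<le> a"
  shows "AE r in lebesgue. r \<in> {a..b} \<longrightarrow>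
      ((\<lambda>r. P r k) has_vector_derivative \<i> * k * P r k - cnj (A r) * Ps r k) (at r within {a..b})"
    and "AE r in lebesgue. r \<in> {a..b} \<longrightarrow>
      ((\<lambda>r. Ps r k) has_vector_derivative - A r * P r k) (at r within {a..b})"
proof -
  have *: "AE r in lebesgue. r \<ge> 0 \<longrightarrow>
           ((\<lambda>r. P r k) has_vector_derivative \<i> * k * P r k - cnj (A r) * Ps r k)
             (at r within {0..}) \<and>
           ((\<lambda>r. Ps r k) has_vector_derivative - A r * P r k) (at r within {0..})"
    using krein by (simp add: krein_system_def)
  have sub: "{a..b} \<subseteq> {0..}" using assms by auto
  show "AE r in lebesgue. r \<in> {a..b} \<longrightarrow>
      ((\<lambda>r. P r k) has_vector_derivative \<i> * k * P r k - cnj (A r) * Ps r k) (at r within {a..b})"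
    using * by eventually_elim (use assms in \<open>auto intro: has_vector_derivative_within_subset[OF _ sub]\<close>)
  show "AE r in lebesgue. r \<in> {a..b} \<longrightarrow>
      ((\<lambda>r. Ps r k) has_vector_derivative - A r * P r k) (at r within {a..b})"
    using * by eventually_elim (use assms in \<open>auto intro: has_vector_derivative_within_subset[OF _ sub]\<close>)
qed

lemma A_square_integrable: "0 \<le> a \<Longrightarrow> set_integrable lborel {a..b} (\<lambda>x. (cmod (A x))\<^sup>2)"
  by (rule set_integrable_subinterval[OF A_L2]) auto

lemma A_integrable: "0 \<le> a \<Longrightarrow> set_integrable lborel {a..b} A"
proof -
  assume "0 \<le> a"
  have "set_integrable lborel {a..b} (\<lambda>x. cmod (A x) * 1)"
    by (rule Cauchy_Schwarz_set_integral(1))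
      (auto simp: set_borel_measurable_def A_square_integrable[OF \<open>0 \<le> a\<close>] intro!: set_integrable_continuous_on)
  then have "set_integrable lborel {a..b} (\<lambda>x. cmod (A x))" by simp
  then show ?thesis
    by (rule set_integrable_norm_cancel[rotated]) (simp add: set_borel_measurable_def)
qed

lemma A_integrable_variants:
  assumes "0 \<le> a"
  shows "set_integrable lborel {a..b} (\<lambda>x. cmod (A x))" "set_integrable lborel {a..b} (\<lambda>x. cnj (A x))"
    and "continuous_on {a..b} g \<Longrightarrow> set_integrable lborel {a..b} (\<lambda>x. A x * g x)"
    and "continuous_on {a..b} g \<Longrightarrow> set_integrable lborel {a..b} (\<lambda>x. cnj (A x) * g x)"
    and "continuous_on {a..b} h \<Longrightarrow> set_integrable lborel {a..b} (\<lambda>x. cmod (A x) * h x)"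
proof -
  show 1: "set_integrable lborel {a..b} (\<lambda>x. cmod (A x))"
    by (rule set_integrable_norm[OF A_integrable[OF assms]])
  show 2: "set_integrable lborel {a..b} (\<lambda>x. cnj (A x))"
    by (rule set_integrable_norm_cancel) (simp_all add: set_borel_measurable_def 1)
  show "continuous_on {a..b} g \<Longrightarrow> set_integrable lborel {a..b} (\<lambda>x. A x * g x)"
    by (rule set_integrable_mult_continuous_on[OF A_integrable[OF assms]])
  show "continuous_on {a..b} g \<Longrightarrow> set_integrable lborel {a..b} (\<lambda>x. cnj (A x) * g x)"
    by (rule set_integrable_mult_continuous_on[OF 2])
  show "continuous_on {a..b} h \<Longrightarrow> set_integrable lborel {a..b} (\<lambda>x. cmod (A x) * h x)"
    by (rule set_integrable_mult_continuous_on[OF 1])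
qed

lemma Ps_increment:
  assumes "0 \<le> a" "a \<le> b"
  shows "Ps b k - Ps a k = - (LINT x:{a..b}|lborel. A x * P x k)"
proof -
  have int: "set_integrable lborel {a..b} (\<lambda>x. A x * P x k)"
    by (intro A_integrable_variants P_continuous' assms)
  then have "set_integrable lborel {a..b} (\<lambda>x. - A x * P x k)"
    using set_integrable_mult_right[of "-1" lborel "{a..b}"] by simp
  then have "(LINT x:{a..b}|lborel. - A x * P x k) = Ps b k - Ps a k"
    by (intro set_integral_abs_continuous_derivative P_abs_continuous' krein_derivatives assms)
  then show ?thesis using set_integral_uminus[OF int] by simp
qed

lemma P_increment:
  assumes "0 \<le> a" "a \<le> b"
  shows "P b k - P a k = (LINT x:{a..b}|lborel. \<i> * k * P x k - cnj (A x) * Ps x k)"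
    and "set_integrable lborel {a..b} (\<lambda>x. \<i> * k * P x k - cnj (A x) * Ps x k)"
proof -
  show *: "set_integrable lborel {a..b} (\<lambda>x. \<i> * k * P x k - cnj (A x) * Ps x k)"
    by (intro set_integral_diff(1) A_integrable_variants P_continuous' assms set_integrable_continuous_on continuous_intros)
  show "P b k - P a k = (LINT x:{a..b}|lborel. \<i> * k * P x k - cnj (A x) * Ps x k)"
    by (rule set_integral_abs_continuous_derivative[symmetric, OF assms(2) _ * ]) (intro P_abs_continuous' krein_derivatives assms)+
qed

text \<open>In the derivative of the left-hand side all terms containing \<open>A\<close> cancel,
  which leaves the integrand on the right; at 0 the left-hand side is 1 - 1.\<close>

lemma christoffel_darboux:
  assumes "0 \<le> r"
  shows "P r k * cnj (P r l) - Ps r k * cnj (Ps r l)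
      = \<i> * (k - cnj l) * (LINT x:{0..r}|lborel. P x k * cnj (P x l))"
proof -
  define F where "F x = P x k * cnj (P x l) - Ps x k * cnj (Ps x l)" for x
  have int: "set_integrable lborel {0..r} (\<lambda>x. P x k * cnj (P x l))"
    by (intro set_integrable_continuous_on continuous_intros P_continuous') auto
  have "AE x in lebesgue. x \<in> {0..r} \<longrightarrow>
      (F has_vector_derivative \<i> * (k - cnj l) * (P x k * cnj (P x l))) (at x within {0..r})"
    using krein_derivatives(1)[of 0 r k, OF order_refl] krein_derivatives(2)[of 0 r k, OF order_refl]
      krein_derivatives(1)[of 0 r l, OF order_refl] krein_derivatives(2)[of 0 r l, OF order_refl]
  proof eventually_elim
    case (elim x)
    show ?case
    proof
      assume x: "x \<in> {0..r}"
      have 1: "((\<lambda>x. P x k * cnj (P x l)) has_vector_derivative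
         P x k * cnj (\<i> * l * P x l - cnj (A x) * Ps x l) + (\<i> * k * P x k - cnj (A x) * Ps x k) * cnj (P x l)) (at x within {0..r})"
        using elim x by (intro has_vector_derivative_mult has_vector_derivative_cnj) auto
      have 2: "((\<lambda>x. Ps x k * cnj (Ps x l)) has_vector_derivative
         Ps x k * cnj (- A x * P x l) + (- A x * P x k) * cnj (Ps x l)) (at x within {0..r})"
        using elim x by (intro has_vector_derivative_mult has_vector_derivative_cnj) auto
      show "(F has_vector_derivative \<i> * (k - cnj l) * (P x k * cnj (P x l))) (at x within {0..r})"
        unfolding F_def
        by (rule has_vector_derivative_eq_rhs[OF has_vector_derivative_diff[OF 1 2]]) (simp add: algebra_simps)
    qed
  qed
  moreover have "abs_continuous_on {0..r} F"
    unfolding F_def by (intro abs_continuous_on_diff abs_continuous_on_mult abs_continuous_on_cnj P_abs_continuous)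
  moreover have "set_integrable lborel {0..r} (\<lambda>x. \<i> * (k - cnj l) * (P x k * cnj (P x l)))"
    using int by simp
  ultimately have "(LINT x:{0..r}|lborel. \<i> * (k - cnj l) * (P x k * cnj (P x l))) = F r - F 0"
    using assms by (intro set_integral_abs_continuous_derivative)
  then show ?thesis by (simp add: F_def initial_values)
qed

text \<open>For equal real parameters the factor \<open>k - cnj l\<close> in
  \<open>christoffel_darboux\<close> vanishes.\<close>

lemma norm_P_eq_norm_Ps:
  assumes "0 \<le> r"
  shows "cmod (P r (of_real k)) = cmod (Ps r (of_real k))"
proof -
  have "complex_of_real ((cmod (P r (of_real k)))\<^sup>2) = of_real ((cmod (Ps r (of_real k)))\<^sup>2)"
    using christoffel_darboux[OF assms, of "of_real k" "of_real k"]
    by (simp add: complex_norm_square del: of_real_power)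
  then show ?thesis by (metis norm_ge_zero of_real_eq_iff power2_eq_iff_nonneg)
qed

text \<open>The Christoffel-Darboux kernel on the diagonal at \<i>. Its boundedness in r is what
  makes evaluation at \<i> bounded on the span of the \<open>P r\<close>, and a positive lower bound
  is what controls \<open>P\<close> in the weighted norm.\<close>

definition "energy r = (LINT x:{0..r}|lborel. (cmod (P x \<i>))\<^sup>2)"

lemma energy_integrable: "0 \<le> a \<Longrightarrow> set_integrable lborel {a..b} (\<lambda>x. (cmod (P x \<i>))\<^sup>2)"
  by (intro set_integrable_continuous_on continuous_intros P_continuous')

text \<open>\<open>christoffel_darboux\<close> at \<open>k = l = \<i>\<close>, where the factor is
  \<open>\<i> * (\<i> - cnj \<i>) = -2\<close>.\<close>

lemma energy_identity:
  assumes "0 \<le> r"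
  shows "(cmod (Ps r \<i>))\<^sup>2 - (cmod (P r \<i>))\<^sup>2 = 2 * energy r"
proof -
  have en: "(LINT x:{0..r}|lborel. P x \<i> * cnj (P x \<i>)) = of_real (energy r)"
    unfolding energy_def set_integral_complex_of_real[symmetric] complex_norm_square ..
  have "complex_of_real ((cmod (P r \<i>))\<^sup>2 - (cmod (Ps r \<i>))\<^sup>2)
      = P r \<i> * cnj (P r \<i>) - Ps r \<i> * cnj (Ps r \<i>)"
    by (simp only: of_real_diff complex_norm_square)
  also have "\<dots> = \<i> * (\<i> - cnj \<i>) * of_real (energy r)"
    using christoffel_darboux[OF assms, of \<i> \<i>] unfolding en .
  also have "\<dots> = of_real (- 2 * energy r)" by (simp add: complex_eq_iff)
  finally have "complex_of_real ((cmod (P r \<i>))\<^sup>2 - (cmod (Ps r \<i>))\<^sup>2) = of_real (- 2 * energy r)" .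
  then have "(cmod (P r \<i>))\<^sup>2 - (cmod (Ps r \<i>))\<^sup>2 = - 2 * energy r" by (simp only: of_real_eq_iff)
  then show ?thesis by simp
qed

lemma energy_mono:
  assumes "r \<le> s"
  shows "energy r \<le> energy s"
  unfolding energy_def by (rule set_integral_mono_subset[OF energy_integrable]) (use assms in auto)

lemma energy_nonneg: "energy r \<ge> 0"
  unfolding energy_def set_lebesgue_integral_def by (rule Bochner_Integration.integral_nonneg) (simp add: indicator_def)

lemma norm_P_le_norm_Ps: "0 \<le> r \<Longrightarrow> cmod (P r \<i>) \<le> cmod (Ps r \<i>)"
  using energy_identity[of r] energy_nonneg[of r] by (metis diff_ge_0_iff_ge norm_ge_zero power2_le_imp_le zero_le_mult_iff zero_le_numeral)

end

section \<open>Gronwall estimates and dependence on the spectral parameter\<close>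

lemma square_sum_le: "(a + b)\<^sup>2 \<le> 2 * a\<^sup>2 + 2 * b\<^sup>2" for a b :: real
  using sum_squares_bound[of a b] by (simp add: power2_sum)

lemma norm_one_add_le: "z = 1 + w \<Longrightarrow> norm z \<le> 1 + norm w" for z :: "'a::real_normed_algebra_1"
  using norm_triangle_ineq[of 1 w] by simp

lemma norm_one_diff_le: "z = 1 + - w \<Longrightarrow> norm z \<le> 1 + norm w" for z :: "'a::real_normed_algebra_1"
  using norm_triangle_ineq[of 1 "- w"] by simp

lemma norm_add_diff_le: "z = a + (b - c) \<Longrightarrow> norm z \<le> norm a + (norm b + norm c)" for z :: "'a::real_normed_vector"
  using norm_triangle_ineq[of a "b - c"] norm_triangle_ineq4[of b c] by simp

lemma gronwall:
  fixes u :: "real \<Rightarrow> real"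
  assumes u: "continuous_on {0..a} u" and K: "K \<ge> 0"
    and le: "\<And>r. r \<in> {0..a} \<Longrightarrow> u r \<le> c + K * (LINT x:{0..r}|lborel. u x)"
    and r: "r \<in> {0..a}"
  shows "u r \<le> c * exp (K * r)"
proof -
  define U where "U r = integral {0..r} u" for r
  have U: "(LINT x:{0..r}|lborel. u x) = U r" if "r \<in> {0..a}" for r
    unfolding U_def using that
    by (intro set_borel_integral_eq_integral(2) set_integrable_continuous_on continuous_on_subset[OF u]) auto
  \<comment> \<open>The integrating factor turns the hypothesis into monotonicity: the derivative of
    \<open>G\<close> is \<open>K * exp (- K * x) * (u x - (c + K * U x))\<close>, which is at most
    0.\<close>
  define G where "G x = (c + K * U x) * exp (- K * x)" for x
  have dU: "(U has_real_derivative u t) (at t within {0..a})" if "t \<in> {0..a}" for t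
    unfolding U_def by (rule integral_has_real_derivative[OF u that])
  have dG: "(G has_real_derivative K * u t * exp (- K * t) + (c + K * U t) * (exp (- K * t) * (- K))) (at t within {0..a})"
    if "t \<in> {0..a}" for t
    unfolding G_def by (auto intro!: derivative_eq_intros dU[OF that] simp: algebra_simps)
  have "G r \<le> G 0"
  proof (rule DERIV_nonpos_imp_decreasing_open[of 0 r G])
    show "0 \<le> r" using r by simp
    show "continuous_on {0..r} G"
    proof (rule continuous_on_subset)
      show "continuous_on {0..a} G" by (rule DERIV_continuous_on[OF dG])
    qed (use r in auto)
    fix x assume x: "0 < x" "x < r"
    then have x': "x \<in> {0..a}" using r by auto
    have "at x within {0..a} = at x" using x r by (intro at_within_interior) auto
    then have "(G has_real_derivative K * u x * exp (- K * x) + (c + K * U x) * (exp (- K * x) * (- K))) (at x)"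
      using dG[OF x'] by simp
    moreover have "K * u x * exp (- K * x) + (c + K * U x) * (exp (- K * x) * (- K)) \<le> 0"
    proof -
      have "K * exp (- K * x) * (u x - (c + K * U x)) \<le> 0"
        using le[OF x'] U[OF x'] K by (intro mult_nonneg_nonpos) auto
      then show ?thesis by (simp add: algebra_simps)
    qed
    ultimately show "\<exists>y. (G has_real_derivative y) (at x) \<and> y \<le> 0" by blast
  qed
  then have "(c + K * U r) * exp (- K * r) \<le> c" by (simp add: G_def U_def)
  then have "c + K * U r \<le> c * exp (K * r)"
    by (simp add: exp_minus field_simps)
  then show ?thesis using le[OF r] U[OF r] by simp
qed

lemma set_borel_measurable_Icc:
  fixes f :: "real \<Rightarrow> 'a::real_normed_vector"
  shows "continuous_on {a..b} f \<Longrightarrow> set_borel_measurable lborel {a..b} f"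
  unfolding set_borel_measurable_def using borel_measurable_continuous_on_indicator[of "{a..b}" f] by simp

lemma set_integral_real_const: "a \<le> b \<Longrightarrow> (LINT x:{a..b}|lborel. c) = (b - a) * (c::real)"
  by (simp add: set_lebesgue_integral_def)

section \<open>A priori bounds and continuity in the spectral parameter\<close>

context krein
begin

lemma A_sq_le: "0 \<le> a \<Longrightarrow> (LINT x:{a..b}|lborel. (cmod (A x))\<^sup>2) \<le> normA2"
  unfolding normA2_def by (rule set_integral_mono_subset[OF A_L2]) auto

text \<open>Cauchy-Schwarz replaces the integral of \<open>(\<kappa> + cmod (A y)) * u y\<close>,
  squared, by a constant times the integral of u^2, so that \<open>gronwall\<close> with a constant
  rate applies to u^2 and only the L^2 norm of \<open>A\<close> enters. Here
  \<open>\<Lambda>\<close> bounds the integral of the squared weight, and (2c + I)^2 \<le> 8 c^2 + 2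
  I^2 gives the rate \<open>2 * \<Lambda>\<close>.\<close>

lemma coupled_gronwall:
  fixes p q :: "real \<Rightarrow> complex"
  assumes p: "continuous_on {0..a} p" and q: "continuous_on {0..a} q" and c: "c \<ge> 0" and \<kappa>: "\<kappa> \<ge> 0"
    and lep: "\<And>x. x \<in> {0..a} \<Longrightarrow> cmod (p x) \<le> c + (LINT y:{0..x}|lborel. \<kappa> * cmod (p y) + cmod (A y) * cmod (q y))"
    and leq: "\<And>x. x \<in> {0..a} \<Longrightarrow> cmod (q x) \<le> c + (LINT y:{0..x}|lborel. cmod (A y) * cmod (p y))"
    and r: "r \<in> {0..a}"
  shows "cmod (p r) + cmod (q r) \<le> 3 * c * exp (2 * (\<kappa>\<^sup>2 * a + normA2) * a)"
proof -
  define u where "u x = cmod (p x) + cmod (q x)" for x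
  define \<Lambda> where "\<Lambda> = 2 * (\<kappa>\<^sup>2 * a + normA2)"
  have a: "a \<ge> 0" using r by auto
  have \<Lambda>: "\<Lambda> \<ge> 0" unfolding \<Lambda>_def using normA2_nonneg a by simp
  have u: "continuous_on {0..a} u" unfolding u_def by (intro continuous_intros p q)
  have u0: "u x \<ge> 0" for x by (simp add: u_def)
  have "(u x)\<^sup>2 \<le> 8 * c\<^sup>2 + (2 * \<Lambda>) * (LINT y:{0..x}|lborel. (u y)\<^sup>2)" if x: "x \<in> {0..a}" for x
  proof -
    have sub: "{0..x} \<subseteq> {0..a}" using x by auto
    note pc = continuous_on_subset[OF p sub] and qc = continuous_on_subset[OF q sub] and uc = continuous_on_subset[OF u sub]
    define B where "B y = \<kappa> + cmod (A y)" for y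
    have Bsq: "(B y)\<^sup>2 \<le> 2 * \<kappa>\<^sup>2 + 2 * (cmod (A y))\<^sup>2" for y
      unfolding B_def by (rule square_sum_le)
    have Bint': "set_integrable lborel {0..x} (\<lambda>y. 2 * \<kappa>\<^sup>2 + 2 * (cmod (A y))\<^sup>2)"
      by (intro set_integral_add set_integrable_mult_right A_square_integrable set_integrable_continuous_on) auto
    have Bint: "set_integrable lborel {0..x} (\<lambda>y. (B y)\<^sup>2)"
      by (rule set_integrable_bound[OF Bint']) (use Bsq in \<open>auto simp: B_def set_borel_measurable_def\<close>)
    have Bm: "set_borel_measurable lborel {0..x} B"
      by (simp add: set_borel_measurable_def B_def)
    have um: "set_borel_measurable lborel {0..x} u"
      by (rule set_borel_measurable_Icc[OF uc])
    have usq: "set_integrable lborel {0..x} (\<lambda>y. (u y)\<^sup>2)"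
      by (intro set_integrable_continuous_on continuous_intros uc)
    note CS = Cauchy_Schwarz_set_integral[OF Bm um Bint usq]
    define I where "I = (LINT y:{0..x}|lborel. B y * u y)"
    have "cmod (p x) + cmod (q x) \<le> 2 * c + ((LINT y:{0..x}|lborel. \<kappa> * cmod (p y) + cmod (A y) * cmod (q y)) + (LINT y:{0..x}|lborel. cmod (A y) * cmod (p y)))"
      using lep[OF x] leq[OF x] by simp
    also have "(LINT y:{0..x}|lborel. \<kappa> * cmod (p y) + cmod (A y) * cmod (q y)) + (LINT y:{0..x}|lborel. cmod (A y) * cmod (p y))
      = (LINT y:{0..x}|lborel. \<kappa> * cmod (p y) + cmod (A y) * cmod (q y) + cmod (A y) * cmod (p y))"
      by (intro set_integral_add(2)[symmetric] set_integral_add(1) A_integrable_variants set_integrable_continuous_on continuous_intros pc qc) auto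
    also have "\<dots> \<le> I"
      unfolding I_def
    proof (rule set_integral_mono[OF _ CS(1)])
      show "set_integrable lborel {0..x} (\<lambda>y. \<kappa> * cmod (p y) + cmod (A y) * cmod (q y) + cmod (A y) * cmod (p y))"
        by (intro set_integral_add(1) A_integrable_variants set_integrable_continuous_on continuous_intros pc qc) auto
      show "\<kappa> * cmod (p y) + cmod (A y) * cmod (q y) + cmod (A y) * cmod (p y) \<le> B y * u y" for y
        using \<kappa> by (simp add: B_def u_def algebra_simps)
    qed
    finally have "u x \<le> 2 * c + I" by (simp add: u_def)
    then have "(u x)\<^sup>2 \<le> (2 * c + I)\<^sup>2" using u0 by (intro power_mono) auto
    also have "\<dots> \<le> 8 * c\<^sup>2 + 2 * I\<^sup>2" using square_sum_le[of "2 * c" I] by (simp add: power_mult_distrib)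
    also have "I\<^sup>2 \<le> \<Lambda> * (LINT y:{0..x}|lborel. (u y)\<^sup>2)"
    proof -
      have "(LINT y:{0..x}|lborel. (B y)\<^sup>2) \<le> (LINT y:{0..x}|lborel. 2 * \<kappa>\<^sup>2 + 2 * (cmod (A y))\<^sup>2)"
        by (rule set_integral_mono[OF Bint Bint']) (rule Bsq)
      also have "\<dots> = x * (2 * \<kappa>\<^sup>2) + 2 * (LINT y:{0..x}|lborel. (cmod (A y))\<^sup>2)"
        using x by (subst set_integral_add(2)) (simp_all add: A_square_integrable set_integrable_continuous_on set_integral_real_const)
      also have "\<dots> \<le> a * (2 * \<kappa>\<^sup>2) + 2 * normA2"
        using x A_sq_le[of 0 x] by (intro add_mono mult_right_mono) auto
      finally have "(LINT y:{0..x}|lborel. (B y)\<^sup>2) \<le> \<Lambda>" by (simp add: \<Lambda>_def algebra_simps)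
      moreover have "0 \<le> (LINT y:{0..x}|lborel. (u y)\<^sup>2)"
        unfolding set_lebesgue_integral_def by (rule Bochner_Integration.integral_nonneg) simp
      ultimately show ?thesis
        using CS(2) unfolding I_def by (meson mult_right_mono order_trans)
    qed
    finally show ?thesis by simp
  qed
  then have "(u r)\<^sup>2 \<le> 8 * c\<^sup>2 * exp (2 * \<Lambda> * r)"
    using \<Lambda> r u by (intro gronwall[where a = a]) (auto intro!: continuous_intros)
  \<comment> \<open>8 is rounded up to a perfect square, whence the factor 3.\<close>
  also have "\<dots> \<le> 9 * c\<^sup>2 * exp (2 * \<Lambda> * a)"
    using r \<Lambda> by (intro mult_mono) (auto intro!: mult_left_mono)
  also have "\<dots> = (3 * c * exp (\<Lambda> * a))\<^sup>2"
    by (simp add: power_mult_distrib flip: exp_double)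
  finally have "u r \<le> 3 * c * exp (\<Lambda> * a)"
    by (rule power2_le_imp_le) (use c in simp)
  then show ?thesis by (simp add: u_def \<Lambda>_def)
qed

lemma norm_bound:
  assumes r: "r \<in> {0..a}"
  shows "cmod (P r k) + cmod (Ps r k) \<le> 3 * exp (2 * ((cmod k)\<^sup>2 * a + normA2) * a)"
proof -
  have "cmod (P r k) + cmod (Ps r k) \<le> 3 * 1 * exp (2 * ((cmod k)\<^sup>2 * a + normA2) * a)"
  proof (rule coupled_gronwall[OF _ _ _ _ _ _ r])
    fix x assume x: "x \<in> {0..a}"
    have "P x k = 1 + (LINT y:{0..x}|lborel. \<i> * k * P y k - cnj (A y) * Ps y k)"
      using P_increment(1)[of 0 x k] x by (simp add: initial_values algebra_simps)
    then have "cmod (P x k) \<le> 1 + cmod (LINT y:{0..x}|lborel. \<i> * k * P y k - cnj (A y) * Ps y k)"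
      by (rule norm_one_add_le)
    also have "cmod (LINT y:{0..x}|lborel. \<i> * k * P y k - cnj (A y) * Ps y k)
        \<le> (LINT y:{0..x}|lborel. cmod k * cmod (P y k) + cmod (A y) * cmod (Ps y k))"
    proof (rule set_integral_norm_mono)
      show "set_integrable lborel {0..x} (\<lambda>y. \<i> * k * P y k - cnj (A y) * Ps y k)"
        using P_increment(2)[of 0 x k] x by simp
      show "set_integrable lborel {0..x} (\<lambda>y. cmod k * cmod (P y k) + cmod (A y) * cmod (Ps y k))"
        by (intro set_integral_add(1) A_integrable_variants set_integrable_continuous_on continuous_intros P_continuous') auto
      show "cmod (\<i> * k * P y k - cnj (A y) * Ps y k) \<le> cmod k * cmod (P y k) + cmod (A y) * cmod (Ps y k)" for y
        by (rule order_trans[OF norm_triangle_ineq4]) (simp add: norm_mult)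
    qed
    finally show "cmod (P x k) \<le> 1 + (LINT y:{0..x}|lborel. cmod k * cmod (P y k) + cmod (A y) * cmod (Ps y k))" by simp
    have "Ps x k = 1 + - (LINT y:{0..x}|lborel. A y * P y k)"
      using Ps_increment[of 0 x k] x by (simp add: initial_values algebra_simps)
    then have "cmod (Ps x k) \<le> 1 + cmod (LINT y:{0..x}|lborel. A y * P y k)"
      by (rule norm_one_diff_le)
    also have "cmod (LINT y:{0..x}|lborel. A y * P y k) \<le> (LINT y:{0..x}|lborel. cmod (A y) * cmod (P y k))"
      by (intro set_integral_norm_mono A_integrable_variants continuous_intros P_continuous') (auto simp: norm_mult)
    finally show "cmod (Ps x k) \<le> 1 + (LINT y:{0..x}|lborel. cmod (A y) * cmod (P y k))" by simp
  qed (auto intro!: P_continuous')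
  then show ?thesis by simp
qed

text \<open>Because |P| = |Ps| on the real line, the second equation alone closes up: both functions
  in \<open>coupled_gronwall\<close> are \<open>Ps\<close>, with \<kappa> = 0. The bound is
  therefore uniform in k, which is what lets the Picard errors be integrated against
  \<sigma>.\<close>

lemma norm_bound_real:
  assumes r: "r \<in> {0..a}"
  shows "cmod (P r (of_real k)) \<le> 3 * exp (2 * normA2 * a)"
proof -
  define l where "l = complex_of_real k"
  have "cmod (Ps r l) + cmod (Ps r l) \<le> 3 * 1 * exp (2 * (0\<^sup>2 * a + normA2) * a)"
  proof (rule coupled_gronwall[OF _ _ _ _ _ _ r])
    fix x assume x: "x \<in> {0..a}"
    have "Ps x l = 1 + - (LINT y:{0..x}|lborel. A y * P y l)"
      using Ps_increment[of 0 x l] x by (simp add: initial_values algebra_simps)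
    then have "cmod (Ps x l) \<le> 1 + cmod (LINT y:{0..x}|lborel. A y * P y l)"
      by (rule norm_one_diff_le)
    also have "cmod (LINT y:{0..x}|lborel. A y * P y l) \<le> (LINT y:{0..x}|lborel. cmod (A y) * cmod (Ps y l))"
      by (intro set_integral_norm_mono A_integrable_variants continuous_intros P_continuous') (auto simp: norm_mult l_def norm_P_eq_norm_Ps)
    finally show *: "cmod (Ps x l) \<le> 1 + (LINT y:{0..x}|lborel. cmod (A y) * cmod (Ps y l))" by simp
    then show "cmod (Ps x l) \<le> 1 + (LINT y:{0..x}|lborel. 0 * cmod (Ps y l) + cmod (A y) * cmod (Ps y l))" by simp
  qed (auto intro!: P_continuous')
  then show ?thesis
    using norm_P_eq_norm_Ps[of r k] r by (simp add: l_def) (smt (verit) norm_ge_zero)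
qed

text \<open>The difference of two solutions solves the system for k with zero initial values and the
  source \<open>\<i> * (k - l) * P y l\<close>, so it falls under \<open>coupled_gronwall\<close>
  with a constant proportional to |k - l|.\<close>

lemma lipschitz_in_k:
  assumes r: "r \<in> {0..a}"
  shows "cmod (P r k - P r l) + cmod (Ps r k - Ps r l)
    \<le> 9 * a * exp (2 * ((cmod l)\<^sup>2 * a + normA2) * a) * exp (2 * ((cmod k)\<^sup>2 * a + normA2) * a) * cmod (k - l)"
proof -
  define B where "B = 3 * exp (2 * ((cmod l)\<^sup>2 * a + normA2) * a)"
  define c where "c = a * (B * cmod (k - l))"
  have a: "a \<ge> 0" using r by auto
  have B0: "B \<ge> 0" by (simp add: B_def)
  have B: "cmod (P x l) \<le> B" if "x \<in> {0..a}" for x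
    using norm_bound[OF that, of l] unfolding B_def by (smt (verit) norm_ge_zero)
  have "cmod (P r k - P r l) + cmod (Ps r k - Ps r l) \<le> 3 * c * exp (2 * ((cmod k)\<^sup>2 * a + normA2) * a)"
  proof (rule coupled_gronwall[OF _ _ _ _ _ _ r])
    show "c \<ge> 0" using a B0 by (simp add: c_def)
    fix x assume x: "x \<in> {0..a}"
    have int: "set_integrable lborel {0..x} (\<lambda>y. \<i> * k * P y k - cnj (A y) * Ps y k)"
      "set_integrable lborel {0..x} (\<lambda>y. \<i> * l * P y l - cnj (A y) * Ps y l)"
      using P_increment(2)[of 0 x] x by auto
    have intr: "set_integrable lborel {0..x} (\<lambda>y. cmod k * cmod (P y k - P y l) + cmod (A y) * cmod (Ps y k - Ps y l))"
      by (intro set_integral_add(1) A_integrable_variants set_integrable_continuous_on continuous_intros P_continuous') auto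
    have eqP: "P x k - P x l = (LINT y:{0..x}|lborel. (\<i> * k * P y k - cnj (A y) * Ps y k) - (\<i> * l * P y l - cnj (A y) * Ps y l))"
    proof -
      have 0: "0 \<le> x" using x by simp
      have "P x k - P x l = (P x k - P 0 k) - (P x l - P 0 l)" by (simp add: initial_values)
      also have "\<dots> = (LINT y:{0..x}|lborel. \<i> * k * P y k - cnj (A y) * Ps y k) - (LINT y:{0..x}|lborel. \<i> * l * P y l - cnj (A y) * Ps y l)"
        by (simp only: P_increment(1)[OF order_refl 0])
      also note set_integral_diff(2)[OF int, symmetric]
      finally show ?thesis .
    qed
    have "cmod (P x k - P x l) \<le> (LINT y:{0..x}|lborel. B * cmod (k - l) + (cmod k * cmod (P y k - P y l) + cmod (A y) * cmod (Ps y k - Ps y l)))"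
      unfolding eqP
    proof (rule set_integral_norm_mono)
      show "set_integrable lborel {0..x} (\<lambda>y. B * cmod (k - l) + (cmod k * cmod (P y k - P y l) + cmod (A y) * cmod (Ps y k - Ps y l)))"
        by (intro set_integral_add(1) intr set_integrable_continuous_on continuous_intros)
      fix y assume y: "y \<in> {0..x}"
      have "(\<i> * k * P y k - cnj (A y) * Ps y k) - (\<i> * l * P y l - cnj (A y) * Ps y l)
          = \<i> * (k - l) * P y l + (\<i> * k * (P y k - P y l) - cnj (A y) * (Ps y k - Ps y l))" (is "?L = ?a + (?b - ?c)")
        by (simp add: algebra_simps)
      then have "cmod ?L \<le> cmod ?a + (cmod ?b + cmod ?c)" by (rule norm_add_diff_le)
      also have "\<dots> \<le> B * cmod (k - l) + (cmod k * cmod (P y k - P y l) + cmod (A y) * cmod (Ps y k - Ps y l))"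
      proof (rule add_mono)
        show "cmod ?a \<le> B * cmod (k - l)"
          using mult_right_mono[OF B[of y], of "cmod (k - l)"] y x by (simp add: norm_mult mult.commute)
      qed (simp add: norm_mult)
      finally show "cmod ?L \<le> B * cmod (k - l) + (cmod k * cmod (P y k - P y l) + cmod (A y) * cmod (Ps y k - Ps y l))" .
    qed (rule set_integral_diff(1)[OF int])
    also have "\<dots> = x * (B * cmod (k - l)) + (LINT y:{0..x}|lborel. cmod k * cmod (P y k - P y l) + cmod (A y) * cmod (Ps y k - Ps y l))"
      using x by (subst set_integral_add(2)[OF _ intr]) (simp_all add: set_integral_real_const set_integrable_continuous_on)
    also have "x * (B * cmod (k - l)) \<le> c"
      unfolding c_def using x B0 by (intro mult_right_mono) auto
    finally show "cmod (P x k - P x l) \<le> c + (LINT y:{0..x}|lborel. cmod k * cmod (P y k - P y l) + cmod (A y) * cmod (Ps y k - Ps y l))"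
      by simp
    have intA: "set_integrable lborel {0..x} (\<lambda>y. A y * P y k)" "set_integrable lborel {0..x} (\<lambda>y. A y * P y l)"
      by (simp_all add: A_integrable_variants P_continuous')
    have "Ps x k - Ps x l = (Ps x k - Ps 0 k) - (Ps x l - Ps 0 l)" by (simp add: initial_values)
    also have "\<dots> = - ((LINT y:{0..x}|lborel. A y * P y k) - (LINT y:{0..x}|lborel. A y * P y l))"
      using x by (simp add: Ps_increment)
    also note set_integral_diff(2)[OF intA, symmetric]
    finally have "cmod (Ps x k - Ps x l) = cmod (LINT y:{0..x}|lborel. A y * P y k - A y * P y l)" by simp
    also have "\<dots> \<le> (LINT y:{0..x}|lborel. cmod (A y) * cmod (P y k - P y l))"
    proof (rule set_integral_norm_mono)
      show "set_integrable lborel {0..x} (\<lambda>y. A y * P y k - A y * P y l)" by (rule set_integral_diff(1)[OF intA])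
      show "set_integrable lborel {0..x} (\<lambda>y. cmod (A y) * cmod (P y k - P y l))"
        by (intro A_integrable_variants continuous_intros P_continuous') auto
    qed (simp add: norm_mult flip: right_diff_distrib)
    finally show "cmod (Ps x k - Ps x l) \<le> c + (LINT y:{0..x}|lborel. cmod (A y) * cmod (P y k - P y l))"
      using a B0 by (simp add: c_def add_increasing)
  qed (auto intro!: P_continuous' continuous_intros)
  then show ?thesis by (simp add: c_def B_def algebra_simps)
qed

text \<open>Continuity in x at a fixed parameter combines with the Lipschitz bound in k, which is
  uniform for x in bounded intervals. This provides the joint measurability that Tonelli's theorem
  needs.\<close>

lemma joint_continuity:
  "continuous_on ({0..} \<times> UNIV) (\<lambda>(x, k). P x k)" "continuous_on ({0..} \<times> UNIV) (\<lambda>(x, k). Ps x k)"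
proof -
  have main: "continuous_on ({0..} \<times> UNIV) (\<lambda>(x, k). F x k)"
    if F: "\<And>l. continuous_on {0..} (\<lambda>x. F x l)"
      and lip: "\<And>a r k l. r \<in> {0..a} \<Longrightarrow> cmod (F r k - F r l) \<le> 9 * a * exp (2 * ((cmod l)\<^sup>2 * a + normA2) * a) * exp (2 * ((cmod k)\<^sup>2 * a + normA2) * a) * cmod (k - l)"
    for F :: "real \<Rightarrow> complex \<Rightarrow> complex"
    unfolding continuous_on_def
  proof
    fix z :: "real \<times> complex" assume "z \<in> {0..} \<times> UNIV"
    then obtain x l where z: "z = (x, l)" "x \<ge> 0" by auto
    define L where "L k = 9 * (x+1) * exp (2 * ((cmod l)\<^sup>2 * (x+1) + normA2) * (x+1)) * exp (2 * ((cmod k)\<^sup>2 * (x+1) + normA2) * (x+1)) * cmod (k - l)" for k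
    let ?F = "at (x, l) within {0..} \<times> UNIV"
    have "((\<lambda>w. F (fst w) l - F x l) \<longlongrightarrow> 0) ?F"
    proof -
      have "((\<lambda>y. F y l) \<longlongrightarrow> F x l) (at x within {0..})"
        using F z unfolding continuous_on_def by auto
      moreover have "filterlim fst (nhds x) ?F" by (intro tendsto_eq_intros refl) auto
      ultimately have "((\<lambda>w. F (fst w) l) \<longlongrightarrow> F x l) ?F"
        using F[of l] z continuous_on_compose2[OF F[of l] continuous_on_fst[OF continuous_on_id], of "{0..} \<times> UNIV"]
        by (auto simp: continuous_on_def)
      then show ?thesis by (simp add: LIM_zero_iff)
    qed
    moreover have "((\<lambda>w. F (fst w) (snd w) - F (fst w) l) \<longlongrightarrow> 0) ?F"
    proof (rule tendsto_0_le[of "\<lambda>w. L (snd w)" _ _ 1])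
      have "((\<lambda>w. L (snd w)) \<longlongrightarrow> L l) ?F"
        unfolding L_def by (intro tendsto_eq_intros refl) auto
      then show "((\<lambda>w. L (snd w)) \<longlongrightarrow> 0) ?F" by (simp add: L_def)
      have "eventually (\<lambda>w. fst w < x + 1) ?F"
        by (rule order_tendstoD(2)[of fst x]) (auto intro!: tendsto_eq_intros)
      moreover have "eventually (\<lambda>w. w \<in> {0..} \<times> UNIV) ?F"
        by (auto simp: eventually_at_filter)
      ultimately show "eventually (\<lambda>w. norm (F (fst w) (snd w) - F (fst w) l) \<le> norm (L (snd w)) * 1) ?F"
      proof eventually_elim
        case (elim w)
        have "norm (F (fst w) (snd w) - F (fst w) l) \<le> L (snd w)"
          unfolding L_def using elim z by (intro lip) auto
        then show ?case by simp
      qed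
    qed
    ultimately have "((\<lambda>w. (F (fst w) (snd w) - F (fst w) l) + (F (fst w) l - F x l)) \<longlongrightarrow> 0 + 0) ?F"
      by (intro tendsto_add)
    then show "((\<lambda>(x, k). F x k) \<longlongrightarrow> (case z of (x, k) \<Rightarrow> F x k)) (at z within {0..} \<times> UNIV)"
      by (simp add: z LIM_zero_iff case_prod_unfold)
  qed
  show "continuous_on ({0..} \<times> UNIV) (\<lambda>(x, k). P x k)"
    by (rule main[OF P_continuous(1)]) (use lipschitz_in_k in \<open>smt (verit) norm_ge_zero\<close>)
  show "continuous_on ({0..} \<times> UNIV) (\<lambda>(x, k). Ps x k)"
    by (rule main[OF P_continuous(2)]) (use lipschitz_in_k in \<open>smt (verit) norm_ge_zero\<close>)
qed

lemma joint_measurability: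
  "(\<lambda>z. indicator {0..} (fst z) *\<^sub>R P (fst z) (of_real (snd z))) \<in> borel_measurable (borel \<Otimes>\<^sub>M borel)"
proof -
  have "continuous_on ({0::real..} \<times> (UNIV::real set)) ((\<lambda>(x, k). P x k) \<circ> (\<lambda>z. (fst z, of_real (snd z))))"
    by (rule continuous_on_compose) (auto intro!: continuous_intros continuous_on_subset[OF joint_continuity(1)])
  then have "(\<lambda>z. indicator ({0::real..} \<times> (UNIV::real set)) z *\<^sub>R P (fst z) (of_real (snd z))) \<in> borel_measurable borel"
    by (intro borel_measurable_continuous_on_indicator borel_closed closed_Times) (auto simp: o_def)
  moreover have "indicator ({0::real..} \<times> (UNIV::real set)) z = (indicator {0..} (fst z) :: real)" for z
    by (cases z) (auto simp: indicator_def)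
  ultimately show ?thesis by (simp add: borel_prod)
qed

lemma continuous_in_k:
  assumes "0 \<le> r"
  shows "continuous_on UNIV (\<lambda>k. P r k)" "continuous_on UNIV (\<lambda>k. Ps r k)"
proof -
  have "continuous_on UNIV ((\<lambda>(x, k). P x k) \<circ> (\<lambda>k. (r, k)))" "continuous_on UNIV ((\<lambda>(x, k). Ps x k) \<circ> (\<lambda>k. (r, k)))"
    by (rule continuous_on_compose; auto intro!: continuous_intros continuous_on_subset[OF joint_continuity(1)] continuous_on_subset[OF joint_continuity(2)] simp: assms)+
  then show "continuous_on UNIV (\<lambda>k. P r k)" "continuous_on UNIV (\<lambda>k. Ps r k)" by (simp_all add: o_def)
qed

lemma measurable_in_k:
  assumes "0 \<le> r"
  shows "(\<lambda>k::real. P r (of_real k)) \<in> borel_measurable borel" "(\<lambda>k::real. Ps r (of_real k)) \<in> borel_measurable borel"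
  using continuous_in_k[OF assms]
  by (auto intro!: borel_measurable_continuous_onI continuous_on_compose2[where f = complex_of_real and t = UNIV] continuous_intros)

text \<open>Cauchy-Schwarz bounds the square of the integral by \<open>normA2 * \<delta>\<close>,
  and 64 makes this at most (1/8)^2.\<close>

lemma A_L1_small:
  assumes "\<delta> = 1 / (64 * (1 + normA2))"
  shows "(LINT x:{0..\<delta>}|lborel. cmod (A x)) \<le> 1 / 8"
proof -
  have d: "\<delta> > 0" using normA2_nonneg by (simp add: assms)
  have "(LINT x:{0..\<delta>}|lborel. cmod (A x) * 1)\<^sup>2 \<le> (LINT x:{0..\<delta>}|lborel. (cmod (A x))\<^sup>2) * (LINT x:{0..\<delta>}|lborel. 1\<^sup>2)"
    by (rule Cauchy_Schwarz_set_integral(2)) (simp_all add: set_borel_measurable_def A_square_integrable set_integrable_continuous_on)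
  also have "\<dots> \<le> normA2 * \<delta>"
    using A_sq_le[of 0 \<delta>] d by (simp add: set_integral_real_const mult_right_mono)
  also have "\<dots> \<le> (1/8)\<^sup>2" using normA2_nonneg by (simp add: assms field_simps power2_eq_square)
  finally show ?thesis by (simp add: power2_le_iff_abs_le)
qed

text \<open>On [0, \<delta>] the maximum \<open>M\<close> of |Ps(x, \<i>)|, which also bounds |P(x,
  \<i>)|, satisfies M \<le> 1 + M/8. Hence M \<le> 8/7, and \<open>P\<close> at \<i> cannot leave
  its initial value 1 by more than 1/2.\<close>

lemma energy_lower_bound:
  assumes \<delta>: "\<delta> = 1 / (64 * (1 + normA2))" and r: "r \<ge> \<delta>"
  shows "energy r \<ge> \<delta> / 4"
proof -
  have d: "\<delta> > 0" "\<delta> \<le> 1 / 64" using normA2_nonneg by (auto simp: assms field_simps)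
  obtain x0 where x0: "x0 \<in> {0..\<delta>}" "\<And>x. x \<in> {0..\<delta>} \<Longrightarrow> cmod (Ps x \<i>) \<le> cmod (Ps x0 \<i>)"
    using continuous_attains_sup[of "{0..\<delta>}" "\<lambda>x. cmod (Ps x \<i>)"] d by (force intro!: continuous_intros P_continuous')
  define M where "M = cmod (Ps x0 \<i>)"
  have M0: "M \<ge> 0" by (simp add: M_def)
  have Ps: "cmod (Ps x \<i>) \<le> M" if "x \<in> {0..\<delta>}" for x using x0(2)[OF that] by (simp add: M_def)
  have P: "cmod (P x \<i>) \<le> M" if "x \<in> {0..\<delta>}" for x
    using Ps[OF that] norm_P_le_norm_Ps[of x] that by simp
  have AL: "(LINT y:{0..x}|lborel. cmod (A y) * M) \<le> M / 8" if "x \<in> {0..\<delta>}" for x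
  proof -
    have "(LINT y:{0..x}|lborel. cmod (A y)) \<le> (LINT y:{0..\<delta>}|lborel. cmod (A y))"
      by (rule set_integral_mono_subset) (use that in \<open>auto intro!: A_integrable_variants\<close>)
    then have "(LINT y:{0..x}|lborel. cmod (A y)) \<le> 1 / 8" using A_L1_small[OF \<delta>] by simp
    then show ?thesis using M0 mult_right_mono[of _ "1/8" M] by simp
  qed
  have "M \<le> 8 / 7"
  proof -
    have "Ps x0 \<i> = 1 + - (LINT y:{0..x0}|lborel. A y * P y \<i>)"
      using Ps_increment[of 0 x0 \<i>] x0 by (simp add: initial_values algebra_simps)
    then have "M \<le> 1 + cmod (LINT y:{0..x0}|lborel. A y * P y \<i>)"
      unfolding M_def by (rule norm_one_diff_le)
    also have "cmod (LINT y:{0..x0}|lborel. A y * P y \<i>) \<le> (LINT y:{0..x0}|lborel. cmod (A y) * M)"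
    proof (rule set_integral_norm_mono)
      show "cmod (A y * P y \<i>) \<le> cmod (A y) * M" if "y \<in> {0..x0}" for y
        using P[of y] that x0(1) by (simp add: norm_mult mult_left_mono)
    qed (simp_all add: A_integrable_variants P_continuous')
    also have "\<dots> \<le> M / 8" using AL x0 by simp
    finally show ?thesis by simp
  qed
  have "cmod (P x \<i>) \<ge> 1 / 2" if x: "x \<in> {0..\<delta>}" for x
  proof -
    have "P x \<i> = 1 + (LINT y:{0..x}|lborel. \<i> * \<i> * P y \<i> - cnj (A y) * Ps y \<i>)"
      using P_increment(1)[of 0 x \<i>] x by (simp add: initial_values algebra_simps)
    then have "1 - cmod (LINT y:{0..x}|lborel. \<i> * \<i> * P y \<i> - cnj (A y) * Ps y \<i>) \<le> cmod (P x \<i>)"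
      by (metis norm_diff_ineq norm_one)
    moreover have "cmod (LINT y:{0..x}|lborel. \<i> * \<i> * P y \<i> - cnj (A y) * Ps y \<i>) \<le> (LINT y:{0..x}|lborel. M + cmod (A y) * M)"
    proof (rule set_integral_norm_mono)
      show "set_integrable lborel {0..x} (\<lambda>y. \<i> * \<i> * P y \<i> - cnj (A y) * Ps y \<i>)"
        using P_increment(2)[of 0 x \<i>] x by simp
      show "set_integrable lborel {0..x} (\<lambda>y. M + cmod (A y) * M)"
        by (intro set_integral_add(1) A_integrable_variants set_integrable_continuous_on continuous_intros) auto
      show "cmod (\<i> * \<i> * P y \<i> - cnj (A y) * Ps y \<i>) \<le> M + cmod (A y) * M" if "y \<in> {0..x}" for y
        using that x P Ps by (intro order_trans[OF norm_triangle_ineq4] add_mono) (auto simp: norm_mult intro!: mult_left_mono)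
    qed
    moreover have "(LINT y:{0..x}|lborel. M + cmod (A y) * M) = x * M + (LINT y:{0..x}|lborel. cmod (A y) * M)"
      using x by (subst set_integral_add(2)) (simp_all add: set_integral_real_const set_integrable_continuous_on A_integrable_variants)
    moreover have "x * M \<le> 1 / 64 * (8 / 7)"
      using x d M0 \<open>M \<le> 8/7\<close> by (intro mult_mono) auto
    ultimately show ?thesis using AL[OF x] \<open>M \<le> 8/7\<close> by simp
  qed
  then have "(1/2)\<^sup>2 \<le> (cmod (P x \<i>))\<^sup>2" if "x \<in> {0..\<delta>}" for x using that by (intro power_mono) auto
  then have "(LINT x:{0..\<delta>}|lborel. (1/2::real)\<^sup>2) \<le> energy \<delta>"
    unfolding energy_def by (intro set_integral_mono energy_integrable set_integrable_continuous_on) auto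
  moreover have "(LINT x:{0..\<delta>}|lborel. (1/2::real)\<^sup>2) = \<delta> / 4"
    using d by (simp add: set_integral_real_const power2_eq_square)
  ultimately show ?thesis using energy_mono[OF r] by simp
qed

text \<open>Bounds the numerator of the quotient |Ps(r, \<i>)|^2 / energy r of
  \<open>weighted_P_bound_kernel\<close>; the part that grows with r is proportional to the energy
  and cancels.\<close>

lemma Ps_sq_le:
  assumes "0 \<le> r"
  shows "(cmod (Ps r \<i>))\<^sup>2 \<le> 2 + 2 * normA2 * energy r"
proof -
  have "Ps r \<i> = 1 + - (LINT y:{0..r}|lborel. A y * P y \<i>)"
    using Ps_increment[of 0 r \<i>] assms by (simp add: initial_values algebra_simps)
  then have "cmod (Ps r \<i>) \<le> 1 + cmod (LINT y:{0..r}|lborel. A y * P y \<i>)"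
    by (rule norm_one_diff_le)
  also have "cmod (LINT y:{0..r}|lborel. A y * P y \<i>) \<le> (LINT y:{0..r}|lborel. cmod (A y) * cmod (P y \<i>))" (is "_ \<le> ?I")
    by (intro set_integral_norm_mono A_integrable_variants continuous_intros P_continuous') (auto simp: norm_mult)
  finally have "(cmod (Ps r \<i>))\<^sup>2 \<le> (1 + ?I)\<^sup>2" by (intro power_mono) auto
  also have "\<dots> \<le> 2 + 2 * ?I\<^sup>2" using square_sum_le[of 1 ?I] by simp
  also have "?I\<^sup>2 \<le> (LINT y:{0..r}|lborel. (cmod (A y))\<^sup>2) * (LINT y:{0..r}|lborel. (cmod (P y \<i>))\<^sup>2)"
  proof (rule Cauchy_Schwarz_set_integral(2))
    show "set_borel_measurable lborel {0..r} (\<lambda>x. cmod (P x \<i>))"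
      by (intro set_borel_measurable_Icc continuous_intros P_continuous') simp
  qed (auto intro!: A_square_integrable energy_integrable simp: set_borel_measurable_def)
  also have "\<dots> \<le> normA2 * energy r"
    unfolding energy_def[symmetric] using A_sq_le[of 0 r] energy_nonneg by (intro mult_right_mono) auto
  finally show ?thesis by simp
qed

end

section \<open>The orthogonality measure\<close>

lemma set_lebesgue_integral_lebesgue_eq_lborel:
  fixes f :: "real \<Rightarrow> 'a::{banach,second_countable_topology}"
  assumes "set_borel_measurable lborel S f"
  shows "(LINT x:S|lebesgue. f x) = (LINT x:S|lborel. f x)"
  using assms unfolding set_lebesgue_integral_def set_borel_measurable_def by (rule integral_completion)

lemma set_integrable_lebesgue_iff_lborel:
  fixes f :: "real \<Rightarrow> 'a::{banach,second_countable_topology}"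
  assumes "set_borel_measurable lborel S f"
  shows "set_integrable lebesgue S f \<longleftrightarrow> set_integrable lborel S f"
  using assms unfolding set_integrable_def set_borel_measurable_def by (rule integrable_completion)

locale krein_measure = krein +
  fixes \<sigma> :: "real measure"
  assumes orth: "orthogonality_measure P \<sigma>"
begin

lemma sets_sigma [measurable_cong]: "sets \<sigma> = sets borel"
  using orth by (simp add: orthogonality_measure_def)

lemma space_sigma [simp]: "space \<sigma> = UNIV"
  using sets_eq_imp_space_eq[OF sets_sigma] by simp

definition "mass = (\<integral>\<^sup>+k. ennreal (1 / (1 + k\<^sup>2)) \<partial>\<sigma>)"

lemma mass_finite: "mass < \<infinity>"
  using orth by (simp add: orthogonality_measure_def mass_def)

lemma isometry:
  assumes f [measurable]: "f \<in> borel_measurable borel"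
    and sq: "set_integrable lborel {0..a} (\<lambda>x. (cmod (f x))\<^sup>2)" and "a > 0"
  shows "(\<integral>\<^sup>+k. ennreal ((cmod (LINT r:{0..a}|lborel. f r * P r (of_real k)))\<^sup>2) \<partial>\<sigma>)
    = ennreal (LINT r:{0..a}|lborel. (cmod (f r))\<^sup>2)"
proof -
  define g where "g x = indicator {0..a} x *\<^sub>R f x" for x
  have gm [measurable]: "g \<in> borel_measurable borel" unfolding g_def[abs_def] by measurable
  have "set_integrable lborel {0..} (\<lambda>x. (cmod (g x))\<^sup>2)"
    using sq unfolding set_integrable_def
    by (rule Bochner_Integration.integrable_cong[OF refl, THEN iffD1, rotated])
      (auto simp: g_def indicator_def)
  then have "set_integrable lebesgue {0..} (\<lambda>x. (cmod (g x))\<^sup>2)"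
    by (subst set_integrable_lebesgue_iff_lborel) (simp_all add: set_borel_measurable_def)
  moreover have "set_borel_measurable lebesgue {0..} g"
    unfolding set_borel_measurable_def by (rule measurable_completion) measurable
  ultimately have "g square_integrable_on {0..}" by (simp add: square_integrable_on_def)
  then have iso: "(\<integral>\<^sup>+k. ennreal ((cmod (LINT r:{0..a}|lebesgue. g r * P r (of_real k)))\<^sup>2) \<partial>\<sigma>) =
        ennreal (LINT r:{0..a}|lebesgue. (cmod (g r))\<^sup>2)"
    using orth \<open>a > 0\<close> unfolding orthogonality_measure_def by blast
  have "(LINT r:{0..a}|lebesgue. g r * P r (of_real k)) = (LINT r:{0..a}|lborel. f r * P r (of_real k))" for k :: real
  proof -
    have "set_borel_measurable lborel {0..a} (\<lambda>r. P r (of_real k))"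
      by (intro set_borel_measurable_Icc P_continuous') simp
    then have "(\<lambda>r. g r * (indicator {0..a} r *\<^sub>R P r (of_real k))) \<in> borel_measurable lborel"
      unfolding set_borel_measurable_def by measurable
    moreover have "(\<lambda>r. g r * (indicator {0..a} r *\<^sub>R P r (of_real k))) = (\<lambda>r. indicator {0..a} r *\<^sub>R (g r * P r (of_real k)))"
      by (auto simp: fun_eq_iff indicator_def)
    ultimately have "(LINT r:{0..a}|lebesgue. g r * P r (of_real k)) = (LINT r:{0..a}|lborel. g r * P r (of_real k))"
      by (intro set_lebesgue_integral_lebesgue_eq_lborel) (simp add: set_borel_measurable_def)
    also have "\<dots> = (LINT r:{0..a}|lborel. f r * P r (of_real k))"
      by (rule set_lebesgue_integral_cong) (auto simp: g_def)
    finally show ?thesis .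
  qed
  moreover have "(LINT r:{0..a}|lebesgue. (cmod (g r))\<^sup>2) = (LINT r:{0..a}|lborel. (cmod (f r))\<^sup>2)"
  proof -
    have "(LINT r:{0..a}|lebesgue. (cmod (g r))\<^sup>2) = (LINT r:{0..a}|lborel. (cmod (g r))\<^sup>2)"
      by (rule set_lebesgue_integral_lebesgue_eq_lborel) (simp add: set_borel_measurable_def)
    also have "\<dots> = (LINT r:{0..a}|lborel. (cmod (f r))\<^sup>2)"
      by (rule set_lebesgue_integral_cong) (auto simp: g_def)
    finally show ?thesis .
  qed
  ultimately show ?thesis using iso by simp
qed

lemma isometry_interval:
  assumes f [measurable]: "f \<in> borel_measurable borel"
    and sq: "set_integrable lborel {a..b} (\<lambda>x. (cmod (f x))\<^sup>2)" and "0 \<le> a" "a < b"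
  shows "(\<integral>\<^sup>+k. ennreal ((cmod (LINT r:{a..b}|lborel. f r * P r (of_real k)))\<^sup>2) \<partial>\<sigma>)
    = ennreal (LINT r:{a..b}|lborel. (cmod (f r))\<^sup>2)"
proof -
  define g where "g x = indicator {a..b} x *\<^sub>R f x" for x
  have ind: "indicat_real {0..b} x * indicat_real {a..b} x = indicat_real {a..b} x" for x
    using assms by (auto simp: indicator_def)
  have ind2: "indicat_real {0..b} x *\<^sub>R (cmod (g x))\<^sup>2 = indicat_real {a..b} x *\<^sub>R (cmod (f x))\<^sup>2" for x
    using assms by (auto simp: indicator_def g_def)
  have "(\<integral>\<^sup>+k. ennreal ((cmod (LINT r:{0..b}|lborel. g r * P r (of_real k)))\<^sup>2) \<partial>\<sigma>)
    = ennreal (LINT r:{0..b}|lborel. (cmod (g r))\<^sup>2)"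
  proof (rule isometry)
    show "set_integrable lborel {0..b} (\<lambda>x. (cmod (g x))\<^sup>2)"
      using sq unfolding set_integrable_def ind2 .
  qed (use assms in \<open>auto simp: g_def\<close>)
  moreover have "(LINT r:{0..b}|lborel. g r * P r (of_real k)) = (LINT r:{a..b}|lborel. f r * P r (of_real k))" for k
    unfolding set_lebesgue_integral_def using assms
    by (intro Bochner_Integration.integral_cong) (auto simp: g_def indicator_def)
  moreover have "(LINT r:{0..b}|lborel. (cmod (g r))\<^sup>2) = (LINT r:{a..b}|lborel. (cmod (f r))\<^sup>2)"
    unfolding set_lebesgue_integral_def ind2 ..
  ultimately show ?thesis by simp
qed

text \<open>The isometry for \<open>A\<close> restricted to [a, b]. The right-hand side is additive
  over adjacent intervals, which is the form in which \<open>rademacher_menshov\<close> uses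
  orthogonality.\<close>

lemma Ps_isometry:
  assumes "0 \<le> a" "a \<le> b"
  shows "(\<integral>\<^sup>+k. ennreal ((cmod (Ps b (of_real k) - Ps a (of_real k)))\<^sup>2) \<partial>\<sigma>)
    = ennreal (LINT r:{a..b}|lborel. (cmod (A r))\<^sup>2)"
proof (cases "a = b")
  case True
  have "AE x in lborel. indicat_real {b} x * (cmod (A x))\<^sup>2 = 0"
    using AE_lborel_singleton[of b] by eventually_elim simp
  then have "(\<integral>x. indicat_real {b} x * (cmod (A x))\<^sup>2 \<partial>lborel) = 0" by (rule integral_eq_zero_AE)
  then show ?thesis using True by (simp add: set_lebesgue_integral_def)
next
  case False
  then show ?thesis
    using isometry_interval[OF A_borel A_square_integrable[OF assms(1)] assms(1)] assms
    by (simp add: Ps_increment)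
qed

text \<open>The Christoffel--Darboux kernel at \<open>\<i>\<close> has \<open>L\<^sup>2(\<sigma>)\<close>-norm squared equal to the energy, and on the
  real line it dominates \<open>P\<close> because \<open>\<bar>P\<bar> = \<bar>P\<^sub>*\<bar>\<close> there while \<open>\<bar>P\<^sub>*\<bar> > \<bar>P\<bar>\<close> at \<open>\<i>\<close>.\<close>

lemma weighted_P_bound_kernel:
  assumes "r > 0" "energy r > 0"
  shows "(\<integral>\<^sup>+k. ennreal ((cmod (P r (of_real k)))\<^sup>2 / (1 + k\<^sup>2)) \<partial>\<sigma>)
    \<le> ennreal ((cmod (Ps r \<i>))\<^sup>2 / energy r)"
proof -
  define E where "E = energy r"
  define N where "N = cmod (Ps r \<i>)"
  define p where "p = cmod (P r \<i>)"
  have E: "E > 0" using assms by (simp add: E_def)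
  have pN: "N\<^sup>2 - p\<^sup>2 = 2 * E" using energy_identity[of r] assms by (simp add: E_def N_def p_def)
  have "N\<^sup>2 > 0" using pN E zero_le_power2[of p] by linarith
  then have N: "N > 0" by (simp add: N_def)
  have "p \<le> N" using norm_P_le_norm_Ps[of r] assms by (simp add: N_def p_def)
  \<comment> \<open>From (N - p)(N + p) = 2 E and N + p \<le> 2 N.\<close>
  have gap: "E / N \<le> N - p"
  proof -
    have "2 * E = (N - p) * (N + p)" using pN by (simp add: power2_eq_square algebra_simps)
    also have "\<dots> \<le> (N - p) * (2 * N)" using \<open>p \<le> N\<close> by (intro mult_left_mono) auto
    finally show ?thesis using N by (simp add: field_simps)
  qed
  define L where "L k = (P r (of_real k) * cnj (P r \<i>) - Ps r (of_real k) * cnj (Ps r \<i>)) / (\<i> * (of_real k - cnj \<i>))" for k :: real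
  have nz: "complex_of_real k + \<i> \<noteq> 0" for k by (simp add: complex_eq_iff)
  have L: "(LINT x:{0..r}|lborel. cnj (P x \<i>) * P x (of_real k)) = L k" for k
    using christoffel_darboux[of r "of_real k" \<i>] assms nz[of k] by (simp add: L_def mult.commute)
  have Lm [measurable]: "L \<in> borel_measurable borel"
  proof -
    have [measurable]: "(\<lambda>k::real. P r (of_real k)) \<in> borel_measurable borel" "(\<lambda>k::real. Ps r (of_real k)) \<in> borel_measurable borel"
      using measurable_in_k[of r] assms by auto
    show ?thesis unfolding L_def by measurable
  qed
  \<comment> \<open>The reverse triangle inequality in the numerator of \<open>L\<close> leaves |P|
    (N - p) \<le> |L| |k + \<i>|, and |k + \<i>|^2 = 1 + k^2 is the origin of the weight.\<close>
  have ptw: "(cmod (P r (of_real k)))\<^sup>2 / (1 + k\<^sup>2) \<le> N\<^sup>2 / E\<^sup>2 * (cmod (L k))\<^sup>2" for k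
  proof -
    define x where "x = cmod (P r (of_real k))"
    have x: "cmod (Ps r (of_real k)) = x" using norm_P_eq_norm_Ps[of r k] assms by (simp add: x_def)
    have kk: "(cmod (of_real k + \<i>))\<^sup>2 = 1 + k\<^sup>2" by (simp add: cmod_power2)
    have "x * (E / N) \<le> x * (N - p)" using gap by (intro mult_left_mono) (auto simp: x_def)
    also have "\<dots> = cmod (Ps r (of_real k) * cnj (Ps r \<i>)) - cmod (P r (of_real k) * cnj (P r \<i>))"
      by (simp add: norm_mult x N_def p_def flip: x_def) (simp add: algebra_simps)
    also have "\<dots> \<le> cmod (P r (of_real k) * cnj (P r \<i>) - Ps r (of_real k) * cnj (Ps r \<i>))"
      by (metis norm_minus_commute norm_triangle_ineq2)
    also have "\<dots> = cmod (L k) * cmod (of_real k + \<i>)"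
      using nz[of k] by (simp add: L_def norm_divide norm_mult)
    finally have "(x * (E / N))\<^sup>2 \<le> (cmod (L k) * cmod (of_real k + \<i>))\<^sup>2"
      using E N by (intro power_mono) (auto simp: x_def)
    then have "x\<^sup>2 * (E\<^sup>2 / N\<^sup>2) \<le> (cmod (L k))\<^sup>2 * (1 + k\<^sup>2)"
      unfolding power_mult_distrib power_divide kk .
    moreover have "1 + k\<^sup>2 > 0" by (simp add: add_pos_nonneg)
    ultimately show ?thesis using E N unfolding x_def[symmetric] by (simp add: field_simps)
  qed
  have "(\<integral>\<^sup>+k. ennreal ((cmod (P r (of_real k)))\<^sup>2 / (1 + k\<^sup>2)) \<partial>\<sigma>)
      \<le> (\<integral>\<^sup>+k. ennreal (N\<^sup>2 / E\<^sup>2) * ennreal ((cmod (L k))\<^sup>2) \<partial>\<sigma>)"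
    using ptw by (intro nn_integral_mono) (simp flip: ennreal_mult)
  also have "\<dots> = ennreal (N\<^sup>2 / E\<^sup>2) * (\<integral>\<^sup>+k. ennreal ((cmod (L k))\<^sup>2) \<partial>\<sigma>)"
    by (intro nn_integral_cmult) measurable
  also have "(\<integral>\<^sup>+k. ennreal ((cmod (L k))\<^sup>2) \<partial>\<sigma>) = ennreal E"
  proof -
    define f where "f x = indicator {0..r} x *\<^sub>R cnj (P x \<i>)" for x
    have fm: "f \<in> borel_measurable borel"
    proof -
      have "continuous_on {0..r} (\<lambda>x. cnj (P x \<i>))" by (intro continuous_intros P_continuous') simp
      from set_borel_measurable_Icc[OF this] show ?thesis
        unfolding f_def[abs_def] by (simp add: set_borel_measurable_def)
    qed
    have "set_integrable lborel {0..r} (\<lambda>x. (cmod (P x \<i>))\<^sup>2)" by (simp add: energy_integrable)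
    then have "set_integrable lborel {0..r} (\<lambda>x. (cmod (f x))\<^sup>2)"
      by (rule set_integrable_cong[OF refl refl, THEN iffD1, rotated]) (simp add: f_def)
    from isometry[OF fm this assms(1)]
    have "(\<integral>\<^sup>+k. ennreal ((cmod (LINT x:{0..r}|lborel. f x * P x (of_real k)))\<^sup>2) \<partial>\<sigma>) = ennreal (LINT x:{0..r}|lborel. (cmod (f x))\<^sup>2)" .
    moreover have "(LINT x:{0..r}|lborel. f x * P x (of_real k)) = L k" for k
      unfolding L[symmetric] by (rule set_lebesgue_integral_cong) (auto simp: f_def)
    moreover have "(LINT x:{0..r}|lborel. (cmod (f x))\<^sup>2) = E"
      unfolding E_def energy_def by (rule set_lebesgue_integral_cong) (auto simp: f_def)
    ultimately show ?thesis by simp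
  qed
  also have "ennreal (N\<^sup>2 / E\<^sup>2) * ennreal E = ennreal (N\<^sup>2 / E)"
    using E by (simp add: power2_eq_square flip: ennreal_mult)
  finally show ?thesis by (simp add: N_def E_def)
qed

text \<open>The kernel estimate degenerates as r tends to 0, because the energy does. For r \<ge>
  \<delta> the energy is at least \<delta>/4, and 8/\<delta> = 512 (1 + normA2) plus 2 normA2 gives
  514. For smaller r a pointwise comparison with r = \<delta> costs (8/7)^2, and 514 * 64/49 is
  below 1000.\<close>

lemma weighted_P_bound:
  assumes "r \<ge> 0"
  shows "(\<integral>\<^sup>+k. ennreal ((cmod (P r (of_real k)))\<^sup>2 / (1 + k\<^sup>2)) \<partial>\<sigma>) \<le> ennreal (1000 * (1 + normA2))"
proof -
  define \<delta> where "\<delta> = 1 / (64 * (1 + normA2))"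
  have d: "\<delta> > 0" using normA2_nonneg by (simp add: \<delta>_def)
  have large: "(\<integral>\<^sup>+k. ennreal ((cmod (P r (of_real k)))\<^sup>2 / (1 + k\<^sup>2)) \<partial>\<sigma>) \<le> ennreal (514 * (1 + normA2))"
    if r: "r \<ge> \<delta>" for r
  proof -
    have E: "energy r \<ge> \<delta> / 4" by (rule energy_lower_bound[OF \<delta>_def r])
    then have E0: "energy r > 0" using d by linarith
    have "(cmod (Ps r \<i>))\<^sup>2 / energy r \<le> (2 + 2 * normA2 * energy r) / energy r"
      using Ps_sq_le[of r] E0 r d by (intro divide_right_mono) auto
    also have "\<dots> = 2 / energy r + 2 * normA2" using E0 by (simp add: field_simps)
    also have "2 / energy r \<le> 2 / (\<delta> / 4)" using E d by (intro divide_left_mono) auto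
    also have "2 / (\<delta> / 4) = 512 * (1 + normA2)" using normA2_nonneg by (simp add: \<delta>_def)
    finally have "(cmod (Ps r \<i>))\<^sup>2 / energy r \<le> 514 * (1 + normA2)" by simp
    moreover have "(\<integral>\<^sup>+k. ennreal ((cmod (P r (of_real k)))\<^sup>2 / (1 + k\<^sup>2)) \<partial>\<sigma>) \<le> ennreal ((cmod (Ps r \<i>))\<^sup>2 / energy r)"
      using r d E0 by (intro weighted_P_bound_kernel) auto
    ultimately show ?thesis by (meson ennreal_leI order_trans)
  qed
  show ?thesis
  proof (cases "r \<ge> \<delta>")
    case True
    then show ?thesis
      by (intro order_trans[OF large[OF True]] ennreal_leI) (use normA2_nonneg in simp)
  next
    case False
    \<comment> \<open>The absorption argument of \<open>energy_lower_bound\<close>, run back from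
      \<delta> on the real line, where |P| = |Ps|: the maximum satisfies M \<le> |Ps(\<delta>)| +
      M/8.\<close>
    have comp: "cmod (P r (of_real k)) \<le> 8 / 7 * cmod (P \<delta> (of_real k))" for k
    proof -
      define l where "l = complex_of_real k"
      obtain x0 where x0: "x0 \<in> {0..\<delta>}" "\<And>x. x \<in> {0..\<delta>} \<Longrightarrow> cmod (Ps x l) \<le> cmod (Ps x0 l)"
        using continuous_attains_sup[of "{0..\<delta>}" "\<lambda>x. cmod (Ps x l)"] d by (force intro!: continuous_intros P_continuous')
      define M where "M = cmod (Ps x0 l)"
      have "Ps x0 l = Ps \<delta> l + (LINT y:{x0..\<delta>}|lborel. A y * P y l)"
        using Ps_increment[of x0 \<delta> l] x0 by (simp add: algebra_simps)
      then have "M \<le> cmod (Ps \<delta> l) + cmod (LINT y:{x0..\<delta>}|lborel. A y * P y l)"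
        unfolding M_def by (metis norm_triangle_ineq)
      also have "cmod (LINT y:{x0..\<delta>}|lborel. A y * P y l) \<le> (LINT y:{x0..\<delta>}|lborel. cmod (A y) * M)"
      proof (rule set_integral_norm_mono)
        fix y assume y: "y \<in> {x0..\<delta>}"
        then have "cmod (P y l) \<le> M"
          using x0(2)[of y] x0(1) norm_P_eq_norm_Ps[of y k] by (simp add: M_def l_def)
        then show "cmod (A y * P y l) \<le> cmod (A y) * M" by (simp add: norm_mult mult_left_mono)
      qed (use x0 in \<open>simp_all add: A_integrable_variants P_continuous'\<close>)
      also have "(LINT y:{x0..\<delta>}|lborel. cmod (A y) * M) \<le> 1 / 8 * M"
      proof -
        have "(LINT y:{x0..\<delta>}|lborel. cmod (A y)) \<le> (LINT y:{0..\<delta>}|lborel. cmod (A y))"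
          by (rule set_integral_mono_subset) (use x0 in \<open>simp_all add: A_integrable_variants\<close>)
        then have "(LINT y:{x0..\<delta>}|lborel. cmod (A y)) \<le> 1 / 8" using A_L1_small[OF \<delta>_def] by simp
        then show ?thesis using mult_right_mono[of _ "1/8" M] by (simp add: M_def)
      qed
      finally have "M \<le> 8 / 7 * cmod (Ps \<delta> l)" by simp
      moreover have "cmod (P r l) \<le> M"
        using x0(2)[of r] False assms norm_P_eq_norm_Ps[of r k] by (simp add: M_def l_def)
      moreover have "cmod (Ps \<delta> l) = cmod (P \<delta> l)" using norm_P_eq_norm_Ps[of \<delta> k] d by (simp add: l_def)
      ultimately show ?thesis by (simp add: l_def)
    qed
    have [measurable]: "(\<lambda>k::real. P \<delta> (of_real k)) \<in> borel_measurable borel"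
      using measurable_in_k[of \<delta>] d by simp
    have "(\<integral>\<^sup>+k. ennreal ((cmod (P r (of_real k)))\<^sup>2 / (1 + k\<^sup>2)) \<partial>\<sigma>)
        \<le> (\<integral>\<^sup>+k. ennreal (64/49) * ennreal ((cmod (P \<delta> (of_real k)))\<^sup>2 / (1 + k\<^sup>2)) \<partial>\<sigma>)"
    proof (intro nn_integral_mono)
      fix k :: real
      have "(cmod (P r (of_real k)))\<^sup>2 \<le> (8 / 7 * cmod (P \<delta> (of_real k)))\<^sup>2" using comp by (intro power_mono) auto
      then have "(cmod (P r (of_real k)))\<^sup>2 / (1 + k\<^sup>2) \<le> 64/49 * (cmod (P \<delta> (of_real k)))\<^sup>2 / (1 + k\<^sup>2)"
        by (intro divide_right_mono) (auto simp: power_mult_distrib power2_eq_square)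
      then show "ennreal ((cmod (P r (of_real k)))\<^sup>2 / (1 + k\<^sup>2)) \<le> ennreal (64/49) * ennreal ((cmod (P \<delta> (of_real k)))\<^sup>2 / (1 + k\<^sup>2))"
        by (simp flip: ennreal_mult)
    qed
    also have "\<dots> = ennreal (64/49) * (\<integral>\<^sup>+k. ennreal ((cmod (P \<delta> (of_real k)))\<^sup>2 / (1 + k\<^sup>2)) \<partial>\<sigma>)"
      by (intro nn_integral_cmult) measurable
    also have "\<dots> \<le> ennreal (64/49) * ennreal (514 * (1 + normA2))"
      by (intro mult_left_mono large) auto
    also have "\<dots> \<le> ennreal (1000 * (1 + normA2))"
    proof -
      have "64/49 * (514 * (1 + normA2)) \<le> 1000 * (1 + normA2)" using normA2_nonneg by simp
      then have "ennreal (64/49 * (514 * (1 + normA2))) \<le> ennreal (1000 * (1 + normA2))" by (rule ennreal_leI)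
      then show ?thesis using normA2_nonneg by (subst (asm) ennreal_mult) auto
    qed
    finally show ?thesis .
  qed
qed

end

section \<open>The Rademacher--Menshov inequality\<close>

text \<open>Removing the binary digits of n from the lowest one up leads from n to 0 along at most
  one dyadic interval per level, and a single increment is at most the l^2 sum over its level. In
  the induction the last digit gives level 0, and the hypothesis for
  \<open>\<lambda>j. Z (2*j)\<close> gives the others.\<close>

lemma norm_dyadic_chain_le:
  fixes Z :: "nat \<Rightarrow> 'a::real_normed_vector"
  assumes "n \<le> 2 ^ L"
  shows "norm (Z n - Z 0) \<le> (\<Sum>l\<le>L. sqrt (\<Sum>i<2^(L-l). (norm (Z ((i+1)*2^l) - Z (i*2^l)))\<^sup>2))"
  using assms
proof (induction L arbitrary: Z n)
  case 0
  then have "n = 0 \<or> n = 1" by auto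
  then show ?case by auto
next
  case (Suc L)
  define m where "m = n div 2"
  define T where "T l = sqrt (\<Sum>i<2^(Suc L-l). (norm (Z ((i+1)*2^l) - Z (i*2^l)))\<^sup>2)" for l
  have m: "m \<le> 2 ^ L" using Suc.prems by (simp add: m_def)
  have "norm (Z n - Z (2*m)) \<le> T 0"
  proof (cases "even n")
    case True
    then show ?thesis by (simp add: m_def T_def sum_nonneg)
  next
    case False
    then have n: "n = 2*m+1" by (simp add: m_def)
    have "2*m < 2 ^ Suc L" using Suc.prems n by linarith
    then have "(norm (Z (2*m+1) - Z (2*m)))\<^sup>2 \<le> (\<Sum>i<2^Suc L. (norm (Z (i+1) - Z i))\<^sup>2)"
      by (intro member_le_sum[of "2*m" _ "\<lambda>i. (norm (Z (i+1) - Z i))\<^sup>2"]) auto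
    then have "sqrt ((norm (Z (2*m+1) - Z (2*m)))\<^sup>2) \<le> T 0"
      unfolding T_def by (intro real_sqrt_le_mono) simp
    then show ?thesis using n by simp
  qed
  moreover have "norm (Z (2*m) - Z 0) \<le> (\<Sum>l\<le>L. T (Suc l))"
  proof -
    have "norm (Z (2*m) - Z (2*0)) \<le> (\<Sum>l\<le>L. sqrt (\<Sum>i<2^(L-l). (norm (Z (2*((i+1)*2^l)) - Z (2*(i*2^l))))\<^sup>2))"
      by (rule Suc.IH[of m "\<lambda>j. Z (2*j)", OF m])
    also have "\<dots> = (\<Sum>l\<le>L. T (Suc l))"
      by (simp add: T_def mult.left_commute mult.assoc)
    finally show ?thesis by simp
  qed
  moreover have "norm (Z n - Z 0) \<le> norm (Z n - Z (2*m)) + norm (Z (2*m) - Z 0)"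
    using norm_triangle_ineq[of "Z n - Z (2*m)" "Z (2*m) - Z 0"] by simp
  ultimately have "norm (Z n - Z 0) \<le> T 0 + (\<Sum>l\<le>L. T (Suc l))" by linarith
  then show ?case unfolding T_def[symmetric] sum.atMost_Suc_shift .
qed

text \<open>Square function over all dyadic subintervals of [0, 2^L]. For orthogonal increments
  every level has at most the total mass, so passing to the mean costs only the number of
  levels.\<close>

definition block_sum :: "nat \<Rightarrow> (nat \<Rightarrow> 'a::real_normed_vector) \<Rightarrow> real" where
  "block_sum L Z = (\<Sum>l\<le>L. \<Sum>i<2^(L-l). (norm (Z ((i+1)*2^l) - Z (i*2^l)))\<^sup>2)"

lemma block_sum_bound:
  assumes "n \<le> 2 ^ L"
  shows "(norm (Z n - Z 0))\<^sup>2 \<le> real (L+1) * block_sum L Z"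
proof -
  define a where "a l = (\<Sum>i<2^(L-l). (norm (Z ((i+1)*2^l) - Z (i*2^l)))\<^sup>2)" for l
  have "(norm (Z n - Z 0))\<^sup>2 \<le> (\<Sum>l\<le>L. 1 * sqrt (a l))\<^sup>2"
    using norm_dyadic_chain_le[OF assms, of Z] by (intro power_mono) (auto simp: a_def)
  also have "\<dots> \<le> (\<Sum>l\<le>L. 1\<^sup>2) * (\<Sum>l\<le>L. (sqrt (a l))\<^sup>2)" by (rule Cauchy_Schwarz_ineq_sum)
  also have "\<dots> = real (L+1) * block_sum L Z"
    by (simp add: block_sum_def a_def sum_nonneg)
  finally show ?thesis .
qed

text \<open>Comparison with a telescoping sum, using l + 2 \<le> 2 (l + 1).\<close>

lemma sum_inverse_squares_le: "(\<Sum>l<L. 1 / (real (l+1))\<^sup>2) \<le> 2"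
proof -
  have "1 / (real (l+1))\<^sup>2 \<le> 2 * (1 / real (l+1) - 1 / real (l+2))" for l
  proof -
    have "2 * (1 / real (l+1) - 1 / real (l+2)) = 2 / (real (l+1) * real (l+2))" by (simp add: field_simps)
    moreover have "1 / a\<^sup>2 = 2 / (a * (2 * a))" for a :: real
      by (simp add: power2_eq_square)
    from this[of "real (l+1)"] have "1 / (real (l+1))\<^sup>2 = 2 / (real (l+1) * (2 * real (l+1)))" .
    moreover have "2 / (real (l+1) * (2 * real (l+1))) \<le> 2 / (real (l+1) * real (l+2))"
      by (intro divide_left_mono mult_left_mono) auto
    ultimately show ?thesis by simp
  qed
  then have "(\<Sum>l<L. 1 / (real (l+1))\<^sup>2) \<le> (\<Sum>l<L. 2 * (1 / real (l+1) - 1 / real (l+2)))" by (intro sum_mono)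
  also have "\<dots> = 2 * (1 - 1 / real (L+1))"
    by (induction L) (simp_all add: algebra_simps)
  also have "\<dots> \<le> 2" by simp
  finally show ?thesis .
qed

text \<open>The blocks of the Rademacher--Menshov argument are \<open>[2\<^sup>l - 1, 2\<^sup>l\<^sup>+\<^sup>1 - 1]\<close>; the first summand takes
  care of the increments between block ends, the second of the increments within a block.\<close>

definition menshov_term :: "(nat \<Rightarrow> 'a::real_normed_vector) \<Rightarrow> nat \<Rightarrow> real" where
  "menshov_term Z l = 4 * (real (l+1))\<^sup>2 * (norm (Z (2^(l+1) - 1) - Z (2^l - 1)))\<^sup>2
     + 2 * (real (l+1) * block_sum l (\<lambda>n. Z (2^l - 1 + n)))"

lemma block_sum_nonneg: "block_sum L Z \<ge> 0"
  by (auto simp: block_sum_def intro!: sum_nonneg)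

lemma menshov_term_nonneg: "menshov_term Z l \<ge> 0"
  by (auto simp: menshov_term_def block_sum_nonneg)

text \<open>The path from 0 to n goes along the block ends up to the block containing n, then
  through that block. Summing the nonnegative terms up to \<open>L\<close> covers both pieces, so
  the bound becomes a series that does not depend on n.\<close>

lemma menshov_pointwise:
  "\<exists>L. (norm (Z n - Z 0))\<^sup>2 \<le> (\<Sum>l\<le>L. menshov_term Z l)"
proof -
  \<comment> \<open>Shifted by one because the blocks start at 2^l - 1, which makes 0 the first
    block end.\<close>
  obtain L where L: "2 ^ L \<le> n + 1" "n + 1 < 2 ^ (L + 1)"
    using ex_power_ivl1[of 2 "n+1"] by auto
  define b where "b l = (2::nat) ^ l - 1" for l
  have bL: "b L \<le> n" "n - b L \<le> 2 ^ L" using L by (auto simp: b_def)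
  have "(norm (Z (b L + (n - b L)) - Z (b L + 0)))\<^sup>2 \<le> real (L+1) * block_sum L (\<lambda>j. Z (b L + j))"
    using block_sum_bound[OF bL(2), of "\<lambda>j. Z (b L + j)"] by simp
  then have 1: "(norm (Z n - Z (b L)))\<^sup>2 \<le> real (L+1) * block_sum L (\<lambda>j. Z (b L + j))" using bL by simp
  define B where "B l = norm (Z (b (l+1)) - Z (b l))" for l
  have tel: "Z (b L) - Z 0 = (\<Sum>l<L. Z (b (l+1)) - Z (b l))"
    using sum_lessThan_telescope[of "\<lambda>l. Z (b l)" L] by (simp add: b_def)
  \<comment> \<open>The weights 1/(l+1) are square summable, so Cauchy-Schwarz moves their inverses,
    comparable with the logarithm of the block end, onto the increments.\<close>
  have "norm (Z (b L) - Z 0) \<le> (\<Sum>l<L. (1 / real (l+1)) * (real (l+1) * B l))"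
    unfolding tel by (rule order_trans[OF norm_sum]) (simp add: B_def)
  then have "(norm (Z (b L) - Z 0))\<^sup>2 \<le> (\<Sum>l<L. (1 / real (l+1)) * (real (l+1) * B l))\<^sup>2"
    by (intro power_mono) auto
  also have "\<dots> \<le> (\<Sum>l<L. (1 / real (l+1))\<^sup>2) * (\<Sum>l<L. (real (l+1) * B l)\<^sup>2)" by (rule Cauchy_Schwarz_ineq_sum)
  also have "\<dots> \<le> 2 * (\<Sum>l<L. (real (l+1) * B l)\<^sup>2)"
    using sum_inverse_squares_le[of L] by (intro mult_right_mono sum_nonneg) (auto simp: power_divide)
  finally have 2: "(norm (Z (b L) - Z 0))\<^sup>2 \<le> 2 * (\<Sum>l<L. (real (l+1) * B l)\<^sup>2)" .
  have "norm (Z n - Z 0) \<le> norm (Z (b L) - Z 0) + norm (Z n - Z (b L))"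
    using norm_triangle_ineq[of "Z n - Z (b L)" "Z (b L) - Z 0"] by simp
  then have "(norm (Z n - Z 0))\<^sup>2 \<le> (norm (Z (b L) - Z 0) + norm (Z n - Z (b L)))\<^sup>2"
    by (intro power_mono) auto
  also have "\<dots> \<le> 2 * (norm (Z (b L) - Z 0))\<^sup>2 + 2 * (norm (Z n - Z (b L)))\<^sup>2" by (rule square_sum_le)
  also have "\<dots> \<le> (\<Sum>l<L. 4 * (real (l+1))\<^sup>2 * (B l)\<^sup>2) + 2 * (real (L+1) * block_sum L (\<lambda>j. Z (b L + j)))"
  proof -
    have "(\<Sum>l<L. 4 * (real (l+1))\<^sup>2 * (B l)\<^sup>2) = 2 * (2 * (\<Sum>l<L. (real (l+1) * B l)\<^sup>2))"
      unfolding sum_distrib_left by (simp add: power_mult_distrib mult.assoc)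
    then show ?thesis using 1 2 by linarith
  qed
  also have "\<dots> \<le> (\<Sum>l<L. menshov_term Z l) + menshov_term Z L"
    by (intro add_mono sum_mono) (auto simp: menshov_term_def B_def b_def block_sum_nonneg)
  also have "\<dots> = (\<Sum>l\<le>L. menshov_term Z l)" by (simp add: lessThan_Suc_atMost[symmetric])
  finally show ?thesis by blast
qed

text \<open>Orthogonality enters through the additive majorant \<open>G\<close>. Inside a block the
  l + 1 levels and the Cauchy-Schwarz factor l + 1 give 2 (l+1)^2, the increments between block ends
  give 4 (l+1)^2, together the 6. The majorant \<open>H\<close> is one measurable function for all
  n.\<close>

lemma rademacher_menshov:
  fixes Z :: "nat \<Rightarrow> 'a \<Rightarrow> complex" and G :: "nat \<Rightarrow> real"
  assumes [measurable]: "\<And>n. Z n \<in> borel_measurable M"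
    and G: "\<And>m n. m \<le> n \<Longrightarrow> G m \<le> G n"
    and Z: "\<And>m n. m \<le> n \<Longrightarrow> (\<integral>\<^sup>+x. ennreal ((cmod (Z n x - Z m x))\<^sup>2) \<partial>M) \<le> ennreal (G n - G m)"
  shows "\<exists>H\<in>borel_measurable M. (\<forall>n x. ennreal ((cmod (Z n x - Z 0 x))\<^sup>2) \<le> H x) \<and>
    (\<integral>\<^sup>+x. H x \<partial>M) \<le> (\<Sum>l. ennreal (6 * ((real (l+1))\<^sup>2 * (G (2^(l+1) - 1) - G (2^l - 1)))))"
proof -
  define V where "V l x = menshov_term (\<lambda>n. Z n x) l" for l x
  define H where "H x = (\<Sum>l. ennreal (V l x))" for x
  have Vm [measurable]: "V l \<in> borel_measurable M" for l
    unfolding V_def menshov_term_def block_sum_def by measurable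
  have "H \<in> borel_measurable M" unfolding H_def by measurable
  moreover have "ennreal ((cmod (Z n x - Z 0 x))\<^sup>2) \<le> H x" for n x
  proof -
    obtain L where "(norm (Z n x - Z 0 x))\<^sup>2 \<le> (\<Sum>l\<le>L. V l x)"
      using menshov_pointwise[of "\<lambda>n. Z n x" n] unfolding V_def by blast
    then have "ennreal ((cmod (Z n x - Z 0 x))\<^sup>2) \<le> ennreal (\<Sum>l\<le>L. V l x)" by (rule ennreal_leI)
    also have "\<dots> = (\<Sum>l\<le>L. ennreal (V l x))" by (simp add: V_def menshov_term_nonneg)
    also have "\<dots> \<le> H x" unfolding H_def by (intro sum_le_suminf) auto
    finally show ?thesis .
  qed
  moreover have "(\<integral>\<^sup>+x. H x \<partial>M) \<le> (\<Sum>l. ennreal (6 * ((real (l+1))\<^sup>2 * (G (2^(l+1) - 1) - G (2^l - 1)))))"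
  proof -
    have "(\<integral>\<^sup>+x. H x \<partial>M) = (\<Sum>l. \<integral>\<^sup>+x. ennreal (V l x) \<partial>M)"
      unfolding H_def by (intro nn_integral_suminf) measurable
    also have "\<dots> \<le> (\<Sum>l. ennreal (6 * ((real (l+1))\<^sup>2 * (G (2^(l+1) - 1) - G (2^l - 1)))))"
    proof (intro suminf_le allI)
      fix l
      define b where "b = (2::nat) ^ l - 1"
      define c where "c = (2::nat) ^ (l+1) - 1"
      have bc: "c = b + 2 ^ l" by (simp add: b_def c_def)
      define g where "g = G c - G b"
      have g0: "g \<ge> 0" using G[of b c] by (simp add: g_def bc)
      have "(\<integral>\<^sup>+x. ennreal (V l x) \<partial>M) = (\<integral>\<^sup>+x. ennreal (4 * (real (l+1))\<^sup>2) * ennreal ((cmod (Z c x - Z b x))\<^sup>2)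
         + ennreal (2 * real (l+1)) * (\<Sum>j\<le>l. \<Sum>i<2^(l-j). ennreal ((cmod (Z (b + (i+1)*2^j) x - Z (b + i*2^j) x))\<^sup>2)) \<partial>M)"
        unfolding V_def menshov_term_def block_sum_def b_def[symmetric] c_def[symmetric]
      proof (intro nn_integral_cong)
        fix x
        define z where "z = (cmod (Z c x - Z b x))\<^sup>2"
        define \<beta> where "\<beta> = (\<Sum>j\<le>l. \<Sum>i<2^(l-j). (cmod (Z (b + (i+1)*2^j) x - Z (b + i*2^j) x))\<^sup>2)"
        have z: "z \<ge> 0" by (simp add: z_def)
        have \<beta>: "\<beta> \<ge> 0" by (auto simp: \<beta>_def intro!: sum_nonneg)
        have "(\<Sum>j\<le>l. \<Sum>i<2^(l-j). ennreal ((cmod (Z (b + (i+1)*2^j) x - Z (b + i*2^j) x))\<^sup>2)) = ennreal \<beta>"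
          unfolding \<beta>_def by ((subst sum_ennreal, simp add: sum_nonneg)+, rule refl)
        moreover have "ennreal (4 * (real (l+1))\<^sup>2 * z + 2 * (real (l+1) * \<beta>))
            = ennreal (4 * (real (l+1))\<^sup>2) * ennreal z + ennreal (2 * real (l+1)) * ennreal \<beta>"
        proof -
          have "ennreal (4 * (real (l+1))\<^sup>2) * ennreal z = ennreal (4 * (real (l+1))\<^sup>2 * z)"
            using z by (intro ennreal_mult[symmetric]) auto
          moreover have "ennreal (2 * real (l+1)) * ennreal \<beta> = ennreal (2 * (real (l+1) * \<beta>))"
            using \<beta> by (subst ennreal_mult[symmetric]) (auto simp: mult.assoc)
          ultimately show ?thesis using z \<beta> by (simp add: ennreal_plus[symmetric] del: ennreal_plus)
        qed
        ultimately show "ennreal (4 * (real (l+1))\<^sup>2 * (cmod (Z c x - Z b x))\<^sup>2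
            + 2 * (real (l+1) * (\<Sum>j\<le>l. \<Sum>i<2^(l-j). (cmod (Z (b + (i+1)*2^j) x - Z (b + i*2^j) x))\<^sup>2)))
          = ennreal (4 * (real (l+1))\<^sup>2) * ennreal ((cmod (Z c x - Z b x))\<^sup>2)
            + ennreal (2 * real (l+1)) * (\<Sum>j\<le>l. \<Sum>i<2^(l-j). ennreal ((cmod (Z (b + (i+1)*2^j) x - Z (b + i*2^j) x))\<^sup>2))"
          by (simp only: z_def \<beta>_def)
      qed
      also have "\<dots> = ennreal (4 * (real (l+1))\<^sup>2) * (\<integral>\<^sup>+x. ennreal ((cmod (Z c x - Z b x))\<^sup>2) \<partial>M)
         + ennreal (2 * real (l+1)) * (\<Sum>j\<le>l. \<Sum>i<2^(l-j). \<integral>\<^sup>+x. ennreal ((cmod (Z (b + (i+1)*2^j) x - Z (b + i*2^j) x))\<^sup>2) \<partial>M)"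
        by (simp add: nn_integral_add nn_integral_cmult nn_integral_sum del: sum_ennreal)
      also have "\<dots> \<le> ennreal (4 * (real (l+1))\<^sup>2) * ennreal g + ennreal (2 * real (l+1)) * (\<Sum>j\<le>l. ennreal g)"
      proof (intro add_mono mult_left_mono sum_mono)
        show "(\<integral>\<^sup>+x. ennreal ((cmod (Z c x - Z b x))\<^sup>2) \<partial>M) \<le> ennreal g"
          unfolding g_def by (rule Z) (simp add: bc)
        fix j assume j: "j \<in> {..l}"
        have "(\<Sum>i<2^(l-j). \<integral>\<^sup>+x. ennreal ((cmod (Z (b + (i+1)*2^j) x - Z (b + i*2^j) x))\<^sup>2) \<partial>M)
            \<le> (\<Sum>i<2^(l-j). ennreal (G (b + (i+1)*2^j) - G (b + i*2^j)))"
          by (intro sum_mono Z) simp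
        \<comment> \<open>On each level the intervals tile the block, so the increments of
          \<open>G\<close> telescope to the full mass \<open>g\<close>, whatever the level.\<close>
        also have "\<dots> = ennreal (\<Sum>i<2^(l-j). G (b + Suc i*2^j) - G (b + i*2^j))"
          using G by (subst sum_ennreal) (auto simp: algebra_simps)
        also have "(\<Sum>i<2^(l-j). G (b + Suc i*2^j) - G (b + i*2^j)) = G (b + 2^(l-j)*2^j) - G (b + 0*2^j)"
          by (rule sum_lessThan_telescope)
        also have "\<dots> = g" using j by (simp add: g_def bc flip: power_add)
        finally show "(\<Sum>i<2^(l-j). \<integral>\<^sup>+x. ennreal ((cmod (Z (b + (i+1)*2^j) x - Z (b + i*2^j) x))\<^sup>2) \<partial>M) \<le> ennreal g" .
      qed auto
      also have "(\<Sum>j\<le>l. ennreal g) = ennreal (real (l+1) * g)"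
        using g0 by (subst sum_ennreal) auto
      also have "ennreal (4 * (real (l+1))\<^sup>2) * ennreal g + ennreal (2 * real (l+1)) * ennreal (real (l+1) * g)
          = ennreal (4 * (real (l+1))\<^sup>2 * g + 2 * real (l+1) * (real (l+1) * g))"
        using g0 by (subst ennreal_plus) (simp_all add: ennreal_mult)
      also have "4 * (real (l+1))\<^sup>2 * g + 2 * real (l+1) * (real (l+1) * g) = 6 * ((real (l+1))\<^sup>2 * g)"
        by (simp add: power2_eq_square)
      finally show "(\<integral>\<^sup>+x. ennreal (V l x) \<partial>M) \<le> ennreal (6 * ((real (l+1))\<^sup>2 * (G (2^(l+1) - 1) - G (2^l - 1))))"
        by (simp only: g_def b_def c_def)
    qed auto
    finally show ?thesis .
  qed
  ultimately show ?thesis by blast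
qed

section \<open>The maximal function\<close>

lemma ennreal_double_sum: "0 \<le> a \<Longrightarrow> 0 \<le> b \<Longrightarrow> ennreal (2 * a + 2 * b) = 2 * ennreal a + 2 * ennreal b"
  by (subst ennreal_plus) (simp_all add: ennreal_mult)

context krein
begin

text \<open>Cut off at 0, since \<open>P\<close> is arbitrary at negative arguments while Tonelli's
  theorem needs measurability on the whole plane.\<close>

definition "Pb x k = indicat_real {0..} x *\<^sub>R P x (complex_of_real k)"

lemma Pb_eq: "x \<ge> 0 \<Longrightarrow> Pb x k = P x (of_real k)"
  by (simp add: Pb_def)

lemma Pb_measurable [measurable (raw)]:
  assumes [measurable]: "f \<in> borel_measurable M" "g \<in> borel_measurable M"
  shows "(\<lambda>w. Pb (f w) (g w)) \<in> borel_measurable M"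
proof -
  have "(\<lambda>w. (f w, g w)) \<in> M \<rightarrow>\<^sub>M borel \<Otimes>\<^sub>M borel" by measurable
  from measurable_compose[OF this joint_measurability] show ?thesis by (simp add: Pb_def)
qed

end

section \<open>Increments of \<open>Ps\<close> inside a unit interval\<close>

context krein_measure
begin

text \<open>Required for Tonelli's theorem with \<sigma>. On [-n, n] the weight is at least 1/(1 +
  n^2), so the finite weighted mass bounds the measure of this interval.\<close>

lemma sigma_finite: "sigma_finite_measure \<sigma>"
proof
  have "emeasure \<sigma> {- real n..real n} \<noteq> \<infinity>" for n
  proof -
    have "emeasure \<sigma> {- real n..real n} = (\<integral>\<^sup>+k. indicator {- real n..real n} k \<partial>\<sigma>)" by simp
    also have "\<dots> \<le> (\<integral>\<^sup>+k. ennreal (1 + (real n)\<^sup>2) * ennreal (1 / (1 + k\<^sup>2)) \<partial>\<sigma>)"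
    proof (intro nn_integral_mono)
      fix k
      show "indicator {- real n..real n} k \<le> ennreal (1 + (real n)\<^sup>2) * ennreal (1 / (1 + k\<^sup>2))"
      proof (cases "k \<in> {- real n..real n}")
        case True
        then have "\<bar>k\<bar> \<le> real n" by auto
        then have "k\<^sup>2 \<le> (real n)\<^sup>2" using power_mono[of "\<bar>k\<bar>" "real n" 2] by simp
        then have "1 \<le> (1 + (real n)\<^sup>2) * (1 / (1 + k\<^sup>2))" by (simp add: add_pos_nonneg)
        then have "ennreal 1 \<le> ennreal ((1 + (real n)\<^sup>2) * (1 / (1 + k\<^sup>2)))" by (rule ennreal_leI)
        then show ?thesis using True by (subst ennreal_mult[symmetric]) auto
      qed simp
    qed
    also have "\<dots> = ennreal (1 + (real n)\<^sup>2) * mass"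
      unfolding mass_def by (intro nn_integral_cmult) measurable
    also have "\<dots> < \<infinity>" using mass_finite by (simp add: ennreal_mult_less_top)
    finally show ?thesis by simp
  qed
  moreover have "(\<Union>n. {- real n..real n}) = UNIV"
  proof -
    have "\<exists>n. x \<in> {- real n..real n}" for x
    proof -
      obtain n where "\<bar>x\<bar> \<le> real n" using real_arch_simple by blast
      then have "x \<in> {- real n..real n}" by auto
      then show ?thesis ..
    qed
    then show ?thesis by auto
  qed
  ultimately show "\<exists>A. countable A \<and> A \<subseteq> sets \<sigma> \<and> \<Union> A = space \<sigma> \<and> (\<forall>a\<in>A. emeasure \<sigma> a \<noteq> \<infinity>)"
    by (intro exI[of _ "range (\<lambda>n::nat. {- real n..real n})"]) (auto simp: sets_sigma)
qed

text \<open>The Cauchy-Schwarz bound for the increment of \<open>Ps\<close> from t to any point of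
  [t, t+1]. It no longer depends on that point, so it dominates the supremum over the interval, and
  it is measurable in k.\<close>

definition "unit_term t k = ennreal (LINT x:{t..t+1}|lborel. (cmod (A x))\<^sup>2)
    * (\<integral>\<^sup>+x. indicator {t..t+1} x * ennreal ((cmod (Pb x k))\<^sup>2 / (1 + k\<^sup>2)) \<partial>lborel)"

lemma unit_term_measurable [measurable]: "unit_term t \<in> borel_measurable borel"
  unfolding unit_term_def[abs_def] by measurable

text \<open>Tonelli brings the \<sigma>-integral inside, where \<open>weighted_P_bound\<close>
  applies at every x of an interval of length 1.\<close>

lemma unit_term_integral:
  assumes "t \<ge> 0"
  shows "(\<integral>\<^sup>+k. unit_term t k \<partial>\<sigma>) \<le> ennreal (1000 * (1 + normA2) * (LINT x:{t..t+1}|lborel. (cmod (A x))\<^sup>2))"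
proof -
  interpret \<sigma>: sigma_finite_measure \<sigma> by (rule sigma_finite)
  interpret pair_sigma_finite lborel \<sigma> ..
  define \<alpha> where "\<alpha> = (LINT x:{t..t+1}|lborel. (cmod (A x))\<^sup>2)"
  have \<alpha>: "\<alpha> \<ge> 0"
    unfolding \<alpha>_def set_lebesgue_integral_def by (rule Bochner_Integration.integral_nonneg) simp
  have "(\<integral>\<^sup>+k. unit_term t k \<partial>\<sigma>) = ennreal \<alpha> * (\<integral>\<^sup>+k. (\<integral>\<^sup>+x. indicator {t..t+1} x * ennreal ((cmod (Pb x k))\<^sup>2 / (1 + k\<^sup>2)) \<partial>lborel) \<partial>\<sigma>)"
    unfolding unit_term_def \<alpha>_def by (intro nn_integral_cmult) measurable
  also have "(\<integral>\<^sup>+k. (\<integral>\<^sup>+x. indicator {t..t+1} x * ennreal ((cmod (Pb x k))\<^sup>2 / (1 + k\<^sup>2)) \<partial>lborel) \<partial>\<sigma>)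
      = (\<integral>\<^sup>+x. (\<integral>\<^sup>+k. indicator {t..t+1} x * ennreal ((cmod (Pb x k))\<^sup>2 / (1 + k\<^sup>2)) \<partial>\<sigma>) \<partial>lborel)"
    by (rule Fubini') measurable
  also have "\<dots> \<le> (\<integral>\<^sup>+x. ennreal (1000 * (1 + normA2)) * indicator {t..t+1} x \<partial>lborel)"
  proof (intro nn_integral_mono)
    fix x
    show "(\<integral>\<^sup>+k. indicator {t..t+1} x * ennreal ((cmod (Pb x k))\<^sup>2 / (1 + k\<^sup>2)) \<partial>\<sigma>) \<le> ennreal (1000 * (1 + normA2)) * indicator {t..t+1} x"
    proof (cases "x \<in> {t..t+1}")
      case True
      then have "x \<ge> 0" using assms by simp
      then show ?thesis using True weighted_P_bound[of x] by (simp add: Pb_eq)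
    qed simp
  qed
  also have "\<dots> = ennreal (1000 * (1 + normA2))"
    by (subst nn_integral_cmult) auto
  finally have "(\<integral>\<^sup>+k. unit_term t k \<partial>\<sigma>) \<le> ennreal \<alpha> * ennreal (1000 * (1 + normA2))"
    by (simp add: mult_left_mono)
  also have "\<dots> = ennreal (1000 * (1 + normA2) * \<alpha>)"
    using \<alpha> normA2_nonneg by (subst ennreal_mult[symmetric]) (auto simp: mult.commute)
  finally show ?thesis by (simp add: \<alpha>_def)
qed

lemma unit_term_bound:
  assumes t: "t \<ge> 0" and r: "r \<in> {t..t+1}"
  shows "ennreal ((cmod (Ps r (of_real k) - Ps t (of_real k)))\<^sup>2 / (1 + k\<^sup>2)) \<le> unit_term t k"
proof -
  define l where "l = complex_of_real k"
  define \<alpha> where "\<alpha> = (LINT x:{t..t+1}|lborel. (cmod (A x))\<^sup>2)"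
  define \<beta> where "\<beta> = (LINT x:{t..t+1}|lborel. (cmod (P x l))\<^sup>2)"
  have Pint: "set_integrable lborel {t..t+1} (\<lambda>x. (cmod (P x l))\<^sup>2)"
    by (intro set_integrable_continuous_on continuous_intros P_continuous' t)
  have \<alpha>0: "\<alpha> \<ge> 0" and \<beta>0: "\<beta> \<ge> 0"
    unfolding \<alpha>_def \<beta>_def set_lebesgue_integral_def by (rule Bochner_Integration.integral_nonneg, simp)+
  have "Ps r l - Ps t l = - (LINT x:{t..r}|lborel. A x * P x l)" using Ps_increment[of t r l] t r by simp
  then have "cmod (Ps r l - Ps t l) = cmod (LINT x:{t..r}|lborel. A x * P x l)" by simp
  also have "\<dots> \<le> (LINT x:{t..r}|lborel. cmod (A x) * cmod (P x l))"
    by (rule set_integral_norm_mono) (simp_all add: A_integrable_variants P_continuous' t continuous_on_norm norm_mult)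
  also have "\<dots> \<le> (LINT x:{t..t+1}|lborel. cmod (A x) * cmod (P x l))"
    by (rule set_integral_mono_subset) (use r in \<open>simp_all add: A_integrable_variants P_continuous' t continuous_on_norm\<close>)
  finally have "(cmod (Ps r l - Ps t l))\<^sup>2 \<le> (LINT x:{t..t+1}|lborel. cmod (A x) * cmod (P x l))\<^sup>2"
    by (intro power_mono) auto
  also have "\<dots> \<le> \<alpha> * \<beta>"
    unfolding \<alpha>_def \<beta>_def
    by (rule Cauchy_Schwarz_set_integral(2))
      (simp_all add: A_square_integrable t Pint set_borel_measurable_Icc continuous_on_norm P_continuous' set_borel_measurable_def[where f = "\<lambda>x. cmod (A x)"])
  finally have "(cmod (Ps r l - Ps t l))\<^sup>2 / (1 + k\<^sup>2) \<le> \<alpha> * (\<beta> / (1 + k\<^sup>2))"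
    by (simp add: divide_right_mono)
  then have "ennreal ((cmod (Ps r l - Ps t l))\<^sup>2 / (1 + k\<^sup>2)) \<le> ennreal \<alpha> * ennreal (\<beta> / (1 + k\<^sup>2))"
    using \<alpha>0 \<beta>0 by (subst ennreal_mult[symmetric]) (auto intro!: ennreal_leI)
  also have "ennreal (\<beta> / (1 + k\<^sup>2)) = (\<integral>\<^sup>+x. indicator {t..t+1} x * ennreal ((cmod (Pb x k))\<^sup>2 / (1 + k\<^sup>2)) \<partial>lborel)"
  proof -
    have int: "integrable lborel (\<lambda>x. indicat_real {t..t+1} x *\<^sub>R ((cmod (P x l))\<^sup>2 / (1 + k\<^sup>2)))"
      using set_integrable_divide[OF Pint, of "1 + k\<^sup>2"] by (simp add: set_integrable_def)
    have "(\<integral>\<^sup>+x. indicator {t..t+1} x * ennreal ((cmod (Pb x k))\<^sup>2 / (1 + k\<^sup>2)) \<partial>lborel)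
      = (\<integral>\<^sup>+x. ennreal (indicat_real {t..t+1} x *\<^sub>R ((cmod (P x l))\<^sup>2 / (1 + k\<^sup>2))) \<partial>lborel)"
      using t by (intro nn_integral_cong) (auto simp: Pb_eq l_def indicator_def)
    also have "\<dots> = ennreal (\<integral>x. indicat_real {t..t+1} x *\<^sub>R ((cmod (P x l))\<^sup>2 / (1 + k\<^sup>2)) \<partial>lborel)"
      by (rule nn_integral_eq_integral[OF int]) simp
    also have "(\<integral>x. indicat_real {t..t+1} x *\<^sub>R ((cmod (P x l))\<^sup>2 / (1 + k\<^sup>2)) \<partial>lborel) = \<beta> / (1 + k\<^sup>2)"
      by (simp add: \<beta>_def set_lebesgue_integral_def)
    finally show ?thesis by simp
  qed
  finally show ?thesis by (simp add: unit_term_def \<alpha>_def l_def)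
qed

end

section \<open>The logarithmic weight and the maximal function\<close>

locale krein_log = krein_measure +
  assumes A_log: "set_integrable lborel {0..} (\<lambda>x. (cmod (A x))\<^sup>2 * (ln (2 + x))\<^sup>2)"
begin

definition "tail \<rho> = (LINT x:{\<rho>..}|lborel. (cmod (A x))\<^sup>2 * (ln (2 + x))\<^sup>2)"

lemma A_log_integrable:
  "0 \<le> a \<Longrightarrow> set_integrable lborel {a..b} (\<lambda>x. (cmod (A x))\<^sup>2 * (ln (2 + x))\<^sup>2)"
  "0 \<le> a \<Longrightarrow> set_integrable lborel {a..} (\<lambda>x. (cmod (A x))\<^sup>2 * (ln (2 + x))\<^sup>2)"
  by (rule set_integrable_subset[OF A_log]; auto)+

definition "log_mass \<rho> n = (LINT x:{\<rho>..\<rho> + real n}|lborel. (cmod (A x))\<^sup>2 * (ln (2 + x))\<^sup>2)"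
definition "A_mass \<rho> n = (LINT x:{\<rho>..\<rho> + real n}|lborel. (cmod (A x))\<^sup>2)"

lemma log_mass_mono_tail:
  assumes "\<rho> \<ge> 0"
  shows "log_mass \<rho> n \<le> tail \<rho>"
  unfolding log_mass_def tail_def
  by (rule set_integral_mono_subset) (use assms in \<open>auto intro!: A_log_integrable\<close>)

lemma tail_nonneg: "tail \<rho> \<ge> 0"
  unfolding tail_def set_lebesgue_integral_def by (rule Bochner_Integration.integral_nonneg) simp

lemma masses_diff:
  assumes "\<rho> \<ge> 0" "m \<le> n"
  shows "A_mass \<rho> n - A_mass \<rho> m = (LINT x:{\<rho> + real m..\<rho> + real n}|lborel. (cmod (A x))\<^sup>2)"
    and "log_mass \<rho> n - log_mass \<rho> m = (LINT x:{\<rho> + real m..\<rho> + real n}|lborel. (cmod (A x))\<^sup>2 * (ln (2 + x))\<^sup>2)"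
  unfolding A_mass_def log_mass_def using assms
  by (subst set_integral_Icc_diff[of \<rho> "\<rho> + real m" "\<rho> + real n"]; auto intro!: A_square_integrable A_log_integrable)+

text \<open>Exchanges the factors (l+1)^2 of \<open>rademacher_menshov\<close> for the weight under
  the integral. The hypothesis starts at \<open>real m\<close>, not at
  \<open>\<rho> + real m\<close>, so the resulting constants are independent of \<rho>.\<close>

lemma mass_increment_le:
  assumes \<rho>: "\<rho> \<ge> 0" "m \<le> n" and c: "c \<ge> 0" "\<And>x. x \<ge> real m \<Longrightarrow> c \<le> ln (2 + x)"
  shows "c\<^sup>2 * (A_mass \<rho> n - A_mass \<rho> m) \<le> log_mass \<rho> n - log_mass \<rho> m"
proof -
  have "c\<^sup>2 * (A_mass \<rho> n - A_mass \<rho> m) = (LINT x:{\<rho> + real m..\<rho> + real n}|lborel. c\<^sup>2 * (cmod (A x))\<^sup>2)"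
    using masses_diff(1)[OF \<rho>] by simp
  also have "\<dots> \<le> (LINT x:{\<rho> + real m..\<rho> + real n}|lborel. (cmod (A x))\<^sup>2 * (ln (2 + x))\<^sup>2)"
  proof (rule set_integral_mono)
    show "set_integrable lborel {\<rho> + real m..\<rho> + real n} (\<lambda>x. c\<^sup>2 * (cmod (A x))\<^sup>2)"
      using \<rho> by (intro set_integrable_mult_right A_square_integrable) auto
    show "set_integrable lborel {\<rho> + real m..\<rho> + real n} (\<lambda>x. (cmod (A x))\<^sup>2 * (ln (2 + x))\<^sup>2)"
      using \<rho> by (intro A_log_integrable) auto
    fix x assume "x \<in> {\<rho> + real m..\<rho> + real n}"
    then have "c\<^sup>2 \<le> (ln (2 + x))\<^sup>2" using \<rho> c by (intro power_mono) auto
    then show "c\<^sup>2 * (cmod (A x))\<^sup>2 \<le> (cmod (A x))\<^sup>2 * (ln (2 + x))\<^sup>2"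
      using mult_right_mono[of "c\<^sup>2" "(ln (2 + x))\<^sup>2" "(cmod (A x))\<^sup>2"] by (simp add: mult.commute)
  qed
  also have "\<dots> = log_mass \<rho> n - log_mass \<rho> m" by (rule masses_diff(2)[OF \<rho>, symmetric])
  finally show ?thesis .
qed

lemma mass_increment_nonneg:
  assumes "\<rho> \<ge> 0" "m \<le> n"
  shows "A_mass \<rho> m \<le> A_mass \<rho> n"
proof -
  have "0 \<le> A_mass \<rho> n - A_mass \<rho> m"
    unfolding masses_diff[OF assms] set_lebesgue_integral_def by (rule Bochner_Integration.integral_nonneg) simp
  then show ?thesis by simp
qed

lemma log_mass_increment_nonneg:
  assumes "\<rho> \<ge> 0" "m \<le> n"
  shows "log_mass \<rho> m \<le> log_mass \<rho> n"
proof -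
  have "0 \<le> log_mass \<rho> n - log_mass \<rho> m"
    unfolding masses_diff[OF assms] set_lebesgue_integral_def by (rule Bochner_Integration.integral_nonneg) simp
  then show ?thesis by simp
qed

text \<open>Since 2 + x \<ge> 2^l and ln 2 \<ge> 2/3, the logarithm is at least 2l/3, which is at
  least (l+1)/3 once l \<ge> 1. For l = 0 the summand 2 in the logarithm is what saves the
  bound.\<close>

lemma ln_block_lower:
  assumes "x \<ge> real (2^l - 1)"
  shows "real (l+1) / 3 \<le> ln (2 + x)"
proof -
  have "(2::nat) ^ l \<ge> 1" by simp
  then have x: "x \<ge> 2 ^ l - 1" using assms by (simp add: of_nat_diff)
  have pow: "(2::real) ^ l \<ge> 1" by simp
  have x2: "2 \<le> 2 + x" "2 ^ l \<le> 2 + x" using x pow by linarith+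
  have "real l * ln 2 = ln (2 ^ l)" by (simp add: ln_realpow)
  also have "\<dots> \<le> ln (2 + x)" using x2 by (intro ln_mono) auto
  finally have 1: "real l * ln 2 \<le> ln (2 + x)" .
  have 2: "ln 2 \<le> ln (2 + x)" using x2 by (intro ln_mono) auto
  have 3: "ln (2::real) \<ge> 2/3" by (rule ln2_ge_two_thirds)
  show ?thesis
  proof (cases "l = 0")
    case True
    then show ?thesis using 2 3 by simp
  next
    case False
    have "real (l+1) / 3 \<le> real l * (2/3)" using False by simp
    also have "\<dots> \<le> real l * ln 2" using 3 by (intro mult_left_mono) auto
    finally show ?thesis using 1 by simp
  qed
qed

text \<open>A measurable majorant takes the place of the supremum over uncountably many pairs; it
  can be integrated by monotone convergence and reused for the convergence statement. Each point is
  reached from \<rho> by a grid point \<rho> + n, controlled by \<open>H\<close>, and an increment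
  inside a unit interval, controlled by \<open>Y\<close>.\<close>

lemma maximal_domination:
  assumes \<rho>: "\<rho> \<ge> 0"
  shows "\<exists>D\<in>borel_measurable borel.
    (\<forall>k r1 r2. \<rho> < r1 \<and> r1 < r2 \<longrightarrow> ennreal ((cmod (Ps r2 (of_real k) - Ps r1 (of_real k)))\<^sup>2 / (1 + k\<^sup>2)) \<le> D k) \<and>
    (\<integral>\<^sup>+k. D k \<partial>\<sigma>) \<le> ennreal (20000 * (1 + normA2) * tail \<rho>)"
proof -
  define t where "t n = \<rho> + real n" for n
  have t0: "t n \<ge> 0" for n using \<rho> by (simp add: t_def)
  define Z where "Z n k = Ps (t n) (complex_of_real k)" for n k
  have Zm: "Z n \<in> borel_measurable \<sigma>" for n
    unfolding Z_def measurable_cong_sets[OF sets_sigma refl] by (rule measurable_in_k(2)[OF t0])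
  have ZG: "(\<integral>\<^sup>+k. ennreal ((cmod (Z n k - Z m k))\<^sup>2) \<partial>\<sigma>) \<le> ennreal (A_mass \<rho> n - A_mass \<rho> m)" if "m \<le> n" for m n
    unfolding masses_diff(1)[OF \<rho> that] Z_def t_def using \<rho> that by (subst Ps_isometry) auto
  obtain H where Hm: "H \<in> borel_measurable \<sigma>"
    and H: "\<And>n k. ennreal ((cmod (Z n k - Z 0 k))\<^sup>2) \<le> H k"
    and Hint: "(\<integral>\<^sup>+k. H k \<partial>\<sigma>) \<le> (\<Sum>l. ennreal (6 * ((real (l+1))\<^sup>2 * (A_mass \<rho> (2^(l+1) - 1) - A_mass \<rho> (2^l - 1)))))"
    using rademacher_menshov[of Z \<sigma> "A_mass \<rho>", OF Zm mass_increment_nonneg[OF \<rho>] ZG] by blast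
  have le3: "(2::nat) ^ l - 1 \<le> 2 ^ (l+1) - 1" for l by (intro diff_le_mono) simp
  \<comment> \<open>54 = 6 * 9, where 9 comes from the lower bound (l+1)/3 for the logarithm. The
    block masses then telescope.\<close>
  have "(\<integral>\<^sup>+k. H k \<partial>\<sigma>) \<le> ennreal (54 * tail \<rho>)"
  proof (rule order_trans[OF Hint], rule suminf_le_const)
    fix N
    have "(\<Sum>l<N. ennreal (6 * ((real (l+1))\<^sup>2 * (A_mass \<rho> (2^(l+1) - 1) - A_mass \<rho> (2^l - 1)))))
        \<le> (\<Sum>l<N. ennreal (54 * (log_mass \<rho> (2^(l+1) - 1) - log_mass \<rho> (2^l - 1))))"
    proof (intro sum_mono ennreal_leI)
      fix l
      have "(real (l+1) / 3)\<^sup>2 * (A_mass \<rho> (2^(l+1) - 1) - A_mass \<rho> (2^l - 1)) \<le> log_mass \<rho> (2^(l+1) - 1) - log_mass \<rho> (2^l - 1)"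
        by (rule mass_increment_le[OF \<rho> le3 _ ln_block_lower]) auto
      then show "6 * ((real (l+1))\<^sup>2 * (A_mass \<rho> (2^(l+1) - 1) - A_mass \<rho> (2^l - 1))) \<le> 54 * (log_mass \<rho> (2^(l+1) - 1) - log_mass \<rho> (2^l - 1))"
        by (simp add: power_divide)
    qed
    also have "\<dots> = ennreal (\<Sum>l<N. 54 * (log_mass \<rho> (2^(l+1) - 1) - log_mass \<rho> (2^l - 1)))"
    proof (rule sum_ennreal)
      fix l
      have "log_mass \<rho> (2^l - 1) \<le> log_mass \<rho> (2^(l+1) - 1)" by (rule log_mass_increment_nonneg[OF \<rho> le3])
      then show "0 \<le> 54 * (log_mass \<rho> (2^(l+1) - 1) - log_mass \<rho> (2^l - 1))" by simp
    qed
    also have "(\<Sum>l<N. 54 * (log_mass \<rho> (2^(l+1) - 1) - log_mass \<rho> (2^l - 1))) = 54 * (log_mass \<rho> (2^N - 1) - log_mass \<rho> (2^0 - 1))"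
      unfolding sum_distrib_left[symmetric]
      using sum_lessThan_telescope[of "\<lambda>l. log_mass \<rho> (2^l - 1)" N] by simp
    also have "log_mass \<rho> (2^0 - 1) = 0"
      using set_integral_Icc_diff[of \<rho> \<rho> \<rho> "\<lambda>x. (cmod (A x))\<^sup>2 * (ln (2 + x))\<^sup>2"] A_log_integrable(1)[OF \<rho>]
      by (simp add: log_mass_def)
    also have "ennreal (54 * (log_mass \<rho> (2^N - 1) - 0)) \<le> ennreal (54 * tail \<rho>)"
      using log_mass_mono_tail[OF \<rho>] by (intro ennreal_leI) simp
    finally show "(\<Sum>l<N. ennreal (6 * ((real (l+1))\<^sup>2 * (A_mass \<rho> (2^(l+1) - 1) - A_mass \<rho> (2^l - 1))))) \<le> ennreal (54 * tail \<rho>)" .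
  qed auto
  then have Hint': "(\<integral>\<^sup>+k. H k \<partial>\<sigma>) \<le> ennreal (54 * tail \<rho>)" .
  define Y where "Y k = (\<Sum>n. unit_term (t n) k)" for k
  have Ym: "Y \<in> borel_measurable \<sigma>"
    unfolding Y_def measurable_cong_sets[OF sets_sigma refl] by measurable
  have Yint: "(\<integral>\<^sup>+k. Y k \<partial>\<sigma>) \<le> ennreal (2250 * (1 + normA2) * tail \<rho>)"
  proof -
    have um: "unit_term (t n) \<in> borel_measurable \<sigma>" for n
      unfolding measurable_cong_sets[OF sets_sigma refl] by measurable
    have "(\<integral>\<^sup>+k. Y k \<partial>\<sigma>) = (\<Sum>n. \<integral>\<^sup>+k. unit_term (t n) k \<partial>\<sigma>)"
      unfolding Y_def by (intro nn_integral_suminf um)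
    also have "\<dots> \<le> (\<Sum>n. ennreal (1000 * (1 + normA2) * (A_mass \<rho> (Suc n) - A_mass \<rho> n)))"
    proof (intro suminf_le allI)
      fix n
      show "(\<integral>\<^sup>+k. unit_term (t n) k \<partial>\<sigma>) \<le> ennreal (1000 * (1 + normA2) * (A_mass \<rho> (Suc n) - A_mass \<rho> n))"
        using unit_term_integral[OF t0[of n]] masses_diff(1)[OF \<rho>, of n "Suc n"] by (simp add: t_def algebra_simps)
    qed auto
    also have "\<dots> \<le> ennreal (2250 * (1 + normA2) * tail \<rho>)"
    proof (rule suminf_le_const)
      fix N
      have "(\<Sum>n<N. ennreal (1000 * (1 + normA2) * (A_mass \<rho> (Suc n) - A_mass \<rho> n)))
          = ennreal (\<Sum>n<N. 1000 * (1 + normA2) * (A_mass \<rho> (Suc n) - A_mass \<rho> n))"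
        using mass_increment_nonneg[OF \<rho>] normA2_nonneg by (intro sum_ennreal mult_nonneg_nonneg) auto
      also have "(\<Sum>n<N. 1000 * (1 + normA2) * (A_mass \<rho> (Suc n) - A_mass \<rho> n)) = 1000 * (1 + normA2) * (A_mass \<rho> N - A_mass \<rho> 0)"
        by (simp add: sum_lessThan_telescope flip: sum_distrib_left)
      \<comment> \<open>9/4 is the inverse square of the lower bound 2/3 for the logarithm; hence
        2250.\<close>
      also have "\<dots> \<le> 1000 * (1 + normA2) * (9/4 * tail \<rho>)"
      proof (intro mult_left_mono)
        have "(2/3)\<^sup>2 * (A_mass \<rho> N - A_mass \<rho> 0) \<le> log_mass \<rho> N - log_mass \<rho> 0"
        proof (rule mass_increment_le[OF \<rho>])
          fix x assume "real 0 \<le> x"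
          then have "ln 2 \<le> ln (2 + x)" by (intro ln_mono) auto
          then show "2/3 \<le> ln (2 + x)" using ln2_ge_two_thirds by linarith
        qed auto
        moreover have "log_mass \<rho> 0 \<ge> 0"
          unfolding log_mass_def set_lebesgue_integral_def by (rule Bochner_Integration.integral_nonneg) simp
        ultimately show "A_mass \<rho> N - A_mass \<rho> 0 \<le> 9/4 * tail \<rho>"
          using log_mass_mono_tail[OF \<rho>, of N] by (simp add: power2_eq_square)
      qed (use normA2_nonneg in auto)
      finally show "(\<Sum>n<N. ennreal (1000 * (1 + normA2) * (A_mass \<rho> (Suc n) - A_mass \<rho> n))) \<le> ennreal (2250 * (1 + normA2) * tail \<rho>)"
        by (auto simp: algebra_simps intro!: ennreal_leI)
    qed auto
    finally show ?thesis .
  qed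
  \<comment> \<open>Splitting at each end point and then between the two end points uses the
    inequality (a+b)^2 \<le> 2a^2 + 2b^2 twice, hence the factor 8. The total 8 * 2250 + 8 * 54 =
    18432 is below 20000.\<close>
  define D where "D k = 8 * Y k + 8 * H k" for k
  have Dm: "D \<in> borel_measurable borel"
    using Ym Hm unfolding D_def measurable_cong_sets[OF sets_sigma refl] by measurable
  have "(\<integral>\<^sup>+k. D k \<partial>\<sigma>) = 8 * (\<integral>\<^sup>+k. Y k \<partial>\<sigma>) + 8 * (\<integral>\<^sup>+k. H k \<partial>\<sigma>)"
    unfolding D_def using Ym Hm by (simp add: nn_integral_add nn_integral_cmult)
  also have "\<dots> \<le> 8 * ennreal (2250 * (1 + normA2) * tail \<rho>) + 8 * ennreal (54 * tail \<rho>)"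
    using Yint Hint' by (intro add_mono mult_left_mono) auto
  also have "\<dots> = ennreal (8 * (2250 * (1 + normA2) * tail \<rho>) + 8 * (54 * tail \<rho>))"
    using tail_nonneg[of \<rho>] normA2_nonneg by (subst ennreal_plus) (simp_all add: ennreal_mult)
  also have "\<dots> \<le> ennreal (20000 * (1 + normA2) * tail \<rho>)"
  proof (rule ennreal_leI)
    have "0 \<le> normA2 * tail \<rho>" using tail_nonneg[of \<rho>] normA2_nonneg by simp
    then show "8 * (2250 * (1 + normA2) * tail \<rho>) + 8 * (54 * tail \<rho>) \<le> 20000 * (1 + normA2) * tail \<rho>"
      using tail_nonneg[of \<rho>] by (simp add: algebra_simps)
  qed
  finally have Dint: "(\<integral>\<^sup>+k. D k \<partial>\<sigma>) \<le> ennreal (20000 * (1 + normA2) * tail \<rho>)" .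
  have one: "ennreal ((cmod (Ps r (of_real k) - Z 0 k))\<^sup>2 / (1 + k\<^sup>2)) \<le> 2 * Y k + 2 * H k" if r: "r > \<rho>" for r k
  proof -
    define n where "n = nat \<lfloor>r - \<rho>\<rfloor>"
    have "real n \<le> r - \<rho>" "r - \<rho> \<le> real n + 1" using r by (auto simp: n_def)
    then have rt: "r \<in> {t n..t n + 1}" by (auto simp: t_def)
    \<comment> \<open>The majorant \<open>H\<close> of the grid part is unweighted, so the weight is
      estimated by 1 there; \<open>unit_term\<close> already contains it.\<close>
    have w: "1 / (1 + k\<^sup>2) \<ge> 0" "1 / (1 + k\<^sup>2) \<le> 1" by (auto simp: add_pos_nonneg)
    define a where "a = cmod (Ps r (of_real k) - Z n k)"
    define b where "b = cmod (Z n k - Z 0 k)"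
    have "cmod (Ps r (of_real k) - Z 0 k) \<le> a + b"
      unfolding a_def b_def using norm_triangle_ineq[of "Ps r (of_real k) - Z n k" "Z n k - Z 0 k"] by simp
    then have "(cmod (Ps r (of_real k) - Z 0 k))\<^sup>2 \<le> (a + b)\<^sup>2" by (intro power_mono) auto
    also have "\<dots> \<le> 2 * a\<^sup>2 + 2 * b\<^sup>2" by (rule square_sum_le)
    finally have "(cmod (Ps r (of_real k) - Z 0 k))\<^sup>2 * (1 / (1 + k\<^sup>2)) \<le> (2 * a\<^sup>2 + 2 * b\<^sup>2) * (1 / (1 + k\<^sup>2))"
      using w by (intro mult_right_mono) auto
    also have "\<dots> \<le> 2 * (a\<^sup>2 / (1 + k\<^sup>2)) + 2 * b\<^sup>2"
      using mult_left_mono[OF w(2), of "2 * b\<^sup>2"] by (simp add: distrib_right add_divide_distrib)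
    finally have "(cmod (Ps r (of_real k) - Z 0 k))\<^sup>2 / (1 + k\<^sup>2) \<le> 2 * (a\<^sup>2 / (1 + k\<^sup>2)) + 2 * b\<^sup>2" by simp
    then have "ennreal ((cmod (Ps r (of_real k) - Z 0 k))\<^sup>2 / (1 + k\<^sup>2)) \<le> ennreal (2 * (a\<^sup>2 / (1 + k\<^sup>2)) + 2 * b\<^sup>2)"
      by (rule ennreal_leI)
    also have "\<dots> = 2 * ennreal (a\<^sup>2 / (1 + k\<^sup>2)) + 2 * ennreal (b\<^sup>2)"
      by (rule ennreal_double_sum) auto
    also have "\<dots> \<le> 2 * Y k + 2 * H k"
    proof (intro add_mono mult_left_mono)
      have "ennreal (a\<^sup>2 / (1 + k\<^sup>2)) \<le> unit_term (t n) k"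
        unfolding a_def Z_def by (rule unit_term_bound[OF t0 rt])
      also have "\<dots> = (\<Sum>i\<in>{n}. unit_term (t i) k)" by simp
      also have "\<dots> \<le> Y k" unfolding Y_def by (intro sum_le_suminf) auto
      finally show "ennreal (a\<^sup>2 / (1 + k\<^sup>2)) \<le> Y k" .
      show "ennreal (b\<^sup>2) \<le> H k" unfolding b_def by (rule H)
    qed auto
    finally show ?thesis .
  qed
  have "ennreal ((cmod (Ps r2 (of_real k) - Ps r1 (of_real k)))\<^sup>2 / (1 + k\<^sup>2)) \<le> D k" if r: "\<rho> < r1" "r1 < r2" for k r1 r2
  proof -
    define a where "a = cmod (Ps r2 (of_real k) - Z 0 k)"
    define b where "b = cmod (Ps r1 (of_real k) - Z 0 k)"
    have "cmod (Ps r2 (of_real k) - Ps r1 (of_real k)) \<le> a + b"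
      unfolding a_def b_def using norm_triangle_ineq4[of "Ps r2 (of_real k) - Z 0 k" "Ps r1 (of_real k) - Z 0 k"] by simp
    then have "(cmod (Ps r2 (of_real k) - Ps r1 (of_real k)))\<^sup>2 \<le> (a + b)\<^sup>2" by (intro power_mono) auto
    also have "\<dots> \<le> 2 * a\<^sup>2 + 2 * b\<^sup>2" by (rule square_sum_le)
    finally have "(cmod (Ps r2 (of_real k) - Ps r1 (of_real k)))\<^sup>2 / (1 + k\<^sup>2) \<le> (2 * a\<^sup>2 + 2 * b\<^sup>2) / (1 + k\<^sup>2)"
      by (intro divide_right_mono) auto
    then have "ennreal ((cmod (Ps r2 (of_real k) - Ps r1 (of_real k)))\<^sup>2 / (1 + k\<^sup>2)) \<le> ennreal (2 * (a\<^sup>2 / (1 + k\<^sup>2)) + 2 * (b\<^sup>2 / (1 + k\<^sup>2)))"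
      by (intro ennreal_leI) (simp add: add_divide_distrib)
    also have "\<dots> = 2 * ennreal (a\<^sup>2 / (1 + k\<^sup>2)) + 2 * ennreal (b\<^sup>2 / (1 + k\<^sup>2))"
      by (rule ennreal_double_sum) auto
    also have "\<dots> \<le> 2 * (2 * Y k + 2 * H k) + 2 * (2 * Y k + 2 * H k)"
      unfolding a_def b_def using r by (intro add_mono mult_left_mono one) auto
    also have "\<dots> = D k"
      unfolding D_def by (simp add: distrib_left mult.assoc[symmetric]) (simp add: algebra_simps flip: mult_2)
    finally show ?thesis .
  qed
  then show ?thesis using Dm Dint by (intro bexI[of _ D]) auto
qed

end

section \<open>Exponential integrals as limits of orthogonal expansions\<close>

text \<open>A non-integrable function has Bochner integral 0, so a nonnegative integrable dominating
  function suffices in either case.\<close>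

lemma integral_norm_le:
  fixes f :: "'a \<Rightarrow> 'b::{banach,second_countable_topology}"
  assumes "integrable M g" "\<And>x. x \<in> space M \<Longrightarrow> norm (f x) \<le> g x"
  shows "norm (\<integral>x. f x \<partial>M) \<le> (\<integral>x. g x \<partial>M)"
proof (cases "integrable M f")
  case True
  have "norm (\<integral>x. f x \<partial>M) \<le> (\<integral>x. norm (f x) \<partial>M)" by (rule integral_norm_bound)
  also have "\<dots> \<le> (\<integral>x. g x \<partial>M)" by (rule integral_mono[OF integrable_norm[OF True] assms(1)]) (rule assms(2))
  finally show ?thesis .
next
  case False
  have "0 \<le> (\<integral>x. g x \<partial>M)"
    using assms(2) order_trans[OF norm_ge_zero] by (intro Bochner_Integration.integral_nonneg) blast
  then show ?thesis using False by (simp add: not_integrable_integral_eq)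
qed

text \<open>The double integrand is dominated by B |w| |p|, integrable on the product. This is how
  an integral operator acting on the first variable of a kernel passes under the integral against
  \<open>P\<close>.\<close>

lemma Fubini_bounded_kernel:
  fixes w p :: "real \<Rightarrow> complex" and \<phi> :: "real \<Rightarrow> real \<Rightarrow> complex"
  assumes w: "integrable lborel w" and p: "integrable lborel p"
    and \<phi>: "(\<lambda>z. \<phi> (fst z) (snd z)) \<in> borel_measurable (borel \<Otimes>\<^sub>M borel)"
    and B: "\<And>v x. cmod (\<phi> v x) \<le> B"
  shows "(\<integral>v. w v * (\<integral>x. \<phi> v x * p x \<partial>lborel) \<partial>lborel) = (\<integral>x. (\<integral>v. w v * \<phi> v x \<partial>lborel) * p x \<partial>lborel)"
proof -
  have [measurable]: "w \<in> borel_measurable borel" "p \<in> borel_measurable borel"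
    using borel_measurable_integrable[OF w] borel_measurable_integrable[OF p] by auto
  have \<phi>m: "(\<lambda>t. \<phi> (f t) (g t)) \<in> borel_measurable M"
    if [measurable]: "f \<in> borel_measurable M" "g \<in> borel_measurable M" for f g and M :: "'z measure"
  proof -
    have "(\<lambda>t. (f t, g t)) \<in> M \<rightarrow>\<^sub>M borel \<Otimes>\<^sub>M borel" by measurable
    from measurable_compose[OF this \<phi>] show ?thesis by simp
  qed
  have \<phi>2: "(\<lambda>z. \<phi> (fst z) (snd z)) \<in> borel_measurable (lborel \<Otimes>\<^sub>M lborel)"
    by (rule \<phi>m) measurable
  have \<phi>1: "(\<lambda>x. \<phi> v x) \<in> borel_measurable borel" for v
    by (rule \<phi>m) measurable
  define h where "h v x = w v * \<phi> v x * p x" for v x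
  have hb: "cmod (h v x) \<le> B * cmod (w v) * cmod (p x)" for v x
    unfolding h_def norm_mult using mult_right_mono[OF mult_left_mono[OF B[of v x], of "cmod (w v)"], of "cmod (p x)"]
    by (simp add: mult.commute)
  have B0: "B \<ge> 0" using B[of 0 0] norm_ge_zero order_trans by blast
  have hm: "(\<lambda>z. h (fst z) (snd z)) \<in> borel_measurable (lborel \<Otimes>\<^sub>M lborel)"
    unfolding h_def using \<phi>2 by measurable
  have int: "integrable (lborel \<Otimes>\<^sub>M lborel) (\<lambda>z. h (fst z) (snd z))"
  proof (rule lborel_pair.Fubini_integrable[OF hm])
    have hi: "integrable lborel (\<lambda>x. h v x)" for v
    proof (rule Bochner_Integration.integrable_bound)
      show "integrable lborel (\<lambda>x. B * cmod (w v) * cmod (p x))" using p by (intro integrable_mult_right integrable_norm)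
      show "h v \<in> borel_measurable lborel" unfolding h_def[abs_def] using \<phi>1[of v] by simp
      show "AE x in lborel. cmod (h v x) \<le> norm (B * cmod (w v) * cmod (p x))"
        using hb B0 by (auto simp: abs_mult)
    qed
    then show "AE v in lborel. integrable lborel (\<lambda>x. h (fst (v, x)) (snd (v, x)))" by simp
    show "integrable lborel (\<lambda>v. \<integral>x. norm (h (fst (v, x)) (snd (v, x))) \<partial>lborel)"
    proof (rule Bochner_Integration.integrable_bound)
      show "integrable lborel (\<lambda>v. cmod (w v) * (B * (\<integral>x. cmod (p x) \<partial>lborel)))"
        using w by (intro integrable_mult_left integrable_norm)
      show "(\<lambda>v. \<integral>x. norm (h (fst (v, x)) (snd (v, x))) \<partial>lborel) \<in> borel_measurable lborel"
        using hm by (intro lborel.borel_measurable_lebesgue_integral) (simp add: case_prod_unfold)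
      show "AE v in lborel. norm (\<integral>x. norm (h (fst (v, x)) (snd (v, x))) \<partial>lborel) \<le> norm (cmod (w v) * (B * (\<integral>x. cmod (p x) \<partial>lborel)))"
      proof (intro AE_I2)
        fix v
        have "(\<integral>x. norm (h v x) \<partial>lborel) \<le> (\<integral>x. B * cmod (w v) * cmod (p x) \<partial>lborel)"
          using hb hi p by (intro integral_mono) auto
        then show "norm (\<integral>x. norm (h (fst (v, x)) (snd (v, x))) \<partial>lborel) \<le> norm (cmod (w v) * (B * (\<integral>x. cmod (p x) \<partial>lborel)))"
          using B0 by (simp add: abs_mult mult_ac)
      qed
    qed
  qed
  have "(\<integral>v. w v * (\<integral>x. \<phi> v x * p x \<partial>lborel) \<partial>lborel) = (\<integral>v. (\<integral>x. h v x \<partial>lborel) \<partial>lborel)"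
    by (simp add: h_def mult.assoc)
  also have "\<dots> = (\<integral>x. (\<integral>v. h v x \<partial>lborel) \<partial>lborel)"
    by (rule lborel_pair.Fubini_integral[symmetric]) (use int in \<open>simp add: case_prod_unfold\<close>)
  also have "\<dots> = (\<integral>x. (\<integral>v. w v * \<phi> v x \<partial>lborel) * p x \<partial>lborel)"
    by (simp add: h_def)
  finally show ?thesis .
qed

text \<open>The integral of exp(\<i> k x) over [0, T], with the removable singularity at k = 0
  filled in.\<close>

definition exp_int :: "real \<Rightarrow> complex \<Rightarrow> complex" where
  "exp_int T k = (if k = 0 then of_real T else (exp (\<i> * k * of_real T) - 1) / (\<i> * k))"

lemma exp_int_mult: "\<i> * k * exp_int T k = exp (\<i> * k * of_real T) - 1"
  by (simp add: exp_int_def)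

lemma exp_int_0 [simp]: "exp_int 0 k = 0"
  by (simp add: exp_int_def)

lemma exp_int_deriv: "((\<lambda>T. exp_int T k) has_vector_derivative exp (\<i> * k * of_real T)) (at T within S)"
proof (cases "k = 0")
  case True
  have "((\<lambda>T. of_real T :: complex) has_vector_derivative 1) (at T within S)"
    by (rule has_vector_derivative_eq_rhs[OF has_vector_derivative_of_real[OF DERIV_ident]]) simp
  then show ?thesis using True by (simp add: exp_int_def)
next
  case False
  have "((\<lambda>z. (exp (\<i> * k * z) - 1) / (\<i> * k)) has_field_derivative exp (\<i> * k * of_real T)) (at (of_real T))"
    using False by (auto intro!: derivative_eq_intros)
  then show ?thesis
    using False by (auto simp: exp_int_def intro!: has_vector_derivative_real_field)
qed

lemma norm_exp_le: "norm (exp (\<i> * k * of_real t)) \<le> exp (cmod k * \<bar>t\<bar>)"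
proof -
  have "norm (exp (\<i> * k * of_real t)) \<le> exp (norm (\<i> * k * of_real t))" by (rule norm_exp)
  then show ?thesis by (simp add: norm_mult)
qed

lemma exp_int_increment_le:
  assumes "s \<le> t" "\<And>x. x \<in> {s..t} \<Longrightarrow> norm (exp (\<i> * k * of_real x)) \<le> B" "B \<ge> 0"
  shows "cmod (exp_int t k - exp_int s k) \<le> B * (t - s)"
proof -
  have "((\<lambda>x. exp (\<i> * k * of_real x)) has_integral (exp_int t k - exp_int s k)) {s..t}"
    by (rule fundamental_theorem_of_calculus[OF assms(1)]) (rule exp_int_deriv)
  from has_integral_bound_real[OF assms(3) finite.emptyI this] show ?thesis
    using assms by simp
qed

text \<open>The modulus is at most T, and at most 2/|k|; the squares of the two bounds are
  added.\<close>

lemma exp_int_real_bound: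
  assumes "T \<ge> 0"
  shows "(cmod (exp_int T (of_real k)))\<^sup>2 \<le> (T\<^sup>2 + 4) / (1 + k\<^sup>2)"
proof -
  define e where "e = cmod (exp_int T (of_real k))"
  have 1: "cmod (exp (\<i> * of_real k * of_real x)) = 1" for x
    by (metis mult.assoc norm_exp_i_times of_real_mult)
  have "e \<le> T" using exp_int_increment_le[of 0 T "of_real k" 1] assms 1 by (simp add: e_def)
  then have e1: "e\<^sup>2 \<le> T\<^sup>2" by (intro power_mono) (auto simp: e_def)
  have "\<bar>k\<bar> * e = cmod (exp (\<i> * of_real k * of_real T) - 1)"
    unfolding exp_int_mult[symmetric] by (simp add: norm_mult e_def)
  also have "\<dots> \<le> 2" using norm_triangle_ineq4[of "exp (\<i> * of_real k * of_real T)" 1] 1[of T] by simp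
  finally have "(\<bar>k\<bar> * e)\<^sup>2 \<le> 2\<^sup>2" by (intro power_mono) (auto simp: e_def)
  then have "k\<^sup>2 * e\<^sup>2 \<le> 4" by (simp add: power_mult_distrib)
  then have "e\<^sup>2 * (1 + k\<^sup>2) \<le> T\<^sup>2 + 4" using e1 by (simp add: algebra_simps)
  moreover have "1 + k\<^sup>2 > 0" by (simp add: add_pos_nonneg)
  ultimately show ?thesis by (simp add: pos_le_divide_eq e_def)
qed

lemma exp_int_continuous: "continuous_on S (\<lambda>T. exp_int T k)"
  by (rule continuous_on_vector_derivative) (rule exp_int_deriv)

section \<open>Boundedness of the energy, and an integral equation for
  \<open>exp_int T k * P s k\<close>\<close>

context krein
begin

lemma A_tail_small:
  assumes "\<epsilon> > 0"
  shows "\<exists>r\<ge>0. \<forall>b\<ge>r. (LINT x:{r..b}|lborel. (cmod (A x))\<^sup>2) \<le> \<epsilon>"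
proof -
  have U: "(\<Union>n. {0..real n}) = {0..}" by (auto simp: real_arch_simple)
  have "(\<lambda>n. LINT x:{0..real n}|lborel. (cmod (A x))\<^sup>2) \<longlonglongrightarrow> (LINT x:(\<Union>n. {0..real n})|lborel. (cmod (A x))\<^sup>2)"
    by (rule set_integral_cont_up) (auto simp: U A_L2 incseq_def)
  then have "(\<lambda>n. LINT x:{0..real n}|lborel. (cmod (A x))\<^sup>2) \<longlonglongrightarrow> normA2"
    by (simp add: U normA2_def)
  from order_tendstoD(1)[OF this, of "normA2 - \<epsilon>"] assms
  obtain n where n: "(LINT x:{0..real n}|lborel. (cmod (A x))\<^sup>2) > normA2 - \<epsilon>"
    by (auto simp: eventually_sequentially)
  have "(LINT x:{real n..b}|lborel. (cmod (A x))\<^sup>2) \<le> \<epsilon>" if "b \<ge> real n" for b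
    using set_integral_Icc_diff[of 0 "real n" b "\<lambda>x. (cmod (A x))\<^sup>2"] A_sq_le[of 0 b] n that A_square_integrable[of 0 b]
    by simp
  then show ?thesis by (intro exI[of _ "real n"]) auto
qed

text \<open>Beyond some r0 the L^2 norm of \<open>A\<close> is at most 1/2. With s the root of the
  energy and c = |Ps(r0, \<i>)|, Cauchy-Schwarz gives |Ps(r, \<i>)| \<le> c + s/2, while
  \<open>energy_identity\<close> gives s \<le> |Ps(r, \<i>)|. Hence s \<le> 2c.\<close>

lemma energy_bounded: "\<exists>K. \<forall>r. energy r \<le> K"
proof -
  obtain r0 where r0: "r0 \<ge> 0" "\<And>b. b \<ge> r0 \<Longrightarrow> (LINT x:{r0..b}|lborel. (cmod (A x))\<^sup>2) \<le> 1/4"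
    using A_tail_small[of "1/4"] by auto
  define c where "c = cmod (Ps r0 \<i>)"
  have main: "energy r \<le> (2 * c)\<^sup>2" if r: "r \<ge> r0" for r
  proof -
    define s where "s = sqrt (energy r)"
    have s: "s \<ge> 0" "s\<^sup>2 = energy r" using energy_nonneg by (auto simp: s_def)
    define I where "I = (LINT y:{r0..r}|lborel. cmod (A y) * cmod (P y \<i>))"
    have I0: "I \<ge> 0"
      unfolding I_def set_lebesgue_integral_def by (rule Bochner_Integration.integral_nonneg) simp
    have "I\<^sup>2 \<le> (LINT y:{r0..r}|lborel. (cmod (A y))\<^sup>2) * (LINT y:{r0..r}|lborel. (cmod (P y \<i>))\<^sup>2)"
      unfolding I_def
      by (rule Cauchy_Schwarz_set_integral(2))
        (simp_all add: r0 A_square_integrable energy_integrable set_borel_measurable_Icc continuous_on_norm P_continuous' set_borel_measurable_def[where f = "\<lambda>x. cmod (A x)"])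
    also have "\<dots> \<le> 1/4 * energy r"
    proof (rule mult_mono)
      show "(LINT y:{r0..r}|lborel. (cmod (P y \<i>))\<^sup>2) \<le> energy r"
        unfolding energy_def by (rule set_integral_mono_subset[OF energy_integrable]) (use r0 in auto)
      show "0 \<le> (LINT y:{r0..r}|lborel. (cmod (P y \<i>))\<^sup>2)"
        unfolding set_lebesgue_integral_def by (rule Bochner_Integration.integral_nonneg) simp
    qed (use r0 r in auto)
    also have "\<dots> = (s/2)\<^sup>2" by (simp add: s power_divide)
    finally have I: "I \<le> s/2" by (rule power2_le_imp_le) (use s in simp)
    have "Ps r \<i> = Ps r0 \<i> - (LINT y:{r0..r}|lborel. A y * P y \<i>)"
      using Ps_increment[of r0 r \<i>] r0 r by (simp add: algebra_simps)
    then have "cmod (Ps r \<i>) \<le> c + cmod (LINT y:{r0..r}|lborel. A y * P y \<i>)"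
      unfolding c_def by (metis norm_triangle_ineq4)
    also have "cmod (LINT y:{r0..r}|lborel. A y * P y \<i>) \<le> I"
      unfolding I_def by (rule set_integral_norm_mono) (simp_all add: r0 A_integrable_variants P_continuous' continuous_on_norm norm_mult)
    finally have 1: "cmod (Ps r \<i>) \<le> c + s/2" using I by simp
    have "s\<^sup>2 \<le> (cmod (Ps r \<i>))\<^sup>2" using energy_identity[of r] r r0 s energy_nonneg[of r]
      by (smt (verit) zero_le_power2)
    then have "s \<le> cmod (Ps r \<i>)" by (rule power2_le_imp_le) simp
    then have "s \<le> 2 * c" using 1 by simp
    then show ?thesis using s by (metis power_mono)
  qed
  have "energy r \<le> (2 * c)\<^sup>2" for r
    using main[of "max r r0"] energy_mono[of r "max r r0"] by simp
  then show ?thesis by blast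
qed

text \<open>Integrates the derivative of \<open>exp_int (s + T - u) k * P u k\<close> over [s, s+T];
  the product vanishes at the upper end. The exponentials cancel by \<open>exp_int_mult\<close>, and
  \<open>Ps\<close> is written as 1 minus the integral of \<open>A * P\<close>. Since 1 = P(0, k),
  all unknowns are again products of the same shape, and k occurs explicitly neither in the
  coefficients nor in the free term.\<close>

lemma exp_int_recursion:
  assumes "s \<ge> 0" "T \<ge> 0"
  shows "exp_int T k * P s k = (LINT x:{s..s+T}|lborel. P x k) +
    (LINT u:{s..s+T}|lborel. cnj (A u) * (exp_int (s + T - u) k - (LINT v:{0..u}|lborel. A v * (exp_int (s + T - u) k * P v k))))"
proof -
  define c where "c = s + T"
  define F where "F u = exp_int (c - u) k * P u k" for u
  have Ps: "Ps u k = 1 - (LINT v:{0..u}|lborel. A v * P v k)" if "u \<ge> 0" for u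
    using Ps_increment[of 0 u k] that by (simp add: initial_values algebra_simps)
  have acE: "abs_continuous_on {s..c} (\<lambda>u. exp_int (c - u) k)"
  proof (rule abs_continuous_on_lipschitz)
    fix u v assume uv: "u \<in> {s..c}" "v \<in> {s..c}" "u \<le> v"
    have "norm (exp (\<i> * k * of_real x)) \<le> exp (cmod k * c)" if "x \<in> {c - v..c - u}" for x
      using that uv assms by (intro order_trans[OF norm_exp_le]) (auto intro!: mult_left_mono)
    then have "cmod (exp_int (c - u) k - exp_int (c - v) k) \<le> exp (cmod k * c) * ((c - u) - (c - v))"
      using uv by (intro exp_int_increment_le) auto
    then show "cmod (exp_int (c - v) k - exp_int (c - u) k) \<le> exp (cmod k * c) * (v - u)" by (simp add: norm_minus_commute)
  qed
  have i1: "set_integrable lborel {s..c} (\<lambda>x. P x k)"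
    using assms by (intro set_integrable_continuous_on P_continuous')
  have i2: "set_integrable lborel {s..c} (\<lambda>u. cnj (A u) * (exp_int (c - u) k * Ps u k))"
    using assms by (intro A_integrable_variants continuous_intros P_continuous' continuous_on_compose2[OF exp_int_continuous[of UNIV]]) auto
  have i3: "set_integrable lborel {s..c} (\<lambda>u. - P u k - cnj (A u) * (exp_int (c - u) k * Ps u k))"
    using set_integral_diff(1)[OF set_integrable_mult_right[of "-1", OF i1] i2] by simp
  have "AE u in lebesgue. u \<in> {s..c} \<longrightarrow> (F has_vector_derivative - P u k - cnj (A u) * (exp_int (c - u) k * Ps u k)) (at u within {s..c})"
    using krein_derivatives(1)[OF assms(1), of c k]
  proof eventually_elim
    case (elim u)
    show ?case
    proof
      assume u: "u \<in> {s..c}"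
      have "((\<lambda>u. c - u) has_vector_derivative - 1) (at u within {s..c})"
        by (auto intro!: derivative_eq_intros)
      from vector_diff_chain_within[OF this exp_int_deriv[of k "c - u"]]
      have 1: "((\<lambda>u. exp_int (c - u) k) has_vector_derivative - exp (\<i> * k * of_real (c - u))) (at u within {s..c})"
        by (simp add: o_def)
      have 2: "((\<lambda>u. P u k) has_vector_derivative \<i> * k * P u k - cnj (A u) * Ps u k) (at u within {s..c})"
        using elim u by simp
      have "exp_int (c - u) k * (\<i> * k * P u k - cnj (A u) * Ps u k) + - exp (\<i> * k * of_real (c - u)) * P u k
        = (\<i> * k * exp_int (c - u) k) * P u k - exp (\<i> * k * of_real (c - u)) * P u k - cnj (A u) * (exp_int (c - u) k * Ps u k)"
        by (simp add: algebra_simps)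
      also have "\<dots> = - P u k - cnj (A u) * (exp_int (c - u) k * Ps u k)"
        unfolding exp_int_mult by (simp add: algebra_simps)
      finally show "(F has_vector_derivative - P u k - cnj (A u) * (exp_int (c - u) k * Ps u k)) (at u within {s..c})"
        unfolding F_def by (rule has_vector_derivative_eq_rhs[OF has_vector_derivative_mult[OF 1 2]])
    qed
  qed
  then have "(LINT u:{s..c}|lborel. - P u k - cnj (A u) * (exp_int (c - u) k * Ps u k)) = F c - F s"
    using assms unfolding F_def
    by (intro set_integral_abs_continuous_derivative abs_continuous_on_mult acE P_abs_continuous' i3) (auto simp: c_def)
  moreover have "(LINT u:{s..c}|lborel. - P u k - cnj (A u) * (exp_int (c - u) k * Ps u k))
      = - (LINT u:{s..c}|lborel. P u k) - (LINT u:{s..c}|lborel. cnj (A u) * (exp_int (c - u) k * Ps u k))"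
    using set_integral_diff(2)[OF set_integrable_mult_right[of "-1", OF i1] i2] set_integral_uminus[OF i1] by simp
  ultimately have "exp_int T k * P s k = (LINT x:{s..c}|lborel. P x k) + (LINT u:{s..c}|lborel. cnj (A u) * (exp_int (c - u) k * Ps u k))"
    by (simp add: F_def c_def algebra_simps)
  also have "(LINT u:{s..c}|lborel. cnj (A u) * (exp_int (c - u) k * Ps u k))
     = (LINT u:{s..c}|lborel. cnj (A u) * (exp_int (c - u) k - (LINT v:{0..u}|lborel. A v * (exp_int (c - u) k * P v k))))"
  proof (rule set_lebesgue_integral_cong)
    show "\<forall>u. u \<in> {s..c} \<longrightarrow> cnj (A u) * (exp_int (c - u) k * Ps u k)
        = cnj (A u) * (exp_int (c - u) k - (LINT v:{0..u}|lborel. A v * (exp_int (c - u) k * P v k)))"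
    proof (intro allI impI)
      fix u assume u: "u \<in> {s..c}"
      have "(LINT v:{0..u}|lborel. A v * (exp_int (c - u) k * P v k)) = exp_int (c - u) k * (LINT v:{0..u}|lborel. A v * P v k)"
        by (simp flip: set_integral_mult_right add: mult.left_commute)
      then show "cnj (A u) * (exp_int (c - u) k * Ps u k) = cnj (A u) * (exp_int (c - u) k - (LINT v:{0..u}|lborel. A v * (exp_int (c - u) k * P v k)))"
        using u assms by (simp add: Ps algebra_simps)
    qed
  qed auto
  finally show ?thesis by (simp add: c_def)
qed

end

text \<open>Kernels in (T, s, x), where x is the variable later integrated against \<open>P\<close>.
  Global boundedness and joint measurability make every application of Fubini's theorem
  unconditional; functions of (T, s) alone are treated as constant in x.\<close>

definition bounded_measurable3 :: "(real \<Rightarrow> real \<Rightarrow> real \<Rightarrow> complex) \<Rightarrow> bool" where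
  "bounded_measurable3 \<phi> \<longleftrightarrow>
     (\<lambda>z. \<phi> (fst z) (fst (snd z)) (snd (snd z))) \<in> borel_measurable (borel \<Otimes>\<^sub>M borel \<Otimes>\<^sub>M borel) \<and>
     (\<exists>B. \<forall>T s x. cmod (\<phi> T s x) \<le> B)"

lemma bounded_measurable3D:
  assumes "bounded_measurable3 \<phi>" "f \<in> borel_measurable M" "g \<in> borel_measurable M" "h \<in> borel_measurable M"
  shows "(\<lambda>w. \<phi> (f w) (g w) (h w)) \<in> borel_measurable M"
proof -
  have pair: "(\<lambda>w. (f w, g w, h w)) \<in> M \<rightarrow>\<^sub>M borel \<Otimes>\<^sub>M borel \<Otimes>\<^sub>M borel" using assms(2-4) by measurable
  have "(\<lambda>z. \<phi> (fst z) (fst (snd z)) (snd (snd z))) \<in> borel_measurable (borel \<Otimes>\<^sub>M borel \<Otimes>\<^sub>M borel)"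
    using assms(1) by (simp add: bounded_measurable3_def)
  from measurable_compose[OF pair this] show ?thesis by simp
qed

lemma bounded_measurable3_bound:
  assumes "bounded_measurable3 \<phi>"
  obtains B where "B \<ge> 0" "\<And>T s x. cmod (\<phi> T s x) \<le> B"
proof -
  obtain B where B: "\<And>T s x. cmod (\<phi> T s x) \<le> B" using assms by (auto simp: bounded_measurable3_def)
  moreover have "B \<ge> 0" using B[of 0 0 0] norm_ge_zero order_trans by blast
  ultimately show ?thesis using that by blast
qed

lemma integrable_weight_mult:
  fixes w f :: "real \<Rightarrow> complex"
  assumes "integrable lborel w" "f \<in> borel_measurable borel" "\<And>x. cmod (f x) \<le> B"
  shows "integrable lborel (\<lambda>x. w x * f x)"
proof (rule Bochner_Integration.integrable_bound)
  have B0: "B \<ge> 0" using assms(3)[of 0] norm_ge_zero order_trans by blast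
  show "integrable lborel (\<lambda>x. cmod (w x) * B)" using assms(1) by (intro integrable_mult_left integrable_norm)
  show "(\<lambda>x. w x * f x) \<in> borel_measurable lborel"
    using borel_measurable_integrable[OF assms(1)] assms(2) by simp
  show "AE x in lborel. cmod (w x * f x) \<le> norm (cmod (w x) * B)"
    using assms(3) B0 by (auto simp: norm_mult abs_mult intro!: mult_left_mono)
qed

lemma bounded_measurable3_add:
  assumes "bounded_measurable3 \<phi>" "bounded_measurable3 \<psi>"
  shows "bounded_measurable3 (\<lambda>T s x. \<phi> T s x + \<psi> T s x)"
proof -
  obtain B B' where "\<And>T s x. cmod (\<phi> T s x) \<le> B" "\<And>T s x. cmod (\<psi> T s x) \<le> B'"
    using assms by (auto simp: bounded_measurable3_def)
  then have "cmod (\<phi> T s x + \<psi> T s x) \<le> B + B'" for T s x by (intro order_trans[OF norm_triangle_ineq] add_mono)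
  then show ?thesis
    using assms unfolding bounded_measurable3_def by (auto intro!: borel_measurable_add exI)
qed

lemma bounded_measurable3_interval: "bounded_measurable3 (\<lambda>T s x. if s \<le> x \<and> x \<le> s + T then 1 else 0)"
  unfolding bounded_measurable3_def
proof (intro conjI exI[of _ 1] allI)
  show "(\<lambda>z. if fst (snd z) \<le> snd (snd z) \<and> snd (snd z) \<le> fst (snd z) + fst z then 1 else 0 :: complex)
      \<in> borel_measurable (borel \<Otimes>\<^sub>M borel \<Otimes>\<^sub>M borel :: (real \<times> real \<times> real) measure)" by measurable
qed auto

section \<open>The operator of the integral equation and its Picard iterates\<close>

context krein
begin

definition "cutA a u = indicat_real {0..a} u *\<^sub>R A u"

lemma cutA_measurable [measurable]: "cutA a \<in> borel_measurable borel"
  unfolding cutA_def[abs_def] by measurable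

lemma cutA_integrable: "integrable lborel (cutA a)"
  using A_integrable[of 0 a] by (simp add: set_integrable_def cutA_def[abs_def])

definition "cutnorm a = (\<integral>u. cmod (cutA a u) \<partial>lborel)"

lemma cutnorm_nonneg: "cutnorm a \<ge> 0"
  unfolding cutnorm_def by (rule Bochner_Integration.integral_nonneg) simp

text \<open>The two halves of the integral operator in \<open>exp_int_recursion\<close>; cutting \<open>A\<close> off at \<open>a\<close> makes them
  act on bounded measurable families without any restriction on the arguments.\<close>

definition Qop :: "real \<Rightarrow> (real \<Rightarrow> real \<Rightarrow> complex) \<Rightarrow> real \<Rightarrow> real \<Rightarrow> complex" where
  "Qop a \<phi> T u = \<phi> T 0 - (\<integral>v. (if 0 \<le> v \<and> v \<le> u then cutA a v else 0) * \<phi> T v \<partial>lborel)"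

definition Kop :: "real \<Rightarrow> (real \<Rightarrow> real \<Rightarrow> complex) \<Rightarrow> real \<Rightarrow> real \<Rightarrow> complex" where
  "Kop a \<phi> T s = (\<integral>u. (if s \<le> u \<and> u \<le> s + T then cnj (cutA a u) else 0) * Qop a \<phi> (s + T - u) u \<partial>lborel)"

lemma weights_integrable:
  "integrable lborel (\<lambda>v. if 0 \<le> v \<and> v \<le> u then cutA a v else 0)"
  "integrable lborel (\<lambda>v. if s \<le> v \<and> v \<le> t then cnj (cutA a v) else 0)"
  by (rule Bochner_Integration.integrable_bound[OF cutA_integrable[of a]]; auto)+

lemma integral_weight_bound:
  fixes w f :: "real \<Rightarrow> complex"
  assumes "integrable lborel w" "\<And>x. w x \<noteq> 0 \<Longrightarrow> cmod (f x) \<le> B"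
    and "\<And>x. cmod (w x) \<le> cmod (cutA a x)" "B \<ge> 0"
  shows "cmod (\<integral>x. w x * f x \<partial>lborel) \<le> cutnorm a * B"
proof -
  have "cmod (\<integral>x. w x * f x \<partial>lborel) \<le> (\<integral>x. cmod (cutA a x) * B \<partial>lborel)"
  proof (rule integral_norm_le)
    show "integrable lborel (\<lambda>x. cmod (cutA a x) * B)" using cutA_integrable by (intro integrable_mult_left integrable_norm)
    show "cmod (w x * f x) \<le> cmod (cutA a x) * B" for x
      using assms(2)[of x] assms(3)[of x] \<open>B \<ge> 0\<close> by (cases "w x = 0") (auto simp: norm_mult intro!: mult_mono)
  qed
  then show ?thesis by (simp add: cutnorm_def)
qed

lemma bounded_measurable3_Qop:
  assumes "bounded_measurable3 \<phi>"
  shows "bounded_measurable3 (\<lambda>T u x. Qop a (\<lambda>T s. \<phi> T s x) T u)"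
proof -
  obtain B where B: "B \<ge> 0" "\<And>T s x. cmod (\<phi> T s x) \<le> B" using bounded_measurable3_bound[OF assms] by metis
  have "cmod (Qop a (\<lambda>T s. \<phi> T s x) T u) \<le> B + cutnorm a * B" for T u x
  proof -
    have "cmod (\<integral>v. (if 0 \<le> v \<and> v \<le> u then cutA a v else 0) * \<phi> T v x \<partial>lborel) \<le> cutnorm a * B"
      using B by (intro integral_weight_bound weights_integrable) auto
    then show ?thesis unfolding Qop_def by (intro order_trans[OF norm_triangle_ineq4] add_mono B)
  qed
  moreover have "(\<lambda>z. Qop a (\<lambda>T s. \<phi> T s (snd (snd z))) (fst z) (fst (snd z))) \<in> borel_measurable (borel \<Otimes>\<^sub>M borel \<Otimes>\<^sub>M borel)"
  proof -
    have 1: "(\<lambda>z. \<phi> (fst z) 0 (snd (snd z))) \<in> borel_measurable (borel \<Otimes>\<^sub>M borel \<Otimes>\<^sub>M borel)"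
      by (rule bounded_measurable3D[OF assms]) measurable
    have 2: "(\<lambda>w. \<phi> (fst (fst w)) (snd w) (snd (snd (fst w)))) \<in> borel_measurable ((borel \<Otimes>\<^sub>M borel \<Otimes>\<^sub>M borel) \<Otimes>\<^sub>M lborel)"
      by (rule bounded_measurable3D[OF assms]) measurable
    have "(\<lambda>z. \<integral>v. (if 0 \<le> v \<and> v \<le> fst (snd z) then cutA a v else 0) * \<phi> (fst z) v (snd (snd z)) \<partial>lborel) \<in> borel_measurable (borel \<Otimes>\<^sub>M borel \<Otimes>\<^sub>M borel)"
      by (rule lborel.borel_measurable_lebesgue_integral) (unfold case_prod_unfold, use 2 in measurable)
    with 1 show ?thesis unfolding Qop_def by (rule borel_measurable_diff)
  qed
  ultimately show ?thesis unfolding bounded_measurable3_def by blast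
qed

lemma bounded_measurable3_Kop:
  assumes "bounded_measurable3 \<phi>"
  shows "bounded_measurable3 (\<lambda>T s x. Kop a (\<lambda>T s. \<phi> T s x) T s)"
proof -
  define \<psi> where "\<psi> T u x = Qop a (\<lambda>T s. \<phi> T s x) T u" for T u x
  have \<psi>: "bounded_measurable3 \<psi>" unfolding \<psi>_def by (rule bounded_measurable3_Qop[OF assms])
  obtain B where B: "B \<ge> 0" "\<And>T s x. cmod (\<psi> T s x) \<le> B" using bounded_measurable3_bound[OF \<psi>] by metis
  have "cmod (Kop a (\<lambda>T s. \<phi> T s x) T s) \<le> cutnorm a * B" for T s x
    unfolding Kop_def \<psi>_def[symmetric] using B by (intro integral_weight_bound weights_integrable) auto
  moreover have "(\<lambda>z. Kop a (\<lambda>T s. \<phi> T s (snd (snd z))) (fst z) (fst (snd z))) \<in> borel_measurable (borel \<Otimes>\<^sub>M borel \<Otimes>\<^sub>M borel)"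
  proof -
    have 2: "(\<lambda>w. \<psi> (fst (snd (fst w)) + fst (fst w) - snd w) (snd w) (snd (snd (fst w)))) \<in> borel_measurable ((borel \<Otimes>\<^sub>M borel \<Otimes>\<^sub>M borel) \<Otimes>\<^sub>M lborel)"
      by (rule bounded_measurable3D[OF \<psi>]) measurable
    show ?thesis unfolding Kop_def \<psi>_def[symmetric]
      by (rule lborel.borel_measurable_lebesgue_integral) (unfold case_prod_unfold, use 2 in measurable)
  qed
  ultimately show ?thesis unfolding bounded_measurable3_def by blast
qed

lemma Qop_integral:
  assumes \<phi>: "bounded_measurable3 \<phi>" and p: "integrable lborel p"
  shows "Qop a (\<lambda>T s. \<integral>x. \<phi> T s x * p x \<partial>lborel) T u = (\<integral>x. Qop a (\<lambda>T s. \<phi> T s x) T u * p x \<partial>lborel)"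
proof -
  obtain B where B: "B \<ge> 0" "\<And>T s x. cmod (\<phi> T s x) \<le> B" using bounded_measurable3_bound[OF \<phi>] by metis
  define w where "w v = (if 0 \<le> v \<and> v \<le> u then cutA a v else 0)" for v
  have w: "integrable lborel w" unfolding w_def by (rule weights_integrable)
  have m1: "(\<lambda>z. \<phi> T (fst z) (snd z)) \<in> borel_measurable (borel \<Otimes>\<^sub>M borel)"
    by (rule bounded_measurable3D[OF \<phi>]) measurable
  have m2: "(\<lambda>x. \<phi> T 0 x) \<in> borel_measurable borel"
    by (rule bounded_measurable3D[OF \<phi>]) measurable
  have F: "(\<integral>v. w v * (\<integral>x. \<phi> T v x * p x \<partial>lborel) \<partial>lborel) = (\<integral>x. (\<integral>v. w v * \<phi> T v x \<partial>lborel) * p x \<partial>lborel)"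
    by (rule Fubini_bounded_kernel[OF w p m1 B(2)])
  have i1: "integrable lborel (\<lambda>x. \<phi> T 0 x * p x)"
    using integrable_weight_mult[OF p m2 B(2)] by (simp add: mult.commute)
  have m3: "(\<lambda>x. \<integral>v. w v * \<phi> T v x \<partial>lborel) \<in> borel_measurable borel"
  proof (rule lborel.borel_measurable_lebesgue_integral)
    have [measurable]: "w \<in> borel_measurable borel" using borel_measurable_integrable[OF w] by simp
    have [measurable]: "(\<lambda>z. \<phi> T (snd z) (fst z)) \<in> borel_measurable (borel \<Otimes>\<^sub>M lborel)"
      by (rule bounded_measurable3D[OF \<phi>]) measurable
    show "(\<lambda>(x, v). w v * \<phi> T v x) \<in> borel_measurable (borel \<Otimes>\<^sub>M lborel)"
      unfolding case_prod_unfold by measurable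
  qed
  have "integrable lborel (\<lambda>x. p x * (\<integral>v. w v * \<phi> T v x \<partial>lborel))"
    by (rule integrable_weight_mult[OF p m3, of "cutnorm a * B"], rule integral_weight_bound[OF w]) (use B in \<open>auto simp: w_def\<close>)
  then have i2: "integrable lborel (\<lambda>x. (\<integral>v. w v * \<phi> T v x \<partial>lborel) * p x)" by (simp add: mult.commute)
  have "Qop a (\<lambda>T s. \<integral>x. \<phi> T s x * p x \<partial>lborel) T u = (\<integral>x. \<phi> T 0 x * p x \<partial>lborel) - (\<integral>x. (\<integral>v. w v * \<phi> T v x \<partial>lborel) * p x \<partial>lborel)"
    unfolding Qop_def w_def[symmetric] F ..
  also have "\<dots> = (\<integral>x. \<phi> T 0 x * p x - (\<integral>v. w v * \<phi> T v x \<partial>lborel) * p x \<partial>lborel)"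
    by (rule Bochner_Integration.integral_diff[OF i1 i2, symmetric])
  finally show ?thesis by (simp add: Qop_def w_def left_diff_distrib)
qed

text \<open>The operator commutes with integration against p, so an iterate given by a kernel is
  mapped to one given by the image of that kernel.\<close>

lemma Kop_integral:
  assumes \<phi>: "bounded_measurable3 \<phi>" and p: "integrable lborel p"
  shows "Kop a (\<lambda>T s. \<integral>x. \<phi> T s x * p x \<partial>lborel) T s = (\<integral>x. Kop a (\<lambda>T s. \<phi> T s x) T s * p x \<partial>lborel)"
proof -
  define \<psi> where "\<psi> T u x = Qop a (\<lambda>T s. \<phi> T s x) T u" for T u x
  have \<psi>: "bounded_measurable3 \<psi>" unfolding \<psi>_def by (rule bounded_measurable3_Qop[OF \<phi>])
  obtain B where B: "B \<ge> 0" "\<And>T s x. cmod (\<psi> T s x) \<le> B" using bounded_measurable3_bound[OF \<psi>] by metis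
  have m: "(\<lambda>z. \<psi> (s + T - fst z) (fst z) (snd z)) \<in> borel_measurable (borel \<Otimes>\<^sub>M borel)"
    by (rule bounded_measurable3D[OF \<psi>]) measurable
  show ?thesis
    unfolding Kop_def Qop_integral[OF \<phi> p] \<psi>_def[symmetric]
    by (rule Fubini_bounded_kernel[OF weights_integrable(2) p m B(2)])
qed

lemma Kop_diff:
  assumes \<phi>: "bounded_measurable3 (\<lambda>T s x. \<phi> T s)" and \<psi>: "bounded_measurable3 (\<lambda>T s x. \<psi> T s)"
  shows "Kop a (\<lambda>T s. \<phi> T s - \<psi> T s) T s = Kop a \<phi> T s - Kop a \<psi> T s"
proof -
  have Q: "Qop a (\<lambda>T s. \<phi> T s - \<psi> T s) T u = Qop a \<phi> T u - Qop a \<psi> T u" for T u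
  proof -
    define w where "w v = (if 0 \<le> v \<and> v \<le> u then cutA a v else 0)" for v
    have w: "integrable lborel w" unfolding w_def by (rule weights_integrable)
    have i: "integrable lborel (\<lambda>v. w v * \<xi> T v)" if \<xi>: "bounded_measurable3 (\<lambda>T s x. \<xi> T s)" for \<xi>
    proof -
      obtain B where B: "B \<ge> 0" "\<And>T s x. cmod (\<xi> T s) \<le> B" using bounded_measurable3_bound[OF \<xi>] by metis
      have "(\<lambda>v. \<xi> T v) \<in> borel_measurable borel"
        by (rule bounded_measurable3D[OF \<xi>, of _ _ _ "\<lambda>_. 0"]) measurable
      from integrable_weight_mult[OF w this B(2)] show ?thesis .
    qed
    show ?thesis
      unfolding Qop_def w_def[symmetric] right_diff_distrib
      by (subst Bochner_Integration.integral_diff[OF i[OF \<phi>] i[OF \<psi>]]) simp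
  qed
  define w where "w v = (if s \<le> v \<and> v \<le> s + T then cnj (cutA a v) else 0)" for v
  have w: "integrable lborel w" unfolding w_def by (rule weights_integrable)
  have i: "integrable lborel (\<lambda>u. w u * Qop a \<xi> (s + T - u) u)" if \<xi>: "bounded_measurable3 (\<lambda>T s x. \<xi> T s)" for \<xi>
  proof -
    have Q': "bounded_measurable3 (\<lambda>T u x. Qop a \<xi> T u)"
      using bounded_measurable3_Qop[OF \<xi>] by simp
    obtain B where B: "B \<ge> 0" "\<And>T u x. cmod (Qop a \<xi> T u) \<le> B" using bounded_measurable3_bound[OF Q'] by metis
    have "(\<lambda>u. Qop a \<xi> (s + T - u) u) \<in> borel_measurable borel"
      by (rule bounded_measurable3D[OF Q', of _ _ _ "\<lambda>_. 0"]) measurable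
    from integrable_weight_mult[OF w this B(2)] show ?thesis .
  qed
  show ?thesis
    unfolding Kop_def w_def[symmetric] Q right_diff_distrib
    by (rule Bochner_Integration.integral_diff[OF i[OF \<phi>] i[OF \<psi>]])
qed

text \<open>Exponent of the weighted norm sup |\<phi>(T, s)| exp(- rate T), chosen so that
  \<open>Kop\<close> contracts by 1/2: the Cauchy-Schwarz estimate needs 2 (1 + cutnorm)^2 normA2
  \<le> rate. The 1 keeps the rate away from 0, as it is divided by.\<close>

definition "rate a = 1 + 2 * (1 + cutnorm a)\<^sup>2 * normA2"

lemma rate_pos: "rate a \<ge> 1"
  unfolding rate_def using normA2_nonneg by simp

lemma weighted_exp_integral:
  assumes "s \<ge> 0" "T \<ge> 0"
  shows "(1 + cutnorm a) * (LINT u:{s..s+T}|lborel. cmod (A u) * exp (rate a * (s + T - u))) \<le> exp (rate a * T) / 2"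
proof -
  define \<gamma> where "\<gamma> = rate a"
  have \<gamma>: "\<gamma> \<ge> 1" using rate_pos by (simp add: \<gamma>_def)
  define c where "c = 1 + cutnorm a"
  have c: "c \<ge> 1" using cutnorm_nonneg by (simp add: c_def)
  define I where "I = (LINT u:{s..s+T}|lborel. cmod (A u) * exp (\<gamma> * (s + T - u)))"
  have e: "continuous_on {s..s+T} (\<lambda>u. exp (\<gamma> * (s + T - u)))" by (intro continuous_intros)
  have ei: "set_integrable lborel {s..s+T} (\<lambda>u. (exp (\<gamma> * (s + T - u)))\<^sup>2)"
    by (intro set_integrable_continuous_on continuous_intros)
  have "I\<^sup>2 \<le> (LINT u:{s..s+T}|lborel. (cmod (A u))\<^sup>2) * (LINT u:{s..s+T}|lborel. (exp (\<gamma> * (s + T - u)))\<^sup>2)"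
    unfolding I_def
    by (rule Cauchy_Schwarz_set_integral(2))
      (simp_all add: A_square_integrable assms ei set_borel_measurable_Icc[OF e] set_borel_measurable_def[where f = "\<lambda>x. cmod (A x)"])
  also have "(LINT u:{s..s+T}|lborel. (exp (\<gamma> * (s + T - u)))\<^sup>2) = (exp (2 * \<gamma> * T) - 1) / (2 * \<gamma>)"
  proof -
    have "((\<lambda>u. (exp (\<gamma> * (s + T - u)))\<^sup>2) has_integral
       (- exp (2 * \<gamma> * (s + T - (s + T))) / (2 * \<gamma>)) - (- exp (2 * \<gamma> * (s + T - s)) / (2 * \<gamma>))) {s..s+T}"
    proof (rule fundamental_theorem_of_calculus)
      fix x
      have "((\<lambda>u. - exp (2 * \<gamma> * (s + T - u)) / (2 * \<gamma>)) has_real_derivative (exp (\<gamma> * (s + T - x)))\<^sup>2) (at x within {s..s+T})"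
        using \<gamma> by (auto intro!: derivative_eq_intros simp: exp_double[symmetric] mult.assoc)
      then show "((\<lambda>u. - exp (2 * \<gamma> * (s + T - u)) / (2 * \<gamma>)) has_vector_derivative (exp (\<gamma> * (s + T - x)))\<^sup>2) (at x within {s..s+T})"
        by (simp add: has_real_derivative_iff_has_vector_derivative)
    qed (use assms in auto)
    then show ?thesis
      using set_borel_integral_eq_integral(2)[OF ei] by (simp add: integral_unique diff_divide_distrib)
  qed
  also have "(LINT u:{s..s+T}|lborel. (cmod (A u))\<^sup>2) * ((exp (2 * \<gamma> * T) - 1) / (2 * \<gamma>)) \<le> normA2 * (exp (2 * \<gamma> * T) / (2 * \<gamma>))"
    using \<gamma> assms normA2_nonneg by (intro mult_mono A_sq_le divide_right_mono) auto
  finally have I2: "I\<^sup>2 \<le> normA2 * (exp (2 * \<gamma> * T) / (2 * \<gamma>))" .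
  have "(c * I)\<^sup>2 \<le> c\<^sup>2 * (normA2 * (exp (2 * \<gamma> * T) / (2 * \<gamma>)))"
    unfolding power_mult_distrib using I2 by (intro mult_left_mono) auto
  also have "\<dots> = (2 * c\<^sup>2 * normA2) * (exp (2 * \<gamma> * T) / (4 * \<gamma>))" by simp
  also have "\<dots> \<le> \<gamma> * (exp (2 * \<gamma> * T) / (4 * \<gamma>))"
    using \<gamma> by (intro mult_right_mono) (auto simp: \<gamma>_def rate_def c_def)
  also have "\<dots> = (exp (\<gamma> * T) / 2)\<^sup>2"
    using \<gamma> by (simp add: power_divide exp_double[symmetric] mult.assoc)
  finally have "c * I \<le> exp (\<gamma> * T) / 2" by (rule power2_le_imp_le) simp
  then show ?thesis by (simp add: c_def I_def \<gamma>_def)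
qed

text \<open>At (T, s) the operator evaluates \<phi> at (s + T - u, v) with 0 \<le> v \<le> u, or v =
  0. The coordinate sum never exceeds s + T, so the triangle s + T \<le> a is preserved.\<close>

lemma Kop_contraction:
  assumes \<phi>: "\<And>T s. T \<ge> 0 \<Longrightarrow> s \<ge> 0 \<Longrightarrow> s + T \<le> a \<Longrightarrow> cmod (\<phi> T s) \<le> L * exp (rate a * T)"
    and L: "L \<ge> 0" and T: "T \<ge> 0" "s \<ge> 0" "s + T \<le> a"
  shows "cmod (Kop a \<phi> T s) \<le> L / 2 * exp (rate a * T)"
proof -
  define \<gamma> where "\<gamma> = rate a"
  have Q: "cmod (Qop a \<phi> (s + T - u) u) \<le> (1 + cutnorm a) * (L * exp (\<gamma> * (s + T - u)))" if u: "s \<le> u" "u \<le> s + T" for u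
  proof -
    have "cmod (\<integral>v. (if 0 \<le> v \<and> v \<le> u then cutA a v else 0) * \<phi> (s + T - u) v \<partial>lborel) \<le> cutnorm a * (L * exp (\<gamma> * (s + T - u)))"
    proof (rule integral_weight_bound[OF weights_integrable(1)])
      fix v assume "(if 0 \<le> v \<and> v \<le> u then cutA a v else 0) \<noteq> 0"
      then have "0 \<le> v" "v \<le> u" by (auto split: if_splits)
      then show "cmod (\<phi> (s + T - u) v) \<le> L * exp (\<gamma> * (s + T - u))"
        unfolding \<gamma>_def using u T by (intro \<phi>) auto
    qed (use L in auto)
    moreover have "cmod (\<phi> (s + T - u) 0) \<le> L * exp (\<gamma> * (s + T - u))"
      unfolding \<gamma>_def using u T by (intro \<phi>) auto
    ultimately have "cmod (Qop a \<phi> (s + T - u) u) \<le> L * exp (\<gamma> * (s + T - u)) + cutnorm a * (L * exp (\<gamma> * (s + T - u)))"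
      unfolding Qop_def by (intro order_trans[OF norm_triangle_ineq4] add_mono)
    then show ?thesis by (simp add: algebra_simps)
  qed
  have int: "set_integrable lborel {s..s+T} (\<lambda>u. cmod (A u) * exp (\<gamma> * (s + T - u)))"
    using T by (intro A_integrable_variants continuous_intros)
  have "cmod (Kop a \<phi> T s) \<le> (\<integral>u. L * (1 + cutnorm a) * (indicat_real {s..s+T} u *\<^sub>R (cmod (A u) * exp (\<gamma> * (s + T - u)))) \<partial>lborel)"
    unfolding Kop_def
  proof (rule integral_norm_le)
    show "integrable lborel (\<lambda>u. L * (1 + cutnorm a) * (indicat_real {s..s+T} u *\<^sub>R (cmod (A u) * exp (\<gamma> * (s + T - u)))))"
      using int unfolding set_integrable_def by (rule integrable_mult_right)
    fix u
    show "cmod ((if s \<le> u \<and> u \<le> s + T then cnj (cutA a u) else 0) * Qop a \<phi> (s + T - u) u)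
        \<le> L * (1 + cutnorm a) * (indicat_real {s..s+T} u *\<^sub>R (cmod (A u) * exp (\<gamma> * (s + T - u))))"
    proof (cases "s \<le> u \<and> u \<le> s + T")
      case True
      have "cmod (cutA a u) \<le> cmod (A u)" by (auto simp: cutA_def indicator_def)
      then have "cmod (cutA a u) * cmod (Qop a \<phi> (s + T - u) u) \<le> cmod (A u) * ((1 + cutnorm a) * (L * exp (\<gamma> * (s + T - u))))"
        using Q[of u] True by (intro mult_mono) auto
      then show ?thesis using True by (simp add: norm_mult mult_ac)
    next
      case False
      then show ?thesis by auto
    qed
  qed
  also have "\<dots> = L * ((1 + cutnorm a) * (LINT u:{s..s+T}|lborel. cmod (A u) * exp (\<gamma> * (s + T - u))))"
    by (simp add: set_lebesgue_integral_def mult.assoc)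
  also have "\<dots> \<le> L * (exp (\<gamma> * T) / 2)"
    unfolding \<gamma>_def using L T by (intro mult_left_mono weighted_exp_integral) auto
  finally show ?thesis by (simp add: \<gamma>_def)
qed

text \<open>Kernels of the Picard iterates started at 0; the indicator of [s, s+T] represents the
  free term of \<open>exp_int_recursion\<close>.\<close>

primrec kern :: "real \<Rightarrow> nat \<Rightarrow> real \<Rightarrow> real \<Rightarrow> real \<Rightarrow> complex" where
  "kern a 0 = (\<lambda>T s x. 0)"
| "kern a (Suc n) = (\<lambda>T s x. (if s \<le> x \<and> x \<le> s + T then 1 else 0) + Kop a (\<lambda>T s. kern a n T s x) T s)"

lemma bounded_measurable3_kern: "bounded_measurable3 (kern a n)"
proof (induction n)
  case 0
  then show ?case by (auto simp: bounded_measurable3_def)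
next
  case (Suc n)
  show ?case
    unfolding kern.simps
    by (intro bounded_measurable3_add bounded_measurable3_interval bounded_measurable3_Kop Suc)
qed

definition "cutP a k x = indicat_real {0..a} x *\<^sub>R P x k"

lemma cutP_integrable: "integrable lborel (cutP a k)"
  unfolding cutP_def[abs_def] using set_integrable_continuous_on[OF P_continuous'(1)[OF order_refl, of a k]]
  by (simp add: set_integrable_def)

definition "picard a n T s k = (\<integral>x. kern a n T s x * cutP a k x \<partial>lborel)"

lemma bounded_measurable3_picard: "bounded_measurable3 (\<lambda>T s x. picard a n T s k)"
proof -
  note K = bounded_measurable3_kern[of a n]
  obtain B where B: "B \<ge> 0" "\<And>T s x. cmod (kern a n T s x) \<le> B" using bounded_measurable3_bound[OF K] by metis
  have [measurable]: "cutP a k \<in> borel_measurable borel" using borel_measurable_integrable[OF cutP_integrable] by simp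
  have "cmod (picard a n T s k) \<le> (\<integral>x. B * cmod (cutP a k x) \<partial>lborel)" for T s
    unfolding picard_def
    using B by (intro integral_norm_le integrable_mult_right integrable_norm cutP_integrable) (auto simp: norm_mult intro!: mult_right_mono)
  moreover have "(\<lambda>z. picard a n (fst z) (fst (snd z)) k) \<in> borel_measurable (borel \<Otimes>\<^sub>M borel \<Otimes>\<^sub>M borel :: (real \<times> real \<times> real) measure)"
    unfolding picard_def
  proof (rule lborel.borel_measurable_lebesgue_integral)
    have [measurable]: "(\<lambda>w. kern a n (fst (fst w)) (fst (snd (fst w))) (snd w)) \<in> borel_measurable ((borel \<Otimes>\<^sub>M borel \<Otimes>\<^sub>M borel :: (real \<times> real \<times> real) measure) \<Otimes>\<^sub>M lborel)"
      by (rule bounded_measurable3D[OF K]) measurable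
    show "(\<lambda>(z, x). kern a n (fst z) (fst (snd z)) x * cutP a k x) \<in> borel_measurable ((borel \<Otimes>\<^sub>M borel \<Otimes>\<^sub>M borel :: (real \<times> real \<times> real) measure) \<Otimes>\<^sub>M lborel)"
      unfolding case_prod_unfold by measurable
  qed
  ultimately show ?thesis unfolding bounded_measurable3_def by blast
qed

lemma picard_Suc:
  assumes "T \<ge> 0" "s \<ge> 0" "s + T \<le> a"
  shows "picard a (Suc n) T s k = (LINT x:{s..s+T}|lborel. P x k) + Kop a (\<lambda>T s. picard a n T s k) T s"
proof -
  note K = bounded_measurable3_kern[of a n]
  have m1: "(\<lambda>x. if s \<le> x \<and> x \<le> s + T then 1 else 0 :: complex) \<in> borel_measurable borel" by measurable
  have i1: "integrable lborel (\<lambda>x. (if s \<le> x \<and> x \<le> s + T then 1 else 0) * cutP a k x)"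
    using integrable_weight_mult[OF cutP_integrable m1, of 1] by (simp add: mult.commute)
  note K2 = bounded_measurable3_Kop[OF K, of a]
  obtain B where B: "B \<ge> 0" "\<And>T s x. cmod (Kop a (\<lambda>T s. kern a n T s x) T s) \<le> B"
    using bounded_measurable3_bound[OF K2] by metis
  have m2: "(\<lambda>x. Kop a (\<lambda>T s. kern a n T s x) T s) \<in> borel_measurable borel"
    by (rule bounded_measurable3D[OF K2]) measurable
  have i2: "integrable lborel (\<lambda>x. Kop a (\<lambda>T s. kern a n T s x) T s * cutP a k x)"
    using integrable_weight_mult[OF cutP_integrable m2 B(2)] by (simp add: mult.commute)
  have "picard a (Suc n) T s k = (\<integral>x. (if s \<le> x \<and> x \<le> s + T then 1 else 0) * cutP a k x \<partial>lborel)
      + (\<integral>x. Kop a (\<lambda>T s. kern a n T s x) T s * cutP a k x \<partial>lborel)"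
    unfolding picard_def kern.simps distrib_right by (rule Bochner_Integration.integral_add[OF i1 i2])
  also have "(\<integral>x. Kop a (\<lambda>T s. kern a n T s x) T s * cutP a k x \<partial>lborel) = Kop a (\<lambda>T s. picard a n T s k) T s"
    unfolding picard_def by (rule Kop_integral[OF K cutP_integrable, symmetric])
  also have "(\<integral>x. (if s \<le> x \<and> x \<le> s + T then 1 else 0) * cutP a k x \<partial>lborel) = (LINT x:{s..s+T}|lborel. P x k)"
    unfolding set_lebesgue_integral_def
    by (rule Bochner_Integration.integral_cong[OF refl]) (use assms in \<open>auto simp: cutP_def indicator_def\<close>)
  finally show ?thesis .
qed

text \<open>The solution of the integral equation, cut off to a square so that it is bounded for all
  arguments, as \<open>bounded_measurable3\<close> demands.\<close>

definition "target a k T s = (if T \<in> {0..a} \<and> s \<in> {0..a} then exp_int T k * P s k else 0)"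

lemma bounded_measurable3_target: "bounded_measurable3 (\<lambda>T s x. target a k T s)"
proof -
  have eq: "target a k T s = (indicat_real {0..a} T *\<^sub>R exp_int T k) * (indicat_real {0..a} s *\<^sub>R P s k)" for T s
    by (auto simp: target_def indicator_def)
  have [measurable]: "(\<lambda>T. indicat_real {0..a} T *\<^sub>R exp_int T k) \<in> borel_measurable borel" "(\<lambda>s. indicat_real {0..a} s *\<^sub>R P s k) \<in> borel_measurable borel"
    using borel_measurable_continuous_on_indicator[OF _ exp_int_continuous[of "{0..a}" k]]
      borel_measurable_continuous_on_indicator[OF _ P_continuous'(1)[OF order_refl, of a k]] by auto
  have "\<exists>B. \<forall>T\<in>{0..a}. cmod (exp_int T k) \<le> B" "\<exists>B. \<forall>T\<in>{0..a}. cmod (P T k) \<le> B"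
    using compact_imp_bounded[OF compact_continuous_image[OF exp_int_continuous[of "{0..a}" k] compact_Icc]]
      compact_imp_bounded[OF compact_continuous_image[OF P_continuous'(1)[OF order_refl, of a k] compact_Icc]]
    by (auto simp: bounded_iff)
  then obtain B B' where B: "\<And>T. T \<in> {0..a} \<Longrightarrow> cmod (exp_int T k) \<le> B" "\<And>T. T \<in> {0..a} \<Longrightarrow> cmod (P T k) \<le> B'" by blast
  have "cmod (target a k T s) \<le> \<bar>B\<bar> * \<bar>B'\<bar>" for T s
    using B[of T] B(2)[of s] unfolding target_def by (auto simp: norm_mult intro!: mult_mono)
  moreover have "(\<lambda>z. target a k (fst z) (fst (snd z))) \<in> borel_measurable (borel \<Otimes>\<^sub>M borel \<Otimes>\<^sub>M borel :: (real \<times> real \<times> real) measure)"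
    unfolding eq by measurable
  ultimately show ?thesis unfolding bounded_measurable3_def by blast
qed

text \<open>For (T, s) in the triangle the operator evaluates only inside the square, so the
  cut-offs of \<open>A\<close> and of the solution are invisible and
  \<open>exp_int_recursion\<close> applies.\<close>

lemma target_recursion:
  assumes "T \<ge> 0" "s \<ge> 0" "s + T \<le> a"
  shows "target a k T s = (LINT x:{s..s+T}|lborel. P x k) + Kop a (target a k) T s"
proof -
  have Q: "Qop a (target a k) (s + T - u) u = exp_int (s + T - u) k - (LINT v:{0..u}|lborel. A v * (exp_int (s + T - u) k * P v k))"
    if u: "s \<le> u" "u \<le> s + T" for u
  proof -
    have "(\<integral>v. (if 0 \<le> v \<and> v \<le> u then cutA a v else 0) * target a k (s + T - u) v \<partial>lborel) = (LINT v:{0..u}|lborel. A v * (exp_int (s + T - u) k * P v k))"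
      unfolding set_lebesgue_integral_def
      by (rule Bochner_Integration.integral_cong[OF refl]) (use assms u in \<open>auto simp: cutA_def target_def indicator_def\<close>)
    then show ?thesis using assms u by (simp add: Qop_def target_def initial_values)
  qed
  have "Kop a (target a k) T s = (LINT u:{s..s+T}|lborel. cnj (A u) * (exp_int (s + T - u) k - (LINT v:{0..u}|lborel. A v * (exp_int (s + T - u) k * P v k))))"
    unfolding Kop_def set_lebesgue_integral_def[of lborel "{s..s+T}"]
    by (rule Bochner_Integration.integral_cong[OF refl]) (use assms Q in \<open>auto simp: cutA_def indicator_def\<close>)
  moreover have "target a k T s = exp_int T k * P s k" using assms by (simp add: target_def)
  ultimately show ?thesis using exp_int_recursion[OF assms(2,1), of k] by simp
qed

text \<open>The error is mapped by \<open>Kop\<close> to the next error, by linearity and the two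
  recursions, so each step halves the weighted norm; at n = 0 the iterate is 0.\<close>

lemma picard_error:
  assumes bnd: "\<And>T s. T \<in> {0..a} \<Longrightarrow> s \<in> {0..a} \<Longrightarrow> cmod (exp_int T k * P s k) \<le> L" and L: "L \<ge> 0"
    and T: "T \<ge> 0" "s \<ge> 0" "s + T \<le> a"
  shows "cmod (target a k T s - picard a n T s k) \<le> L / 2 ^ n * exp (rate a * T)"
  using T
proof (induction n arbitrary: T s)
  case 0
  have "cmod (target a k T s) \<le> L * 1" using 0 bnd[of T s] L by (simp add: target_def)
  also have "\<dots> \<le> L * exp (rate a * T)" using L 0 rate_pos[of a] by (intro mult_left_mono) auto
  finally show ?case by (simp add: picard_def)
next
  case (Suc n)
  have "target a k T s - picard a (Suc n) T s k = Kop a (\<lambda>T s. target a k T s - picard a n T s k) T s"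
    unfolding Kop_diff[OF bounded_measurable3_target bounded_measurable3_picard]
      picard_Suc[OF Suc.prems] target_recursion[OF Suc.prems] by simp
  also have "cmod \<dots> \<le> (L / 2 ^ n) / 2 * exp (rate a * T)"
    by (rule Kop_contraction) (use Suc L in auto)
  finally show ?case by (simp add: mult.commute)
qed

end

section \<open>Bounded limits of exponential polynomials\<close>

definition eval_points :: "complex set" where
  "eval_points = insert \<i> (range complex_of_real)"

lemma eval_points_Im: "k \<in> eval_points \<Longrightarrow> Im k \<ge> 0"
  by (auto simp: eval_points_def)

lemma of_real_eval_points [simp]: "complex_of_real k \<in> eval_points"
  and i_eval_points [simp]: "\<i> \<in> eval_points"
  by (auto simp: eval_points_def)

text \<open>Stands in for the bounded analytic functions on the upper half-plane, which are only ever
  evaluated on the real line and at \<open>\<i>\<close>.\<close>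

inductive exp_closure :: "(complex \<Rightarrow> complex) \<Rightarrow> bool" where
  exp: "x \<ge> 0 \<Longrightarrow> exp_closure (\<lambda>k. exp (\<i> * k * of_real x))"
| scale: "exp_closure F \<Longrightarrow> exp_closure (\<lambda>k. c * F k)"
| add: "exp_closure F \<Longrightarrow> exp_closure G \<Longrightarrow> exp_closure (\<lambda>k. F k + G k)"
| lim: "(\<And>n::nat. exp_closure (F n)) \<Longrightarrow> (\<And>n k. k \<in> eval_points \<Longrightarrow> cmod (F n k) \<le> M) \<Longrightarrow>
    (\<And>k. k \<in> eval_points \<Longrightarrow> (\<lambda>n. F n k) \<longlonglongrightarrow> G k) \<Longrightarrow> exp_closure G"

lemma norm_exp_eval_points:
  assumes "k \<in> eval_points" "x \<ge> 0"
  shows "cmod (exp (\<i> * k * of_real x)) \<le> 1"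
proof -
  have "cmod (exp (\<i> * k * of_real x)) = exp (- (Im k * x))" by (simp add: norm_exp_eq_Re)
  then show ?thesis using eval_points_Im[OF assms(1)] assms(2) by simp
qed

lemma exp_closure_bounded:
  "exp_closure F \<Longrightarrow> \<exists>M\<ge>0. \<forall>k\<in>eval_points. cmod (F k) \<le> M"
proof (induction rule: exp_closure.induct)
  case (exp x)
  then show ?case using norm_exp_eval_points by (intro exI[of _ 1]) auto
next
  case (scale F c)
  then obtain M where "M \<ge> 0" "\<forall>k\<in>eval_points. cmod (F k) \<le> M" by blast
  then show ?case by (intro exI[of _ "cmod c * M"]) (auto simp: norm_mult intro!: mult_left_mono)
next
  case (add F G)
  then obtain M M' where "M \<ge> 0" "\<forall>k\<in>eval_points. cmod (F k) \<le> M" "M' \<ge> 0" "\<forall>k\<in>eval_points. cmod (G k) \<le> M'" by blast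
  then show ?case by (intro exI[of _ "M + M'"]) (auto intro!: norm_triangle_mono)
next
  case (lim F M G)
  have *: "cmod (G k) \<le> M" if "k \<in> eval_points" for k
    using lim.hyps(3)[OF that] lim.hyps(2)[OF that] by (intro LIMSEQ_le_const2[OF tendsto_norm]) auto
  then have "M \<ge> 0" using order_trans[OF norm_ge_zero *[OF i_eval_points]] by simp
  then show ?case using * by blast
qed

lemma exp_closure_measurable:
  "exp_closure F \<Longrightarrow> (\<lambda>k::real. F (of_real k)) \<in> borel_measurable borel"
proof (induction rule: exp_closure.induct)
  case (exp x)
  show ?case by (intro borel_measurable_continuous_onI continuous_intros)
next
  case (lim F M G)
  show ?case
    by (rule borel_measurable_LIMSEQ_metric[of "\<lambda>n k. F n (complex_of_real k)"]) (use lim in auto)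
qed (auto intro!: borel_measurable_times borel_measurable_add)

lemma exp_closure_mult_exp:
  "exp_closure F \<Longrightarrow> x \<ge> 0 \<Longrightarrow> exp_closure (\<lambda>k. exp (\<i> * k * of_real x) * F k)"
proof (induction rule: exp_closure.induct)
  case (exp y)
  have eq: "(\<lambda>k. exp (\<i> * k * of_real x) * exp (\<i> * k * of_real y)) = (\<lambda>k. exp (\<i> * k * of_real (x + y)))"
    by (simp add: fun_eq_iff exp_add[symmetric] algebra_simps)
  show ?case unfolding eq by (rule exp_closure.exp) (use exp in simp)
next
  case (scale F c)
  then show ?case using exp_closure.scale[of "\<lambda>k. exp (\<i> * k * of_real x) * F k" c] by (simp add: mult.left_commute)
next
  case (add F G)
  then show ?case using exp_closure.add[of "\<lambda>k. exp (\<i> * k * of_real x) * F k" "\<lambda>k. exp (\<i> * k * of_real x) * G k"]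
    by (simp add: distrib_left)
next
  case (lim F M G)
  show ?case
  proof (rule exp_closure.lim[of "\<lambda>n k. exp (\<i> * k * of_real x) * F n k" M])
    show "exp_closure (\<lambda>k. exp (\<i> * k * of_real x) * F n k)" for n using lim by blast
    show "cmod (exp (\<i> * k * of_real x) * F n k) \<le> M" if "k \<in> eval_points" for n k
      using mult_mono[OF norm_exp_eval_points[OF that lim.prems] lim.hyps(2)[OF that, of n]] by (simp add: norm_mult)
    show "(\<lambda>n. exp (\<i> * k * of_real x) * F n k) \<longlonglongrightarrow> exp (\<i> * k * of_real x) * G k" if "k \<in> eval_points" for k
      by (intro tendsto_mult tendsto_const lim.hyps(3) that)
  qed
qed

text \<open>Induction on the first factor, with \<open>exp_closure_mult_exp\<close> as base case.
  The boundedness of \<open>G\<close> on \<open>eval_points\<close> preserves the uniform bound that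
  \<open>lim\<close> requires.\<close>

lemma exp_closure_mult:
  "exp_closure F \<Longrightarrow> exp_closure G \<Longrightarrow> exp_closure (\<lambda>k. F k * G k)"
proof (induction rule: exp_closure.induct)
  case (exp x)
  then show ?case by (intro exp_closure_mult_exp)
next
  case (scale F c)
  then show ?case using exp_closure.scale[of "\<lambda>k. F k * G k" c] by (simp add: mult.assoc)
next
  case (add F H)
  then show ?case using exp_closure.add[of "\<lambda>k. F k * G k" "\<lambda>k. H k * G k"] by (simp add: distrib_right)
next
  case (lim F M H)
  obtain B where B: "B \<ge> 0" "\<And>k. k \<in> eval_points \<Longrightarrow> cmod (G k) \<le> B" using exp_closure_bounded[OF lim.prems] by blast
  show ?case
  proof (rule exp_closure.lim[of "\<lambda>n k. F n k * G k" "\<bar>M\<bar> * B"])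
    show "exp_closure (\<lambda>k. F n k * G k)" for n using lim by blast
    show "cmod (F n k * G k) \<le> \<bar>M\<bar> * B" if k: "k \<in> eval_points" for n k
      unfolding norm_mult using lim.hyps(2)[OF k, of n] B(2)[OF k] by (intro mult_mono) auto
    show "(\<lambda>n. F n k * G k) \<longlonglongrightarrow> H k * G k" if "k \<in> eval_points" for k
      by (intro tendsto_mult tendsto_const lim.hyps(3) that)
  qed
qed

lemma exp_closure_const: "exp_closure (\<lambda>k. c)"
  using exp_closure.scale[OF exp_closure.exp[of 0], of c] by simp

lemma exp_closure_sum:
  "finite S \<Longrightarrow> (\<And>j. j \<in> S \<Longrightarrow> exp_closure (F j)) \<Longrightarrow> exp_closure (\<lambda>k. \<Sum>j\<in>S. F j k)"
  by (induction rule: finite_induct) (auto intro: exp_closure_const exp_closure.add)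

lemma exp_closure_power: "exp_closure F \<Longrightarrow> exp_closure (\<lambda>k. F k ^ n)"
  by (induction n) (auto intro: exp_closure_const exp_closure_mult)

text \<open>The partial sums of the exponential series are polynomials in \<open>F\<close>, bounded
  by \<open>exp M\<close> on \<open>eval_points\<close>. This step produces the outer functions of
  \<open>compact_null_set\<close>.\<close>

lemma exp_closure_exp:
  assumes "exp_closure F"
  shows "exp_closure (\<lambda>k. exp (F k))"
proof -
  obtain M where M: "M \<ge> 0" "\<And>k. k \<in> eval_points \<Longrightarrow> cmod (F k) \<le> M" using exp_closure_bounded[OF assms] by blast
  show ?thesis
  proof (rule exp_closure.lim[of "\<lambda>N k. \<Sum>n<N. (1 / fact n) * F k ^ n" "exp M"])
    show "exp_closure (\<lambda>k. \<Sum>n<N. (1 / fact n) * F k ^ n)" for N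
      by (intro exp_closure_sum exp_closure.scale exp_closure_power assms) auto
    show "cmod (\<Sum>n<N. (1 / fact n) * F k ^ n) \<le> exp M" if "k \<in> eval_points" for N k
    proof -
      have "cmod (\<Sum>n<N. (1 / fact n) * F k ^ n) \<le> (\<Sum>n<N. M ^ n /\<^sub>R fact n)"
        using M(1) M(2)[OF that] by (intro sum_norm_le)
          (auto simp: norm_mult norm_divide norm_power divide_inverse norm_inverse intro!: mult_left_mono power_mono)
      also have "\<dots> \<le> (\<Sum>n. M ^ n /\<^sub>R fact n)"
        by (rule sum_le_suminf[OF summable_exp_generic]) (use M in auto)
      finally show ?thesis by (simp add: exp_def)
    qed
    show "(\<lambda>N. \<Sum>n<N. (1 / fact n) * F k ^ n) \<longlonglongrightarrow> exp (F k)" for k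
      using exp_converges[of "F k"] unfolding sums_def by (simp add: scaleR_conv_of_real divide_inverse)
  qed
qed

text \<open>The resolvent is reached through the geometric series
  \<open>\<epsilon> \<Sum>\<^sub>n exp (\<i> \<epsilon> n (k - z)) = \<epsilon> / (1 - exp (\<i> \<epsilon> (k - z))) \<longlonglongrightarrow> \<i> / (k - z)\<close> as \<open>\<epsilon> \<rightarrow> 0\<close>.\<close>

lemma exp_closure_resolvent:
  assumes z: "Im z < 0"
  shows "exp_closure (\<lambda>k. 1 / (k - z))"
proof -
  define y where "y = - Im z"
  have y: "y > 0" using z by (simp add: y_def)
  have nrm: "cmod (exp (\<i> * of_real \<epsilon> * (k - z))) \<le> exp (- (\<epsilon> * y))" if "k \<in> eval_points" "\<epsilon> > 0" for k \<epsilon>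
    using eval_points_Im[OF that(1)] that(2) by (simp add: norm_exp_eq_Re y_def algebra_simps)
  \<comment> \<open>A bound for the geometric series that stays finite as \<epsilon> tends to 0;
    without uniformity the rule \<open>lim\<close> could not be applied to the outer limit.\<close>
  have q: "1 - exp (- (\<epsilon> * y)) > 0" "\<epsilon> / (1 - exp (- (\<epsilon> * y))) \<le> (1 + \<epsilon> * y) / y" if "\<epsilon> > 0" for \<epsilon>
  proof -
    have t: "\<epsilon> * y > 0" using that y by simp
    then show "1 - exp (- (\<epsilon> * y)) > 0" by simp
    have "1 + \<epsilon> * y \<le> exp (\<epsilon> * y)" by (rule exp_ge_add_one_self)
    then have "exp (- (\<epsilon> * y)) \<le> 1 / (1 + \<epsilon> * y)" using t by (simp add: exp_minus field_simps)
    then have "\<epsilon> * y / (1 + \<epsilon> * y) \<le> 1 - exp (- (\<epsilon> * y))" using t by (simp add: field_simps)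
    moreover have "\<epsilon> * y / (1 + \<epsilon> * y) > 0" using t by simp
    ultimately have "\<epsilon> / (1 - exp (- (\<epsilon> * y))) \<le> \<epsilon> / (\<epsilon> * y / (1 + \<epsilon> * y))"
      using that by (intro frac_le) auto
    also have "\<dots> = (1 + \<epsilon> * y) / y" using that y by simp
    finally show "\<epsilon> / (1 - exp (- (\<epsilon> * y))) \<le> (1 + \<epsilon> * y) / y" .
  qed
  define S where "S \<epsilon> k = of_real \<epsilon> / (1 - exp (\<i> * of_real \<epsilon> * (k - z)))" for \<epsilon> k
  have low: "1 - exp (- (\<epsilon> * y)) \<le> cmod (1 - exp (\<i> * of_real \<epsilon> * (k - z)))" if "k \<in> eval_points" "\<epsilon> > 0" for k \<epsilon>
    using norm_triangle_ineq2[of 1 "exp (\<i> * of_real \<epsilon> * (k - z))"] nrm[OF that] unfolding norm_one by linarith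
  have S: "exp_closure (S \<epsilon>)" if \<epsilon>: "\<epsilon> > 0" for \<epsilon>
  proof (rule exp_closure.lim[of "\<lambda>N k. \<Sum>n<N. (of_real \<epsilon> * exp (- \<i> * of_real \<epsilon> * of_nat n * z)) * exp (\<i> * k * of_real (\<epsilon> * real n))" "\<epsilon> / (1 - exp (- (\<epsilon> * y)))"])
    have term_eq: "(of_real \<epsilon> * exp (- \<i> * of_real \<epsilon> * of_nat n * z)) * exp (\<i> * k * of_real (\<epsilon> * real n))
        = of_real \<epsilon> * exp (\<i> * of_real \<epsilon> * (k - z)) ^ n" for n k
      by (simp add: exp_of_nat_mult[symmetric] exp_add[symmetric] algebra_simps)
    show "exp_closure (\<lambda>k. \<Sum>n<N. (of_real \<epsilon> * exp (- \<i> * of_real \<epsilon> * of_nat n * z)) * exp (\<i> * k * of_real (\<epsilon> * real n)))" for N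
      using \<epsilon> by (intro exp_closure_sum exp_closure.scale exp_closure.exp) auto
    fix k assume k: "k \<in> eval_points"
    define w where "w = exp (\<i> * of_real \<epsilon> * (k - z))"
    have w: "cmod w \<le> exp (- (\<epsilon> * y))" unfolding w_def by (rule nrm[OF k \<epsilon>])
    have w1: "cmod w < 1" using w q(1)[OF \<epsilon>] by linarith
    have gs: "(\<lambda>n. of_real \<epsilon> * w ^ n) sums (of_real \<epsilon> * (1 / (1 - w)))"
      by (intro sums_mult geometric_sums w1)
    show "(\<lambda>N. \<Sum>n<N. (of_real \<epsilon> * exp (- \<i> * of_real \<epsilon> * of_nat n * z)) * exp (\<i> * k * of_real (\<epsilon> * real n))) \<longlonglongrightarrow> S \<epsilon> k"
      using gs unfolding term_eq sums_def S_def w_def by simp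
    show "cmod (\<Sum>n<N. (of_real \<epsilon> * exp (- \<i> * of_real \<epsilon> * of_nat n * z)) * exp (\<i> * k * of_real (\<epsilon> * real n))) \<le> \<epsilon> / (1 - exp (- (\<epsilon> * y)))" for N
    proof -
      define r where "r = exp (- (\<epsilon> * y))"
      have r: "0 \<le> r" "r < 1" using q(1)[OF \<epsilon>] by (auto simp: r_def)
      have "cmod (\<Sum>n<N. of_real \<epsilon> * w ^ n) \<le> (\<Sum>n<N. \<epsilon> * r ^ n)"
        using w \<epsilon> by (intro sum_norm_le) (auto simp: norm_mult norm_power r_def intro!: mult_left_mono power_mono)
      also have "\<dots> \<le> (\<Sum>n. \<epsilon> * r ^ n)"
        using r \<epsilon> by (intro sum_le_suminf summable_mult summable_geometric) auto
      also have "\<dots> = \<epsilon> / (1 - r)"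
        using r by (subst suminf_mult) (auto simp: suminf_geometric summable_geometric)
      finally show ?thesis unfolding term_eq w_def r_def .
    qed
  qed
  \<comment> \<open>A null sequence in (0, 1], so that (1 + \<epsilon> y)/y is at most (1 +
    y)/y.\<close>
  define e where "e m = 1 / real (Suc m)" for m
  have e: "e m > 0" "e m \<le> 1" for m by (auto simp: e_def)
  have "exp_closure (\<lambda>k. \<i> / (k - z))"
  proof (rule exp_closure.lim[of "\<lambda>m. S (e m)" "(1 + y) / y"])
    show "exp_closure (S (e m))" for m by (rule S[OF e(1)])
    fix k assume k: "k \<in> eval_points"
    show "cmod (S (e m) k) \<le> (1 + y) / y" for m
    proof -
      have "cmod (S (e m) k) = e m / cmod (1 - exp (\<i> * of_real (e m) * (k - z)))"
        using e[of m] by (simp add: S_def norm_divide)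
      also have "\<dots> \<le> e m / (1 - exp (- (e m * y)))"
        using low[OF k e(1)[of m]] q(1)[OF e(1)[of m]] e(1)[of m] by (intro divide_left_mono mult_pos_pos) auto
      also have "\<dots> \<le> (1 + e m * y) / y" by (rule q(2)[OF e(1)])
      also have "\<dots> \<le> (1 + y) / y" using e[of m] y by (intro divide_right_mono) auto
      finally show ?thesis .
    qed
    have kz: "k - z \<noteq> 0" using eval_points_Im[OF k] z by auto
    have elim: "(\<lambda>m. complex_of_real (e m)) \<longlonglongrightarrow> 0"
      using tendsto_of_real[OF LIMSEQ_inverse_real_of_nat, where 'a = complex]
      by (simp add: e_def inverse_eq_divide del: of_nat_Suc)
    have "((\<lambda>t. exp (\<i> * t * (k - z))) has_field_derivative \<i> * (k - z)) (at 0)"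
      by (auto intro!: derivative_eq_intros)
    then have "((\<lambda>t. (exp (\<i> * t * (k - z)) - 1) / t) \<longlongrightarrow> \<i> * (k - z)) (at 0)"
      by (simp add: has_field_derivative_iff)
    then have "(\<lambda>m. (exp (\<i> * of_real (e m) * (k - z)) - 1) / of_real (e m)) \<longlonglongrightarrow> \<i> * (k - z)"
      by (rule filterlim_compose) (use elim e(1) in \<open>auto simp: filterlim_at less_le intro!: always_eventually\<close>)
    then have "(\<lambda>m. - (1 / ((exp (\<i> * of_real (e m) * (k - z)) - 1) / of_real (e m)))) \<longlonglongrightarrow> - (1 / (\<i> * (k - z)))"
      using kz by (intro tendsto_intros) auto
    moreover have "- (1 / ((exp (\<i> * of_real (e m) * (k - z)) - 1) / of_real (e m))) = S (e m) k" for m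
      unfolding S_def by (simp add: minus_divide_right)
    moreover have "- (1 / (\<i> * (k - z))) = \<i> / (k - z)" using kz by (simp add: field_simps)
    ultimately show "(\<lambda>m. S (e m) k) \<longlonglongrightarrow> \<i> / (k - z)" by simp
  qed
  from exp_closure.scale[OF this, of "- \<i>"] show ?thesis by simp
qed

text \<open>Riemann sums along the floor grid, with the measures of the cells of \<open>S\<close> as weights.\<close>

lemma exp_closure_resolvent_integral:
  assumes S: "S \<in> sets borel" "S \<subseteq> {-c..c}" and y: "y > 0"
  shows "exp_closure (\<lambda>k. LINT t:S|lborel. 1 / (k - of_real t + \<i> * of_real y))"
proof -
  define g where "g k t = 1 / (k - of_real t + \<i> * of_real y)" for k t
  have Sf: "emeasure lborel S < \<infinity>"
    using emeasure_mono[OF S(2), of lborel] by (simp add: emeasure_lborel_Icc_eq le_less_trans split: if_splits)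
  have gb: "cmod (g k t) \<le> 1 / y" if "k \<in> eval_points" for k t
  proof -
    have "y \<le> Im (k - of_real t + \<i> * of_real y)" using eval_points_Im[OF that] by simp
    also have "\<dots> \<le> cmod (k - of_real t + \<i> * of_real y)" using abs_Im_le_cmod abs_ge_self order_trans by blast
    finally show ?thesis using y by (auto simp: g_def norm_divide intro!: frac_le)
  qed
  have gc: "continuous_on UNIV (g k)" if "k \<in> eval_points" for k
  proof -
    have "k - of_real t + \<i> * of_real y \<noteq> 0" for t
      using eval_points_Im[OF that] y by (auto simp: complex_eq_iff)
    then show ?thesis unfolding g_def by (intro continuous_intros) auto
  qed
  define tn where "tn n t = of_int \<lfloor>real (Suc n) * t\<rfloor> / real (Suc n)" for n t
  have tnm [measurable]: "tn n \<in> borel_measurable borel" for n unfolding tn_def[abs_def] by measurable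
  have tn_lim: "(\<lambda>n. tn n t) \<longlonglongrightarrow> t" for t
  proof (rule LIM_zero_cancel)
    show "(\<lambda>n. tn n t - t) \<longlonglongrightarrow> 0"
    proof (rule tendsto_0_le[of "\<lambda>n. 1 / real (Suc n)" _ _ 1])
      show "(\<lambda>n. 1 / real (Suc n)) \<longlonglongrightarrow> 0" using LIMSEQ_inverse_real_of_nat by (simp add: inverse_eq_divide del: of_nat_Suc)
      have "\<bar>t - tn n t\<bar> \<le> 1 / real (Suc n)" for n
      proof -
        have "t - tn n t = (real (Suc n) * t - of_int \<lfloor>real (Suc n) * t\<rfloor>) / real (Suc n)"
          by (simp add: tn_def field_simps)
        moreover have "\<bar>real (Suc n) * t - of_int \<lfloor>real (Suc n) * t\<rfloor>\<bar> \<le> 1"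
          using floor_correct[of "real (Suc n) * t"] by linarith
        ultimately show ?thesis by (simp add: abs_divide divide_right_mono)
      qed
      then show "\<forall>\<^sub>F n in sequentially. norm (tn n t - t) \<le> norm (1 / real (Suc n)) * 1"
        by (simp add: abs_minus_commute)
    qed
  qed
  show ?thesis
    unfolding g_def[symmetric]
  proof (rule exp_closure.lim[of "\<lambda>n k. LINT t:S|lborel. g k (tn n t)" "measure lborel S * (1 / y)"])
    fix n
    \<comment> \<open>All cells that can meet \<open>S\<close>, by its inclusion in [-c, c]. The
      index set is finite, so the Riemann sum is a finite combination of resolvents.\<close>
    define J where "J = {\<lfloor>- (real (Suc n) * c)\<rfloor>..\<lfloor>real (Suc n) * c\<rfloor>}"
    define C where "C j = S \<inter> {t. \<lfloor>real (Suc n) * t\<rfloor> = j}" for j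
    have Cm: "C j \<in> sets borel" for j unfolding C_def using S(1) by measurable
    have eq: "(LINT t:S|lborel. g k (tn n t)) = (\<Sum>j\<in>J. of_real (measure lborel (C j)) * g k (of_int j / real (Suc n)))" for k
    proof -
      have "indicat_real S t *\<^sub>R g k (tn n t) = (\<Sum>j\<in>J. indicat_real (C j) t *\<^sub>R g k (of_int j / real (Suc n)))" for t
      proof (cases "t \<in> S")
        case True
        then have "- c \<le> t" "t \<le> c" using S by auto
        then have "- (real (Suc n) * c) \<le> real (Suc n) * t" "real (Suc n) * t \<le> real (Suc n) * c"
          using mult_left_mono[of "- c" t "real (Suc n)"] mult_left_mono[of t c "real (Suc n)"]
          by (simp_all del: of_nat_Suc)
        then have j: "\<lfloor>real (Suc n) * t\<rfloor> \<in> J" unfolding J_def by (auto intro!: floor_mono)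
        have "(\<Sum>j\<in>J. indicat_real (C j) t *\<^sub>R g k (of_int j / real (Suc n))) = (\<Sum>j\<in>J. if j = \<lfloor>real (Suc n) * t\<rfloor> then g k (of_int j / real (Suc n)) else 0)"
          using True by (intro sum.cong) (auto simp: C_def)
        also have "\<dots> = g k (tn n t)" using j by (simp add: J_def tn_def)
        finally show ?thesis using True by simp
      qed (simp add: C_def)
      then have "(LINT t:S|lborel. g k (tn n t)) = (\<integral>t. (\<Sum>j\<in>J. indicat_real (C j) t *\<^sub>R g k (of_int j / real (Suc n))) \<partial>lborel)"
        unfolding set_lebesgue_integral_def by simp
      also have "\<dots> = (\<Sum>j\<in>J. \<integral>t. indicat_real (C j) t *\<^sub>R g k (of_int j / real (Suc n)) \<partial>lborel)"
      proof (rule Bochner_Integration.integral_sum)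
        fix j
        have "emeasure lborel (C j) < \<infinity>"
          using emeasure_mono[of "C j" S lborel] S Sf by (auto simp: C_def intro: le_less_trans)
        then show "integrable lborel (\<lambda>t. indicat_real (C j) t *\<^sub>R g k (of_int j / real (Suc n)))"
          using Cm by (intro integrable_scaleR_left integrable_real_indicator) auto
      qed
      also have "\<dots> = (\<Sum>j\<in>J. of_real (measure lborel (C j)) * g k (of_int j / real (Suc n)))"
        using Cm by (simp add: scaleR_conv_of_real)
      finally show ?thesis .
    qed
    show "exp_closure (\<lambda>k. LINT t:S|lborel. g k (tn n t))"
      unfolding eq
    proof (intro exp_closure_sum exp_closure.scale)
      fix j
      have "g k (of_int j / real (Suc n)) = 1 / (k - (of_real (of_int j / real (Suc n)) - \<i> * of_real y))" for k
        by (simp add: g_def)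
      then show "exp_closure (\<lambda>k. g k (of_int j / real (Suc n)))"
        using exp_closure_resolvent[of "of_real (of_int j / real (Suc n)) - \<i> * of_real y"] y by simp
    qed (simp add: J_def)
  next
    fix n k assume k: "k \<in> eval_points"
    have "cmod (LINT t:S|lborel. g k (tn n t)) \<le> (\<integral>t. indicat_real S t * (1 / y) \<partial>lborel)"
      unfolding set_lebesgue_integral_def
    proof (rule integral_norm_le)
      show "integrable lborel (\<lambda>t. indicat_real S t * (1 / y))"
        using S Sf by (intro integrable_mult_left integrable_real_indicator) auto
    qed (use gb[OF k] in \<open>auto simp: indicator_def\<close>)
    then show "cmod (LINT t:S|lborel. g k (tn n t)) \<le> measure lborel S * (1 / y)" using S by simp
  next
    fix k assume k: "k \<in> eval_points"
    have [measurable]: "g k \<in> borel_measurable borel" using gc[OF k] by (rule borel_measurable_continuous_onI)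
    note S(1)[measurable]
    show "(\<lambda>n. LINT t:S|lborel. g k (tn n t)) \<longlonglongrightarrow> (LINT t:S|lborel. g k t)"
      unfolding set_lebesgue_integral_def
    proof (rule integral_dominated_convergence[where w = "\<lambda>t. indicat_real S t * (1 / y)"])
      show "integrable lborel (\<lambda>t. indicat_real S t * (1 / y))"
        using S Sf by (intro integrable_mult_left integrable_real_indicator) auto
      have "(\<lambda>n. g k (tn n t)) \<longlonglongrightarrow> g k t" for t
        using continuous_on_tendsto_compose[OF gc[OF k] tn_lim] by simp
      then show "AE t in lborel. (\<lambda>n. indicat_real S t *\<^sub>R g k (tn n t)) \<longlonglongrightarrow> indicat_real S t *\<^sub>R g k t"
        by (intro AE_I2 tendsto_scaleR tendsto_const)
      show "AE t in lborel. cmod (indicat_real S t *\<^sub>R g k (tn n t)) \<le> indicat_real S t * (1 / y)" for n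
        using gb[OF k] by (intro AE_I2) (auto simp: indicator_def)
    qed measurable
  qed
qed

section \<open>Approximation in the space of the orthogonality measure\<close>

lemma exp_int_measurable: "(\<lambda>k::real. exp_int T (of_real k)) \<in> borel_measurable borel"
  unfolding exp_int_def by measurable

lemma exp_int_1_real_bound: "(cmod (exp_int 1 (of_real k)))\<^sup>2 \<le> 5 / (1 + k\<^sup>2)"
  using exp_int_real_bound[of 1 k] by simp

lemma sq_add_le: "ennreal ((cmod (z + w))\<^sup>2) \<le> 2 * ennreal ((cmod z)\<^sup>2) + 2 * ennreal ((cmod w)\<^sup>2)"
proof -
  have "(cmod (z + w))\<^sup>2 \<le> (cmod z + cmod w)\<^sup>2" by (intro power_mono norm_triangle_ineq) auto
  also have "\<dots> \<le> 2 * (cmod z)\<^sup>2 + 2 * (cmod w)\<^sup>2" by (rule square_sum_le)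
  finally have "ennreal ((cmod (z + w))\<^sup>2) \<le> ennreal (2 * (cmod z)\<^sup>2 + 2 * (cmod w)\<^sup>2)" by (rule ennreal_leI)
  then show ?thesis by (subst (asm) ennreal_double_sum) auto
qed

section \<open>The closed span of the \<open>P r\<close> and the evaluation at \<i>\<close>

context krein_measure
begin

text \<open>The image of bounded functions on a bounded interval under the isometry. One f has to
  serve for all complex k, which ties the value at \<i> to the values on the real line.\<close>

definition representable :: "(complex \<Rightarrow> complex) \<Rightarrow> bool" where
  "representable G \<longleftrightarrow> (\<exists>a>0. \<exists>f\<in>borel_measurable borel. (\<exists>B. \<forall>x. cmod (f x) \<le> B) \<and>
     (\<forall>k. G k = (\<integral>x. f x * cutP a k x \<partial>lborel)))"

lemma representableI:
  assumes "a > 0" "f \<in> borel_measurable borel" "\<And>x. cmod (f x) \<le> B" "\<And>k. G k = (\<integral>x. f x * cutP a k x \<partial>lborel)"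
  shows "representable G"
  unfolding representable_def using assms by (intro exI[of _ a] conjI bexI[of _ f] exI[of _ B]) simp_all

lemma representable_scale:
  assumes "representable G"
  shows "representable (\<lambda>k. c * G k)"
proof -
  obtain a f B where f: "a > 0" "f \<in> borel_measurable borel" "\<And>x. cmod (f x) \<le> B" "\<And>k. G k = (\<integral>x. f x * cutP a k x \<partial>lborel)"
    using assms unfolding representable_def by metis
  have "c * G k = (\<integral>x. (c * f x) * cutP a k x \<partial>lborel)" for k
    unfolding f(4) by (simp add: mult.assoc)
  moreover have "(\<lambda>x. c * f x) \<in> borel_measurable borel" using f(2) by simp
  moreover have "cmod (c * f x) \<le> cmod c * B" for x using f(3) by (simp add: norm_mult mult_left_mono)
  ultimately show ?thesis by (intro representableI[OF f(1)])
qed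

lemma representable_add:
  assumes "representable G" "representable H"
  shows "representable (\<lambda>k. G k + H k)"
proof -
  obtain a f B where f: "a > 0" "f \<in> borel_measurable borel" "\<And>x. cmod (f x) \<le> B" "\<And>k. G k = (\<integral>x. f x * cutP a k x \<partial>lborel)"
    using assms(1) unfolding representable_def by metis
  obtain b g B' where g: "b > 0" "g \<in> borel_measurable borel" "\<And>x. cmod (g x) \<le> B'" "\<And>k. H k = (\<integral>x. g x * cutP b k x \<partial>lborel)"
    using assms(2) unfolding representable_def by metis
  define h where "h x = indicat_real {0..a} x *\<^sub>R f x + indicat_real {0..b} x *\<^sub>R g x" for x
  define c where "c = max a b"
  have hm: "h \<in> borel_measurable borel" unfolding h_def[abs_def] using f(2) g(2) by measurable
  have "cmod (h x) \<le> B + B'" for x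
  proof -
    have "cmod (indicat_real {0..a} x *\<^sub>R f x) \<le> B" "cmod (indicat_real {0..b} x *\<^sub>R g x) \<le> B'"
      using f(3)[of x] g(3)[of x] order_trans[OF norm_ge_zero f(3)] order_trans[OF norm_ge_zero g(3)] by (auto simp: indicator_def)
    then show ?thesis unfolding h_def by (rule norm_triangle_mono)
  qed
  moreover have "G k + H k = (\<integral>x. h x * cutP c k x \<partial>lborel)" for k
  proof -
    have i1: "integrable lborel (\<lambda>x. f x * cutP a k x)" "integrable lborel (\<lambda>x. g x * cutP b k x)"
      using integrable_weight_mult[OF cutP_integrable f(2,3)] integrable_weight_mult[OF cutP_integrable g(2,3)]
      by (simp_all add: mult.commute)
    have "h x * cutP c k x = f x * cutP a k x + g x * cutP b k x" for x
      using f(1) g(1) by (auto simp: h_def cutP_def c_def indicator_def distrib_right)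
    then show ?thesis
      unfolding f(4) g(4) using Bochner_Integration.integral_add[OF i1] by simp
  qed
  moreover have "c > 0" using f(1) by (simp add: c_def)
  ultimately show ?thesis using hm by (intro representableI[of c])
qed

lemma representable_measurable:
  assumes "representable G"
  shows "(\<lambda>k::real. G (of_real k)) \<in> borel_measurable borel"
proof -
  obtain a f where f: "a > 0" "f \<in> borel_measurable borel" "\<And>k. G k = (\<integral>x. f x * cutP a k x \<partial>lborel)"
    using assms unfolding representable_def by metis
  have eq: "cutP a (of_real k) x = indicat_real {0..a} x *\<^sub>R Pb x k" for k x
    by (auto simp: cutP_def Pb_def indicator_def)
  note f(2)[measurable]
  show ?thesis
    unfolding f(3) eq by measurable
qed

text \<open>Cauchy-Schwarz bounds |G(\<i>)|^2 by the energy times the squared L^2 norm of f, and the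
  isometry turns the latter into the norm in L^2(\<sigma>).\<close>

lemma representable_eval:
  assumes G: "representable G" and K: "\<And>r. energy r \<le> K"
  shows "ennreal ((cmod (G \<i>))\<^sup>2) \<le> ennreal K * (\<integral>\<^sup>+k. ennreal ((cmod (G (of_real k)))\<^sup>2) \<partial>\<sigma>)"
proof -
  obtain a f B where f: "a > 0" "f \<in> borel_measurable borel" "\<And>x. cmod (f x) \<le> B" "\<And>k. G k = (\<integral>x. f x * cutP a k x \<partial>lborel)"
    using G unfolding representable_def by metis
  note f(2)[measurable]
  have Gk: "G k = (LINT x:{0..a}|lborel. f x * P x k)" for k
    unfolding f(4) set_lebesgue_integral_def by (rule Bochner_Integration.integral_cong[OF refl]) (simp add: cutP_def)
  have fsq: "set_integrable lborel {0..a} (\<lambda>x. (cmod (f x))\<^sup>2)"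
  proof (rule set_integrable_bound)
    show "set_integrable lborel {0..a} (\<lambda>x. B\<^sup>2)" by (intro set_integrable_continuous_on continuous_intros)
    show "set_borel_measurable lborel {0..a} (\<lambda>x. (cmod (f x))\<^sup>2)" by (simp add: set_borel_measurable_def)
    have "(cmod (f x))\<^sup>2 \<le> B\<^sup>2" for x using f(3) by (intro power_mono) auto
    then show "AE x in lborel. x \<in> {0..a} \<longrightarrow> norm ((cmod (f x))\<^sup>2) \<le> norm (B\<^sup>2)" by simp
  qed
  define X where "X = (LINT x:{0..a}|lborel. (cmod (f x))\<^sup>2)"
  have X0: "X \<ge> 0"
    unfolding X_def set_lebesgue_integral_def by (rule Bochner_Integration.integral_nonneg) simp
  have fm: "set_borel_measurable lborel {0..a} (\<lambda>x. cmod (f x))" by (simp add: set_borel_measurable_def)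
  have Pm: "set_borel_measurable lborel {0..a} (\<lambda>x. cmod (P x \<i>))"
    by (intro set_borel_measurable_Icc continuous_intros P_continuous') simp
  note CS = Cauchy_Schwarz_set_integral[OF fm Pm fsq energy_integrable[OF order_refl]]
  have "cmod (G \<i>) \<le> (LINT x:{0..a}|lborel. cmod (f x) * cmod (P x \<i>))"
    unfolding Gk set_lebesgue_integral_def
    by (rule integral_norm_le) (use CS(1) in \<open>auto simp: set_integrable_def norm_mult\<close>)
  then have "(cmod (G \<i>))\<^sup>2 \<le> (LINT x:{0..a}|lborel. cmod (f x) * cmod (P x \<i>))\<^sup>2" by (intro power_mono) auto
  also have "\<dots> \<le> X * energy a" using CS(2) by (simp add: X_def energy_def)
  also have "\<dots> \<le> K * X" using mult_left_mono[OF K[of a] X0] by (simp add: mult.commute)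
  finally have "ennreal ((cmod (G \<i>))\<^sup>2) \<le> ennreal (K * X)" by (rule ennreal_leI)
  also have "\<dots> = ennreal K * ennreal X"
    using X0 order_trans[OF energy_nonneg K] by (intro ennreal_mult) auto
  also have "ennreal X = (\<integral>\<^sup>+k. ennreal ((cmod (G (of_real k)))\<^sup>2) \<partial>\<sigma>)"
    unfolding X_def Gk by (rule isometry[OF f(2) fsq f(1), symmetric])
  finally show ?thesis .
qed

text \<open>An element of L^2(\<sigma>) has no value at \<i> of its own, so convergence there is
  recorded by a second summand.\<close>

definition dist2 :: "(complex \<Rightarrow> complex) \<Rightarrow> (complex \<Rightarrow> complex) \<Rightarrow> ennreal" where
  "dist2 G H = (\<integral>\<^sup>+k. ennreal ((cmod (G (of_real k) - H (of_real k)))\<^sup>2) \<partial>\<sigma>) + ennreal ((cmod (G \<i> - H \<i>))\<^sup>2)"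

definition approximable :: "(complex \<Rightarrow> complex) \<Rightarrow> bool" where
  "approximable G \<longleftrightarrow> (\<lambda>k::real. G (of_real k)) \<in> borel_measurable borel \<and>
     (\<forall>\<epsilon>>0. \<exists>G'. representable G' \<and> dist2 G G' \<le> ennreal \<epsilon>)"

lemma dist2_add_le:
  assumes [measurable]: "(\<lambda>k::real. F (of_real k)) \<in> borel_measurable borel" "(\<lambda>k::real. G (of_real k)) \<in> borel_measurable borel"
    "(\<lambda>k::real. F' (of_real k)) \<in> borel_measurable borel" "(\<lambda>k::real. G' (of_real k)) \<in> borel_measurable borel"
  shows "dist2 (\<lambda>k. F k + G k) (\<lambda>k. F' k + G' k) \<le> 2 * dist2 F F' + 2 * dist2 G G'"
proof -
  have eq: "F k + G k - (F' k + G' k) = (F k - F' k) + (G k - G' k)" for k by simp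
  have "(\<integral>\<^sup>+k. ennreal ((cmod (F (of_real k) + G (of_real k) - (F' (of_real k) + G' (of_real k))))\<^sup>2) \<partial>\<sigma>)
    \<le> (\<integral>\<^sup>+k. 2 * ennreal ((cmod (F (of_real k) - F' (of_real k)))\<^sup>2) + 2 * ennreal ((cmod (G (of_real k) - G' (of_real k)))\<^sup>2) \<partial>\<sigma>)"
    unfolding eq by (intro nn_integral_mono sq_add_le)
  also have "\<dots> = 2 * (\<integral>\<^sup>+k. ennreal ((cmod (F (of_real k) - F' (of_real k)))\<^sup>2) \<partial>\<sigma>) + 2 * (\<integral>\<^sup>+k. ennreal ((cmod (G (of_real k) - G' (of_real k)))\<^sup>2) \<partial>\<sigma>)"
    by (simp add: nn_integral_add nn_integral_cmult)
  finally have 1: "(\<integral>\<^sup>+k. ennreal ((cmod (F (of_real k) + G (of_real k) - (F' (of_real k) + G' (of_real k))))\<^sup>2) \<partial>\<sigma>)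
     \<le> 2 * (\<integral>\<^sup>+k. ennreal ((cmod (F (of_real k) - F' (of_real k)))\<^sup>2) \<partial>\<sigma>) + 2 * (\<integral>\<^sup>+k. ennreal ((cmod (G (of_real k) - G' (of_real k)))\<^sup>2) \<partial>\<sigma>)" .
  have 2: "ennreal ((cmod (F \<i> + G \<i> - (F' \<i> + G' \<i>)))\<^sup>2) \<le> 2 * ennreal ((cmod (F \<i> - F' \<i>))\<^sup>2) + 2 * ennreal ((cmod (G \<i> - G' \<i>))\<^sup>2)"
    unfolding eq by (rule sq_add_le)
  show ?thesis
    unfolding dist2_def using add_mono[OF 1 2] by (simp add: distrib_left add_ac)
qed

lemma approximable_measurable: "approximable G \<Longrightarrow> (\<lambda>k::real. G (of_real k)) \<in> borel_measurable borel"
  by (simp add: approximable_def)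

lemma approximable_add:
  assumes "approximable F" "approximable G"
  shows "approximable (\<lambda>k. F k + G k)"
  unfolding approximable_def
proof (intro conjI allI impI)
  show "(\<lambda>k::real. F (of_real k) + G (of_real k)) \<in> borel_measurable borel"
    using assms by (intro borel_measurable_add approximable_measurable)
  fix \<epsilon> :: real assume \<epsilon>: "\<epsilon> > 0"
  then obtain F' G' where F': "representable F'" "dist2 F F' \<le> ennreal (\<epsilon>/4)" and G': "representable G'" "dist2 G G' \<le> ennreal (\<epsilon>/4)"
    using assms unfolding approximable_def by (metis divide_pos_pos zero_less_numeral)
  have "dist2 (\<lambda>k. F k + G k) (\<lambda>k. F' k + G' k) \<le> 2 * dist2 F F' + 2 * dist2 G G'"
    by (rule dist2_add_le[OF approximable_measurable[OF assms(1)] approximable_measurable[OF assms(2)]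
        representable_measurable[OF F'(1)] representable_measurable[OF G'(1)]])
  also have "\<dots> \<le> 2 * ennreal (\<epsilon>/4) + 2 * ennreal (\<epsilon>/4)" using F' G' by (intro add_mono mult_left_mono) auto
  also have "\<dots> = ennreal \<epsilon>" using \<epsilon> by (subst ennreal_double_sum[symmetric]) auto
  finally show "\<exists>H. representable H \<and> dist2 (\<lambda>k. F k + G k) H \<le> ennreal \<epsilon>"
    using representable_add[OF F'(1) G'(1)] by blast
qed

lemma approximable_scale:
  assumes "approximable F"
  shows "approximable (\<lambda>k. c * F k)"
  unfolding approximable_def
proof (intro conjI allI impI)
  have [measurable]: "(\<lambda>k::real. F (of_real k)) \<in> borel_measurable borel" using assms by (rule approximable_measurable)
  show "(\<lambda>k::real. c * F (of_real k)) \<in> borel_measurable borel" by measurable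
  fix \<epsilon> :: real assume \<epsilon>: "\<epsilon> > 0"
  define m where "m = 1 + (cmod c)\<^sup>2"
  have m: "m > 0" by (simp add: m_def add_pos_nonneg)
  then obtain F' where F': "representable F'" "dist2 F F' \<le> ennreal (\<epsilon>/m)"
    using assms \<epsilon> unfolding approximable_def by (metis divide_pos_pos)
  have [measurable]: "(\<lambda>k::real. F' (of_real k)) \<in> borel_measurable borel" using F'(1) by (rule representable_measurable)
  have eq: "ennreal ((cmod (c * z - c * w))\<^sup>2) = ennreal ((cmod c)\<^sup>2) * ennreal ((cmod (z - w))\<^sup>2)" for z w
    by (simp add: norm_mult power_mult_distrib ennreal_mult flip: right_diff_distrib)
  have "dist2 (\<lambda>k. c * F k) (\<lambda>k. c * F' k) = ennreal ((cmod c)\<^sup>2) * dist2 F F'"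
    unfolding dist2_def eq by (simp add: nn_integral_cmult distrib_left)
  also have "\<dots> \<le> ennreal m * ennreal (\<epsilon>/m)" using F' by (intro mult_mono ennreal_leI) (auto simp: m_def)
  also have "\<dots> = ennreal \<epsilon>" using m \<epsilon> by (subst ennreal_mult[symmetric]) auto
  finally show "\<exists>H. representable H \<and> dist2 (\<lambda>k. c * F k) H \<le> ennreal \<epsilon>"
    using representable_scale[OF F'(1)] by blast
qed

lemma approximable_limit:
  assumes m: "(\<lambda>k::real. G (of_real k)) \<in> borel_measurable borel"
    and F: "\<And>n. approximable (F n)" and lim: "(\<lambda>n. dist2 G (F n)) \<longlonglongrightarrow> 0"
  shows "approximable G"
  unfolding approximable_def
proof (intro conjI allI impI)
  show "(\<lambda>k::real. G (of_real k)) \<in> borel_measurable borel" by (rule m)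
  fix \<epsilon> :: real assume \<epsilon>: "\<epsilon> > 0"
  have "\<forall>\<^sub>F n in sequentially. dist2 G (F n) < ennreal (\<epsilon>/4)"
    by (rule order_tendstoD(2)[OF lim]) (use \<epsilon> in simp)
  then obtain n where n: "dist2 G (F n) < ennreal (\<epsilon>/4)" by (auto simp: eventually_sequentially)
  obtain F' where F': "representable F'" "dist2 (F n) F' \<le> ennreal (\<epsilon>/4)"
    using F[of n] \<epsilon> unfolding approximable_def by (metis divide_pos_pos zero_less_numeral)
  \<comment> \<open>Adding \<open>F n\<close> to both arguments obtains the triangle inequality from
    \<open>dist2_add_le\<close>.\<close>
  have "dist2 G F' = dist2 (\<lambda>k. G k + F n k) (\<lambda>k. F n k + F' k)"
    by (simp add: dist2_def)
  also have "\<dots> \<le> 2 * dist2 G (F n) + 2 * dist2 (F n) F'"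
    by (rule dist2_add_le[OF m approximable_measurable[OF F] approximable_measurable[OF F] representable_measurable[OF F'(1)]])
  also have "\<dots> \<le> 2 * ennreal (\<epsilon>/4) + 2 * ennreal (\<epsilon>/4)" using F' n by (intro add_mono mult_left_mono) auto
  also have "\<dots> = ennreal \<epsilon>" using \<epsilon> by (subst ennreal_double_sum[symmetric]) auto
  finally show "\<exists>H. representable H \<and> dist2 G H \<le> ennreal \<epsilon>" using F'(1) by blast
qed

text \<open>\<open>representable_eval\<close> for an approximant; comparing G with it at \<i> and on
  the real line doubles the square each time, hence the 4. The remainder is (2 + 4K) times the
  approximation error and is made equal to e.\<close>

lemma approximable_eval:
  assumes G: "approximable G" and K: "\<And>r. energy r \<le> K"
  shows "ennreal ((cmod (G \<i>))\<^sup>2) \<le> ennreal (4 * K) * (\<integral>\<^sup>+k. ennreal ((cmod (G (of_real k)))\<^sup>2) \<partial>\<sigma>)"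
proof (rule ennreal_le_epsilon)
  fix e :: real assume e: "e > 0"
  have K0: "K \<ge> 0" using order_trans[OF energy_nonneg K] .
  define \<epsilon> where "\<epsilon> = e / (2 + 4 * K)"
  have \<epsilon>: "\<epsilon> > 0" using e K0 by (simp add: \<epsilon>_def)
  obtain F where F: "representable F" "dist2 G F \<le> ennreal \<epsilon>" using G \<epsilon> unfolding approximable_def by blast
  note [measurable] = approximable_measurable[OF G] representable_measurable[OF F(1)]
  define X where "X = (\<integral>\<^sup>+k. ennreal ((cmod (G (of_real k)))\<^sup>2) \<partial>\<sigma>)"
  have d1: "(\<integral>\<^sup>+k. ennreal ((cmod (G (of_real k) - F (of_real k)))\<^sup>2) \<partial>\<sigma>) \<le> ennreal \<epsilon>"
    and d2: "ennreal ((cmod (G \<i> - F \<i>))\<^sup>2) \<le> ennreal \<epsilon>"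
    using F(2) unfolding dist2_def by (auto intro: order_trans[rotated])
  have "(\<integral>\<^sup>+k. ennreal ((cmod (F (of_real k)))\<^sup>2) \<partial>\<sigma>) \<le> (\<integral>\<^sup>+k. 2 * ennreal ((cmod (G (of_real k)))\<^sup>2) + 2 * ennreal ((cmod (G (of_real k) - F (of_real k)))\<^sup>2) \<partial>\<sigma>)"
  proof (intro nn_integral_mono)
    fix k :: real
    show "ennreal ((cmod (F (of_real k)))\<^sup>2) \<le> 2 * ennreal ((cmod (G (of_real k)))\<^sup>2) + 2 * ennreal ((cmod (G (of_real k) - F (of_real k)))\<^sup>2)"
      using sq_add_le[of "G (of_real k)" "F (of_real k) - G (of_real k)"] by (simp add: norm_minus_commute)
  qed
  also have "\<dots> = 2 * X + 2 * (\<integral>\<^sup>+k. ennreal ((cmod (G (of_real k) - F (of_real k)))\<^sup>2) \<partial>\<sigma>)"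
    unfolding X_def by (simp add: nn_integral_add nn_integral_cmult)
  also have "\<dots> \<le> 2 * X + 2 * ennreal \<epsilon>" using d1 by (intro add_left_mono mult_left_mono) auto
  finally have FX: "(\<integral>\<^sup>+k. ennreal ((cmod (F (of_real k)))\<^sup>2) \<partial>\<sigma>) \<le> 2 * X + 2 * ennreal \<epsilon>" .
  have rF: "ennreal ((cmod (F \<i>))\<^sup>2) \<le> ennreal K * (2 * X + 2 * ennreal \<epsilon>)"
    by (rule order_trans[OF representable_eval[OF F(1) K] mult_left_mono[OF FX]]) simp
  have "ennreal ((cmod (G \<i>))\<^sup>2) \<le> 2 * ennreal ((cmod (G \<i> - F \<i>))\<^sup>2) + 2 * ennreal ((cmod (F \<i>))\<^sup>2)"
    using sq_add_le[of "G \<i> - F \<i>" "F \<i>"] by simp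
  also have "\<dots> \<le> 2 * ennreal \<epsilon> + 2 * (ennreal K * (2 * X + 2 * ennreal \<epsilon>))"
    using d2 rF by (intro add_mono mult_left_mono) auto
  also have "\<dots> = ennreal (4 * K) * X + ennreal ((2 + 4 * K) * \<epsilon>)"
  proof -
    have "ennreal ((2 + 4 * K) * \<epsilon>) = 2 * ennreal \<epsilon> + 4 * (ennreal K * ennreal \<epsilon>)"
      using K0 \<epsilon> by (simp add: distrib_right ennreal_mult mult.assoc)
    moreover have "ennreal (4 * K) = 4 * ennreal K" using K0 by (simp add: ennreal_mult)
    ultimately show ?thesis by (simp add: distrib_left mult.assoc add_ac mult.left_commute)
  qed
  also have "(2 + 4 * K) * \<epsilon> = e" using K0 by (simp add: \<epsilon>_def)
  finally show "ennreal ((cmod (G \<i>))\<^sup>2) \<le> ennreal (4 * K) * (\<integral>\<^sup>+k. ennreal ((cmod (G (of_real k)))\<^sup>2) \<partial>\<sigma>) + ennreal e"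
    by (simp add: X_def)
qed

text \<open>At s = 0 the target is \<open>exp_int T\<close> itself, since \<open>P 0 k = 1\<close>,
  and the Picard iterates are representable through \<open>kern\<close>.\<close>

lemma approximable_exp_int:
  assumes T: "T \<ge> 0"
  shows "approximable (exp_int T)"
proof (rule approximable_limit)
  \<comment> \<open>Positive also for T = 0, as \<open>representable\<close> demands, and large
    enough for (T, 0) to lie in the triangle.\<close>
  define a where "a = T + 1"
  have a: "a > 0" using T by (simp add: a_def)
  define F where "F n = picard a n T 0" for n
  show "(\<lambda>k::real. exp_int T (of_real k)) \<in> borel_measurable borel" by (rule exp_int_measurable)
  have Fr: "representable (F n)" for n
  proof -
    note K = bounded_measurable3_kern[of a n]
    obtain B where B: "\<And>T s x. cmod (kern a n T s x) \<le> B" using bounded_measurable3_bound[OF K] by metis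
    have "(\<lambda>x. kern a n T 0 x) \<in> borel_measurable borel" by (rule bounded_measurable3D[OF K]) measurable
    then show ?thesis by (rule representableI[OF a _ B]) (simp add: F_def picard_def)
  qed
  show "approximable (F n)" for n
    unfolding approximable_def
    using Fr representable_measurable[OF Fr] by (auto simp: dist2_def intro!: exI[of _ "F n"])
  define g where "g = exp (rate a * T)"
  define cR where "cR = 9 * (exp (2 * normA2 * a))\<^sup>2 * (a\<^sup>2 + 4) * g\<^sup>2"
  \<comment> \<open>The decay of \<open>exp_int\<close> and the k-independent bound for
    \<open>P\<close> give an error of size 1/(1 + k^2), which the finite weighted mass can
    integrate.\<close>
  have err_real: "(cmod (exp_int T (of_real k) - F n (of_real k)))\<^sup>2 \<le> cR / 4 ^ n * (1 / (1 + k\<^sup>2))" for n k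
  proof -
    define L where "L = sqrt ((a\<^sup>2 + 4) / (1 + k\<^sup>2)) * (3 * exp (2 * normA2 * a))"
    have L0: "L \<ge> 0" by (simp add: L_def add_nonneg_nonneg)
    have "cmod (exp_int t (of_real k) * P s (of_real k)) \<le> L" if "t \<in> {0..a}" "s \<in> {0..a}" for t s
    proof -
      have "(cmod (exp_int t (of_real k)))\<^sup>2 \<le> (t\<^sup>2 + 4) / (1 + k\<^sup>2)" using that by (intro exp_int_real_bound) auto
      also have "\<dots> \<le> (a\<^sup>2 + 4) / (1 + k\<^sup>2)" using that by (intro divide_right_mono add_right_mono power_mono) auto
      finally have "cmod (exp_int t (of_real k)) \<le> sqrt ((a\<^sup>2 + 4) / (1 + k\<^sup>2))" by (rule real_le_rsqrt)
      then show ?thesis unfolding norm_mult L_def using norm_bound_real[OF that(2), of k] by (intro mult_mono) auto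
    qed
    from picard_error[where a = a and s = 0 and n = n, OF this L0 T order_refl]
    have "cmod (exp_int T (of_real k) - F n (of_real k)) \<le> L / 2 ^ n * g"
      using T by (simp add: F_def g_def target_def a_def initial_values)
    then have "(cmod (exp_int T (of_real k) - F n (of_real k)))\<^sup>2 \<le> (L / 2 ^ n * g)\<^sup>2" by (intro power_mono) auto
    also have "\<dots> = L\<^sup>2 * g\<^sup>2 / 4 ^ n"
      by (simp add: power_mult_distrib power_divide power_mult[symmetric] mult.commute[of _ 2]) (simp add: power_mult)
    also have "L\<^sup>2 = (a\<^sup>2 + 4) / (1 + k\<^sup>2) * (9 * (exp (2 * normA2 * a))\<^sup>2)"
      by (simp add: L_def power_mult_distrib add_nonneg_nonneg)
    finally show ?thesis by (simp add: cR_def field_simps)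
  qed
  obtain LI where LI: "LI \<ge> 0" "\<And>t s. t \<in> {0..a} \<Longrightarrow> s \<in> {0..a} \<Longrightarrow> cmod (exp_int t \<i> * P s \<i>) \<le> LI"
  proof -
    have b: "bounded ((\<lambda>T. exp_int T \<i>) ` {0..a})" "bounded ((\<lambda>s. P s \<i>) ` {0..a})"
      by (intro compact_imp_bounded compact_continuous_image exp_int_continuous P_continuous'; simp)+
    obtain B B' where B: "\<And>t. t \<in> {0..a} \<Longrightarrow> cmod (exp_int t \<i>) \<le> B" "\<And>s. s \<in> {0..a} \<Longrightarrow> cmod (P s \<i>) \<le> B'"
      using b unfolding bounded_iff by (metis imageI)
    show ?thesis
    proof (rule that[of "\<bar>B\<bar> * \<bar>B'\<bar>"])
      show "cmod (exp_int t \<i> * P s \<i>) \<le> \<bar>B\<bar> * \<bar>B'\<bar>" if "t \<in> {0..a}" "s \<in> {0..a}" for t s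
        unfolding norm_mult using B(1)[OF that(1)] B(2)[OF that(2)] by (intro mult_mono) auto
    qed simp
  qed
  define cI where "cI = (LI * g)\<^sup>2"
  have err_i: "(cmod (exp_int T \<i> - F n \<i>))\<^sup>2 \<le> cI / 4 ^ n" for n
  proof -
    have "cmod (exp_int T \<i> - F n \<i>) \<le> LI / 2 ^ n * g"
      using picard_error[where a = a and s = 0 and n = n, OF LI(2,1) T order_refl] T by (simp add: F_def g_def target_def a_def initial_values)
    then have "(cmod (exp_int T \<i> - F n \<i>))\<^sup>2 \<le> (LI / 2 ^ n * g)\<^sup>2" by (intro power_mono) auto
    also have "\<dots> = cI / 4 ^ n"
      by (simp add: cI_def power_mult_distrib power_divide power_mult[symmetric] mult.commute[of _ 2]) (simp add: power_mult)
    finally show ?thesis .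
  qed
  define m where "m = enn2real mass"
  have m: "mass = ennreal m" "m \<ge> 0" using mass_finite by (simp_all add: m_def)
  have cR0: "cR \<ge> 0" and cI0: "cI \<ge> 0" by (simp_all add: cR_def cI_def)
  have bound: "dist2 (exp_int T) (F n) \<le> ennreal ((cR * m + cI) / 4 ^ n)" for n
  proof -
    have "(\<integral>\<^sup>+k. ennreal ((cmod (exp_int T (of_real k) - F n (of_real k)))\<^sup>2) \<partial>\<sigma>) \<le> (\<integral>\<^sup>+k. ennreal (cR / 4 ^ n) * ennreal (1 / (1 + k\<^sup>2)) \<partial>\<sigma>)"
    proof (intro nn_integral_mono)
      fix k
      have "ennreal ((cmod (exp_int T (of_real k) - F n (of_real k)))\<^sup>2) \<le> ennreal (cR / 4 ^ n * (1 / (1 + k\<^sup>2)))"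
        by (intro ennreal_leI err_real)
      also have "\<dots> = ennreal (cR / 4 ^ n) * ennreal (1 / (1 + k\<^sup>2))" using cR0 by (intro ennreal_mult) auto
      finally show "ennreal ((cmod (exp_int T (of_real k) - F n (of_real k)))\<^sup>2) \<le> ennreal (cR / 4 ^ n) * ennreal (1 / (1 + k\<^sup>2))" .
    qed
    also have "\<dots> = ennreal (cR / 4 ^ n) * mass" unfolding mass_def by (intro nn_integral_cmult) measurable
    also have "\<dots> = ennreal (cR / 4 ^ n * m)" unfolding m(1) using cR0 m by (intro ennreal_mult[symmetric]) auto
    finally have "dist2 (exp_int T) (F n) \<le> ennreal (cR / 4 ^ n * m) + ennreal (cI / 4 ^ n)"
      unfolding dist2_def by (intro add_mono ennreal_leI err_i)
    also have "\<dots> = ennreal (cR / 4 ^ n * m + cI / 4 ^ n)" using cR0 cI0 m by (intro ennreal_plus[symmetric]) auto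
    also have "cR / 4 ^ n * m + cI / 4 ^ n = (cR * m + cI) / 4 ^ n" by (simp add: field_simps)
    finally show ?thesis .
  qed
  have "(\<lambda>n. (cR * m + cI) * (1/4) ^ n) \<longlonglongrightarrow> (cR * m + cI) * 0"
    by (intro tendsto_mult tendsto_const LIMSEQ_power_zero) simp
  then have "(\<lambda>n. ennreal ((cR * m + cI) / 4 ^ n)) \<longlonglongrightarrow> ennreal 0"
    by (intro tendsto_ennrealI) (simp add: power_divide)
  then have l0: "(\<lambda>n. ennreal ((cR * m + cI) / 4 ^ n)) \<longlonglongrightarrow> 0" by simp
  show "(\<lambda>n. dist2 (exp_int T) (F n)) \<longlonglongrightarrow> 0"
    by (rule tendsto_sandwich[OF _ _ tendsto_const l0]) (simp_all add: bound)
qed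

text \<open>The factor \<open>exp_int 1\<close> brings a bounded F into L^2(\<sigma>). For an
  exponential the product is a difference of two exponential integrals; bounded limits pass through
  by dominated convergence with 20 M^2 / (1 + k^2), where 20 M^2 = (2M)^2 * 5.\<close>

lemma approximable_exp_closure:
  "exp_closure F \<Longrightarrow> approximable (\<lambda>k. F k * exp_int 1 k)"
proof (induction rule: exp_closure.induct)
  case (exp x)
  have eq: "exp (\<i> * k * of_real x) * exp_int 1 k = exp_int (x + 1) k + (-1) * exp_int x k" for k
  proof (cases "k = 0")
    case False
    then show ?thesis by (simp add: exp_int_def exp_add[symmetric] divide_simps) (simp add: algebra_simps exp_add[symmetric])
  qed (simp add: exp_int_def)
  show ?case unfolding eq using exp by (intro approximable_add approximable_scale approximable_exp_int) auto
next
  case (scale F c)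
  then show ?case using approximable_scale[of "\<lambda>k. F k * exp_int 1 k" c] by (simp add: mult.assoc)
next
  case (add F G)
  then show ?case using approximable_add[of "\<lambda>k. F k * exp_int 1 k" "\<lambda>k. G k * exp_int 1 k"] by (simp add: distrib_right)
next
  case (lim F M G)
  have clG: "exp_closure G" using lim.hyps by (rule exp_closure.lim)
  note [measurable] = exp_closure_measurable[OF clG] exp_closure_measurable[OF lim.hyps(1)] exp_int_measurable
  have GM: "cmod (G k) \<le> M" if "k \<in> eval_points" for k
    using lim.hyps(3)[OF that] lim.hyps(2)[OF that] by (intro LIMSEQ_le_const2[OF tendsto_norm]) auto
  have M0: "M \<ge> 0" using order_trans[OF norm_ge_zero GM[OF i_eval_points]] .
  show ?case
  proof (rule approximable_limit[OF _ lim.IH])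
    show "(\<lambda>k::real. G (of_real k) * exp_int 1 (of_real k)) \<in> borel_measurable borel" by measurable
    have l1: "(\<lambda>n. \<integral>\<^sup>+k. ennreal ((cmod (G (of_real k) * exp_int 1 (of_real k) - F n (of_real k) * exp_int 1 (of_real k)))\<^sup>2) \<partial>\<sigma>) \<longlonglongrightarrow> (\<integral>\<^sup>+k. 0 \<partial>\<sigma>)"
    proof (rule nn_integral_dominated_convergence[where w = "\<lambda>k. ennreal (20 * M\<^sup>2) * ennreal (1 / (1 + k\<^sup>2))"])
      have "(\<integral>\<^sup>+k. ennreal (20 * M\<^sup>2) * ennreal (1 / (1 + k\<^sup>2)) \<partial>\<sigma>) = ennreal (20 * M\<^sup>2) * mass"
        unfolding mass_def by (intro nn_integral_cmult) measurable
      then show "(\<integral>\<^sup>+k. ennreal (20 * M\<^sup>2) * ennreal (1 / (1 + k\<^sup>2)) \<partial>\<sigma>) < \<infinity>"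
        using mass_finite by (simp add: ennreal_mult_less_top)
      show "AE k in \<sigma>. ennreal ((cmod (G (of_real k) * exp_int 1 (of_real k) - F n (of_real k) * exp_int 1 (of_real k)))\<^sup>2) \<le> ennreal (20 * M\<^sup>2) * ennreal (1 / (1 + k\<^sup>2))" for n
      proof (intro AE_I2)
        fix k :: real
        have "cmod (G (of_real k) - F n (of_real k)) \<le> 2 * M"
          using GM[OF of_real_eval_points, of k] lim.hyps(2)[OF of_real_eval_points, of n k] norm_triangle_ineq4[of "G (of_real k)" "F n (of_real k)"] by linarith
        then have "(cmod (G (of_real k) - F n (of_real k)))\<^sup>2 \<le> (2 * M)\<^sup>2" by (intro power_mono) auto
        then have "(cmod (G (of_real k) - F n (of_real k)))\<^sup>2 * (cmod (exp_int 1 (of_real k)))\<^sup>2 \<le> (2 * M)\<^sup>2 * (5 / (1 + k\<^sup>2))"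
          using exp_int_1_real_bound[of k] by (intro mult_mono) auto
        then have "(cmod (G (of_real k) * exp_int 1 (of_real k) - F n (of_real k) * exp_int 1 (of_real k)))\<^sup>2 \<le> 20 * M\<^sup>2 * (1 / (1 + k\<^sup>2))"
          by (simp add: norm_mult power_mult_distrib flip: left_diff_distrib)
        then show "ennreal ((cmod (G (of_real k) * exp_int 1 (of_real k) - F n (of_real k) * exp_int 1 (of_real k)))\<^sup>2) \<le> ennreal (20 * M\<^sup>2) * ennreal (1 / (1 + k\<^sup>2))"
          by (subst ennreal_mult[symmetric]) (auto intro: ennreal_leI)
      qed
      show "AE k in \<sigma>. (\<lambda>n. ennreal ((cmod (G (of_real k) * exp_int 1 (of_real k) - F n (of_real k) * exp_int 1 (of_real k)))\<^sup>2)) \<longlonglongrightarrow> 0"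
      proof (intro AE_I2)
        fix k :: real
        have "(\<lambda>n. (cmod (G (of_real k) * exp_int 1 (of_real k) - F n (of_real k) * exp_int 1 (of_real k)))\<^sup>2) \<longlonglongrightarrow> (cmod (G (of_real k) * exp_int 1 (of_real k) - G (of_real k) * exp_int 1 (of_real k)))\<^sup>2"
          by (intro tendsto_intros lim.hyps(3)) simp
        from tendsto_ennrealI[OF this] show "(\<lambda>n. ennreal ((cmod (G (of_real k) * exp_int 1 (of_real k) - F n (of_real k) * exp_int 1 (of_real k)))\<^sup>2)) \<longlonglongrightarrow> 0"
          by simp
      qed
    qed measurable
    have l2: "(\<lambda>n. ennreal ((cmod (G \<i> * exp_int 1 \<i> - F n \<i> * exp_int 1 \<i>))\<^sup>2)) \<longlonglongrightarrow> ennreal ((cmod (G \<i> * exp_int 1 \<i> - G \<i> * exp_int 1 \<i>))\<^sup>2)"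
      by (intro tendsto_ennrealI tendsto_intros lim.hyps(3)) simp
    show "(\<lambda>n. dist2 (\<lambda>k. G k * exp_int 1 k) (\<lambda>k. F n k * exp_int 1 k)) \<longlonglongrightarrow> 0"
      unfolding dist2_def using tendsto_add[OF l1 l2] by simp
  qed
qed

end

section \<open>Null sets of the orthogonality measure\<close>

text \<open>On the real line its real part is \<pi> times the Poisson extension of the indicator of
  \<open>S\<close> at height y. The shift by y keeps the function bounded up to the real
  axis.\<close>

definition cauchy_transform :: "real set \<Rightarrow> real \<Rightarrow> complex \<Rightarrow> complex" where
  "cauchy_transform S y k = \<i> * (LINT t:S|lborel. 1 / (k - of_real t + \<i> * of_real y))"

lemma Re_cauchy_transform:
  assumes S: "compact S" and y: "y > 0" and k: "k \<in> eval_points"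
  shows "Re (cauchy_transform S y k) = (LINT t:S|lborel. Re (\<i> / (k - of_real t + \<i> * of_real y)))"
    and "set_integrable lborel S (\<lambda>t. Re (\<i> / (k - of_real t + \<i> * of_real y)))"
proof -
  have nz: "k - of_real t + \<i> * of_real y \<noteq> 0" for t
    using eval_points_Im[OF k] y by (auto simp: complex_eq_iff)
  have int: "set_integrable lborel S (\<lambda>t. \<i> / (k - of_real t + \<i> * of_real y))"
    by (rule borel_integrable_compact[OF S, folded set_integrable_def]) (use nz in \<open>auto intro!: continuous_intros\<close>)
  have "cauchy_transform S y k = (LINT t:S|lborel. \<i> / (k - of_real t + \<i> * of_real y))"
    unfolding cauchy_transform_def by (simp flip: set_integral_mult_right)
  then show "Re (cauchy_transform S y k) = (LINT t:S|lborel. Re (\<i> / (k - of_real t + \<i> * of_real y)))"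
    using integral_Re[OF int[unfolded set_integrable_def]] by (simp add: set_lebesgue_integral_def)
  show "set_integrable lborel S (\<lambda>t. Re (\<i> / (k - of_real t + \<i> * of_real y)))"
    using integrable_Re[OF int[unfolded set_integrable_def]] by (simp add: set_integrable_def)
qed

lemma poisson_kernel_eq:
  assumes "y > 0"
  shows "Re (\<i> / (of_real k - of_real t + \<i> * of_real y)) = y / ((k - t)\<^sup>2 + y\<^sup>2)"
  by (simp add: Re_divide power2_eq_square)

text \<open>The antiderivative is arctan((t - k)/y), whose total variation is \<pi>.\<close>

lemma poisson_integral_le:
  assumes y: "y > 0" and c: "c \<ge> 0"
  shows "(LINT t:{-c..c}|lborel. y / ((k - t)\<^sup>2 + y\<^sup>2)) \<le> pi"
proof -
  have pos: "(k - t)\<^sup>2 + y\<^sup>2 > 0" for t using y by (simp add: add_nonneg_pos)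
  have "((\<lambda>t. y / ((k - t)\<^sup>2 + y\<^sup>2)) has_integral (arctan ((c - k) / y) - arctan ((- c - k) / y))) {-c..c}"
  proof (rule fundamental_theorem_of_calculus)
    fix t
    have "((\<lambda>t. arctan ((t - k) / y)) has_real_derivative inverse (1 + ((t - k) / y)\<^sup>2) * (1 / y)) (at t within {-c..c})"
      using y by (auto intro!: derivative_eq_intros)
    moreover have "inverse (1 + ((t - k) / y)\<^sup>2) * (1 / y) = y / ((k - t)\<^sup>2 + y\<^sup>2)"
    proof -
      have "1 + ((t - k) / y)\<^sup>2 = ((k - t)\<^sup>2 + y\<^sup>2) / y\<^sup>2"
        using y by (simp add: power_divide add_divide_distrib power2_commute)
      then show ?thesis using y by (simp add: power2_eq_square)
    qed
    ultimately show "((\<lambda>t. arctan ((t - k) / y)) has_vector_derivative y / ((k - t)\<^sup>2 + y\<^sup>2)) (at t within {-c..c})"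
      by (simp add: has_real_derivative_iff_has_vector_derivative)
  qed (use c in auto)
  moreover have "set_integrable lborel {-c..c} (\<lambda>t. y / ((k - t)\<^sup>2 + y\<^sup>2))"
  proof (intro set_integrable_continuous_on continuous_intros ballI)
    show "(k - t)\<^sup>2 + y\<^sup>2 \<noteq> 0" for t using pos[of t] by linarith
  qed
  ultimately have "(LINT t:{-c..c}|lborel. y / ((k - t)\<^sup>2 + y\<^sup>2)) = arctan ((c - k) / y) - arctan ((- c - k) / y)"
    using set_borel_integral_eq_integral(2) by (metis integral_unique)
  also have "\<dots> \<le> pi" using arctan_ubound[of "(c - k) / y"] arctan_lbound[of "(- c - k) / y"] by linarith
  finally show ?thesis .
qed

lemma exp_closure_cauchy_transform:
  assumes "compact S" "S \<subseteq> {-c..c}" "y > 0"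
  shows "exp_closure (cauchy_transform S y)"
  unfolding cauchy_transform_def[abs_def]
  using assms by (intro exp_closure.scale exp_closure_resolvent_integral[of S c]) (auto simp: borel_compact)

lemma Re_cauchy_transform_le_pi:
  assumes S: "compact S" "S \<subseteq> {-c..c}" and y: "y > 0" and c: "c \<ge> 0"
  shows "Re (cauchy_transform S y (of_real k)) \<le> pi"
proof -
  have pos: "(k - t)\<^sup>2 + y\<^sup>2 > 0" for t using y by (simp add: add_nonneg_pos)
  have "Re (cauchy_transform S y (of_real k)) = (LINT t:S|lborel. y / ((k - t)\<^sup>2 + y\<^sup>2))"
    using Re_cauchy_transform(1)[OF S(1) y of_real_eval_points, of k] unfolding poisson_kernel_eq[OF y] .
  also have "\<dots> \<le> (LINT t:{-c..c}|lborel. y / ((k - t)\<^sup>2 + y\<^sup>2))"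
  proof (rule set_integral_mono_subset)
    show "set_integrable lborel {-c..c} (\<lambda>t. y / ((k - t)\<^sup>2 + y\<^sup>2))"
    proof (intro set_integrable_continuous_on continuous_intros ballI)
      show "(k - t)\<^sup>2 + y\<^sup>2 \<noteq> 0" for t using pos[of t] by linarith
    qed
  qed (use S y in \<open>auto simp: borel_compact\<close>)
  also have "\<dots> \<le> pi" by (rule poisson_integral_le[OF y c])
  finally show ?thesis .
qed

text \<open>Off the closed set the Poisson kernel is at most y/d^2, with d the distance from k to
  \<open>S\<close>.\<close>

lemma Re_cauchy_transform_off_set:
  assumes S: "compact S" and k: "k \<notin> S"
  shows "(\<lambda>m. Re (cauchy_transform S (1 / real (Suc m)) (of_real k))) \<longlonglongrightarrow> 0"
proof -
  obtain d where d: "d > 0" "\<And>t. t \<in> S \<Longrightarrow> d \<le> dist k t"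
    using separate_point_closed[OF compact_imp_closed[OF S] k] by blast
  have mS: "emeasure lborel S < \<infinity>" using emeasure_compact_finite[OF S] by (simp add: less_top)
  have Sm: "S \<in> sets lborel" using S by (simp add: borel_compact)
  have bound: "\<bar>Re (cauchy_transform S y (of_real k))\<bar> \<le> y * (measure lborel S / d\<^sup>2)" if y: "y > 0" for y
  proof -
    have "Re (cauchy_transform S y (of_real k)) = (LINT t:S|lborel. y / ((k - t)\<^sup>2 + y\<^sup>2))"
      using Re_cauchy_transform(1)[OF S y of_real_eval_points, of k] unfolding poisson_kernel_eq[OF y] .
    also have "norm \<dots> \<le> (\<integral>t. indicat_real S t * (y / d\<^sup>2) \<partial>lborel)"
      unfolding set_lebesgue_integral_def
    proof (rule integral_norm_le)
      show "integrable lborel (\<lambda>t. indicat_real S t * (y / d\<^sup>2))"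
        using Sm mS by (intro integrable_mult_left integrable_real_indicator)
      fix t
      show "norm (indicat_real S t *\<^sub>R (y / ((k - t)\<^sup>2 + y\<^sup>2))) \<le> indicat_real S t * (y / d\<^sup>2)"
      proof (cases "t \<in> S")
        case True
        have "d\<^sup>2 \<le> \<bar>k - t\<bar>\<^sup>2" using d(2)[OF True] d(1) by (intro power_mono) (auto simp: dist_real_def)
        then have "d\<^sup>2 \<le> (k - t)\<^sup>2 + y\<^sup>2" by (simp add: add_increasing2)
        then have "y / ((k - t)\<^sup>2 + y\<^sup>2) \<le> y / d\<^sup>2" using y d(1) by (intro divide_left_mono mult_pos_pos) (auto simp: add_nonneg_pos)
        then show ?thesis using True y by simp
      qed simp
    qed
    finally show ?thesis using Sm by (simp add: mult.commute)
  qed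
  have "(\<lambda>m. (1 / real (Suc m)) * (measure lborel S / d\<^sup>2)) \<longlonglongrightarrow> 0 * (measure lborel S / d\<^sup>2)"
    using LIMSEQ_inverse_real_of_nat by (intro tendsto_mult tendsto_const) (simp add: inverse_eq_divide del: of_nat_Suc)
  then have l: "(\<lambda>m. (1 / real (Suc m)) * (measure lborel S / d\<^sup>2)) \<longlonglongrightarrow> 0" by simp
  have "\<bar>Re (cauchy_transform S (1 / real (Suc m)) (of_real k))\<bar> \<le> (1 / real (Suc m)) * (measure lborel S / d\<^sup>2)" for m
    by (rule bound) simp
  then have "(\<lambda>m. \<bar>Re (cauchy_transform S (1 / real (Suc m)) (of_real k))\<bar>) \<longlonglongrightarrow> 0"
    by (intro tendsto_sandwich[OF _ _ tendsto_const l]) (simp_all del: of_nat_Suc times_divide_eq_right times_divide_eq_left)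
  then show ?thesis by (rule tendsto_rabs_zero_cancel)
qed

text \<open>At \<i> the kernel is (1 + y)/(t^2 + (1 + y)^2); for |t| \<le> c and y \<le> 1 this is
  at least 1/(c^2 + 4), so the lower bound survives the limit y to 0.\<close>

lemma Re_cauchy_transform_i:
  assumes S: "compact S" "S \<subseteq> {-c..c}" and y: "0 < y" "y \<le> 1"
  shows "measure lborel S / (c\<^sup>2 + 4) \<le> Re (cauchy_transform S y \<i>)"
proof -
  have Sm: "S \<in> sets lborel" using S by (simp add: borel_compact)
  have mS: "emeasure lborel S < \<infinity>" using emeasure_compact_finite[OF S(1)] by (simp add: less_top)
  have "measure lborel S / (c\<^sup>2 + 4) = (LINT t:S|lborel. 1 / (c\<^sup>2 + 4))"
    using Sm by (simp add: set_lebesgue_integral_def)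
  also have "\<dots> \<le> (LINT t:S|lborel. Re (\<i> / (\<i> - of_real t + \<i> * of_real y)))"
  proof (rule set_integral_mono)
    show "set_integrable lborel S (\<lambda>t. 1 / (c\<^sup>2 + 4))"
      using Sm mS by (auto simp: set_integrable_def intro!: integrable_divide integrable_real_indicator)
    show "set_integrable lborel S (\<lambda>t. Re (\<i> / (\<i> - of_real t + \<i> * of_real y)))"
      by (rule Re_cauchy_transform(2)[OF S(1) y(1) i_eval_points])
    fix t assume t: "t \<in> S"
    have "Re (\<i> / (\<i> - of_real t + \<i> * of_real y)) = (1 + y) / (t\<^sup>2 + (1 + y)\<^sup>2)"
      by (simp add: Re_divide power2_eq_square)
    moreover have "1 / (c\<^sup>2 + 4) \<le> (1 + y) / (t\<^sup>2 + (1 + y)\<^sup>2)"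
    proof (rule frac_le)
      have "\<bar>t\<bar> \<le> c" using subsetD[OF S(2) t] by auto
      then have "t\<^sup>2 \<le> c\<^sup>2" using power_mono[of "\<bar>t\<bar>" c 2] by simp
      moreover have "(1 + y)\<^sup>2 \<le> 2\<^sup>2" using y by (intro power_mono) auto
      ultimately show "t\<^sup>2 + (1 + y)\<^sup>2 \<le> c\<^sup>2 + 4" by simp
      show "0 < t\<^sup>2 + (1 + y)\<^sup>2" using y by (simp add: add_nonneg_pos)
    qed (use y in auto)
    ultimately show "1 / (c\<^sup>2 + 4) \<le> Re (\<i> / (\<i> - of_real t + \<i> * of_real y))" by simp
  qed
  also have "\<dots> = Re (cauchy_transform S y \<i>)" by (rule Re_cauchy_transform(1)[OF S(1) y(1) i_eval_points, symmetric])
  finally show ?thesis .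
qed

context krein_measure
begin

text \<open>\<open>approximable_eval\<close> applied to \<open>F\<close> times
  \<open>exp_int 1\<close>. The factor equals 1 - exp(-1) at \<i>, which is not 0, and its square is
  at most 5/(1 + k^2) on the real line; hence 20 K = 4 K * 5.\<close>

lemma evaluation_inequality:
  obtains K c where "K \<ge> 0" "c > 0"
    "\<And>F. exp_closure F \<Longrightarrow> ennreal (c * (cmod (F \<i>))\<^sup>2) \<le> ennreal K * (\<integral>\<^sup>+k. ennreal ((cmod (F (of_real k)))\<^sup>2 * (1 / (1 + k\<^sup>2))) \<partial>\<sigma>)"
proof -
  obtain K where K: "\<And>r. energy r \<le> K" using energy_bounded by blast
  have K0: "K \<ge> 0" using order_trans[OF energy_nonneg K] .
  define c where "c = (cmod (exp_int 1 \<i>))\<^sup>2"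
  have "exp_int 1 \<i> = 1 - of_real (exp (-1))"
    by (simp add: exp_int_def exp_of_real[symmetric])
  then have "exp_int 1 \<i> \<noteq> 0" by (metis eq_iff_diff_eq_0 exp_eq_one_iff neg_equal_0_iff_equal of_real_eq_1_iff zero_neq_one)
  then have c: "c > 0" by (simp add: c_def)
  show ?thesis
  proof (rule that[of "20 * K" c])
    fix F assume F: "exp_closure F"
    note [measurable] = exp_closure_measurable[OF F]
    have "ennreal (c * (cmod (F \<i>))\<^sup>2) = ennreal ((cmod (F \<i> * exp_int 1 \<i>))\<^sup>2)"
      by (simp add: c_def norm_mult power_mult_distrib mult.commute)
    also have "\<dots> \<le> ennreal (4 * K) * (\<integral>\<^sup>+k. ennreal ((cmod (F (of_real k) * exp_int 1 (of_real k)))\<^sup>2) \<partial>\<sigma>)"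
      by (rule approximable_eval[OF approximable_exp_closure[OF F] K])
    also have "\<dots> \<le> ennreal (4 * K) * (\<integral>\<^sup>+k. ennreal 5 * ennreal ((cmod (F (of_real k)))\<^sup>2 * (1 / (1 + k\<^sup>2))) \<partial>\<sigma>)"
    proof (intro mult_left_mono nn_integral_mono)
      fix k :: real
      have "(cmod (F (of_real k) * exp_int 1 (of_real k)))\<^sup>2 \<le> 5 * ((cmod (F (of_real k)))\<^sup>2 * (1 / (1 + k\<^sup>2)))"
        using mult_left_mono[OF exp_int_1_real_bound[of k], of "(cmod (F (of_real k)))\<^sup>2"] by (simp add: norm_mult power_mult_distrib mult.commute)
      then have "ennreal ((cmod (F (of_real k) * exp_int 1 (of_real k)))\<^sup>2) \<le> ennreal (5 * ((cmod (F (of_real k)))\<^sup>2 * (1 / (1 + k\<^sup>2))))"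
        by (rule ennreal_leI)
      also have "\<dots> = ennreal 5 * ennreal ((cmod (F (of_real k)))\<^sup>2 * (1 / (1 + k\<^sup>2)))" by (rule ennreal_mult) auto
      finally show "ennreal ((cmod (F (of_real k) * exp_int 1 (of_real k)))\<^sup>2) \<le> ennreal 5 * ennreal ((cmod (F (of_real k)))\<^sup>2 * (1 / (1 + k\<^sup>2)))" .
    qed auto
    also have "\<dots> = ennreal (4 * K) * (ennreal 5 * (\<integral>\<^sup>+k. ennreal ((cmod (F (of_real k)))\<^sup>2 * (1 / (1 + k\<^sup>2))) \<partial>\<sigma>))"
      by (subst nn_integral_cmult) auto
    also have "\<dots> = ennreal (20 * K) * (\<integral>\<^sup>+k. ennreal ((cmod (F (of_real k)))\<^sup>2 * (1 / (1 + k\<^sup>2))) \<partial>\<sigma>)"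
    proof -
      have "ennreal (20 * K) = ennreal (4 * K) * ennreal 5" using K0 by (subst ennreal_mult[symmetric]) auto
      then show ?thesis by (simp only: mult.assoc)
    qed
    finally show "ennreal (c * (cmod (F \<i>))\<^sup>2) \<le> ennreal (20 * K) * (\<integral>\<^sup>+k. ennreal ((cmod (F (of_real k)))\<^sup>2 * (1 / (1 + k\<^sup>2))) \<partial>\<sigma>)" .
  qed (use K0 c in auto)
qed

text \<open>If a compact set of positive length were \<open>\<sigma>\<close>-null, the outer functions with modulus
  \<open>exp (M \<pi>)\<close> on it and modulus \<open>1\<close> elsewhere would have bounded \<open>L\<^sup>2(\<sigma>)\<close>-norms but values at \<open>\<i>\<close>
  growing exponentially in \<open>M\<close>, contradicting the boundedness of the evaluation at \<open>\<i>\<close>.\<close>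

lemma compact_null_set:
  assumes S: "compact S" and null: "emeasure \<sigma> S = 0"
  shows "measure lborel S = 0"
proof (rule ccontr)
  assume "measure lborel S \<noteq> 0"
  then have mS: "measure lborel S > 0" by (simp add: zero_less_measure_iff)
  obtain c0 where c0: "\<And>x. x \<in> S \<Longrightarrow> norm x \<le> c0" using compact_imp_bounded[OF S] by (auto simp: bounded_iff)
  define c where "c = \<bar>c0\<bar>"
  have c: "c \<ge> 0" "S \<subseteq> {-c..c}" using c0 by (force simp: c_def)+
  obtain K d where K: "K \<ge> 0" "d > 0"
    and ev: "\<And>F. exp_closure F \<Longrightarrow> ennreal (d * (cmod (F \<i>))\<^sup>2) \<le> ennreal K * (\<integral>\<^sup>+k. ennreal ((cmod (F (of_real k)))\<^sup>2 * (1 / (1 + k\<^sup>2))) \<partial>\<sigma>)"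
    by (rule evaluation_inequality, rule that) blast+
  define \<eta> where "\<eta> = measure lborel S / (c\<^sup>2 + 4)"
  have \<eta>: "\<eta> > 0" unfolding \<eta>_def using mS by (simp add: add_nonneg_pos)
  define m where "m = enn2real mass"
  have m: "mass = ennreal m" "m \<ge> 0" using mass_finite by (simp_all add: m_def)
  have main: "d * exp (2 * real M * \<eta>) \<le> K * m" for M :: nat
  proof -
    define y where "y n = 1 / real (Suc n)" for n
    have y: "y n > 0" "y n \<le> 1" for n by (auto simp: y_def)
    define h where "h n = cauchy_transform S (y n)" for n
    have h: "exp_closure (h n)" for n unfolding h_def by (rule exp_closure_cauchy_transform[OF S c(2) y(1)])
    define F where "F n k = exp (of_nat M * h n k)" for n k
    have F: "exp_closure (F n)" for n
      unfolding F_def[abs_def] by (intro exp_closure_exp exp_closure.scale h)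
    have nF: "(cmod (F n k))\<^sup>2 = exp (2 * real M * Re (h n k))" for n k
      by (simp add: F_def norm_exp_eq_Re exp_double[symmetric] mult.assoc)
    note [measurable] = exp_closure_measurable[OF F]
    define X where "X n = (\<integral>\<^sup>+k. ennreal ((cmod (F n (of_real k)))\<^sup>2 * (1 / (1 + k\<^sup>2))) \<partial>\<sigma>)" for n
    \<comment> \<open>The exponent tends to 0 off \<open>S\<close>, hence \<sigma>-almost
      everywhere, so the limit is independent of \<open>M\<close>; the dominating function may
      depend on \<open>M\<close>.\<close>
    have "X \<longlonglongrightarrow> (\<integral>\<^sup>+k. ennreal (1 / (1 + k\<^sup>2)) \<partial>\<sigma>)"
      unfolding X_def
    proof (rule nn_integral_dominated_convergence[where w = "\<lambda>k. ennreal (exp (2 * real M * pi)) * ennreal (1 / (1 + k\<^sup>2))"])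
      have "(\<integral>\<^sup>+k. ennreal (exp (2 * real M * pi)) * ennreal (1 / (1 + k\<^sup>2)) \<partial>\<sigma>) = ennreal (exp (2 * real M * pi)) * mass"
        unfolding mass_def by (intro nn_integral_cmult) measurable
      then show "(\<integral>\<^sup>+k. ennreal (exp (2 * real M * pi)) * ennreal (1 / (1 + k\<^sup>2)) \<partial>\<sigma>) < \<infinity>"
        using mass_finite by (simp add: ennreal_mult_less_top)
      show "AE k in \<sigma>. ennreal ((cmod (F n (of_real k)))\<^sup>2 * (1 / (1 + k\<^sup>2))) \<le> ennreal (exp (2 * real M * pi)) * ennreal (1 / (1 + k\<^sup>2))" for n
      proof (intro AE_I2)
        fix k
        have "Re (h n (of_real k)) \<le> pi"
          unfolding h_def by (rule Re_cauchy_transform_le_pi[OF S c(2) y(1) c(1)])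
        then have "exp (2 * real M * Re (h n (of_real k))) \<le> exp (2 * real M * pi)" by (simp add: mult_left_mono)
        then have "exp (2 * real M * Re (h n (of_real k))) * (1 / (1 + k\<^sup>2)) \<le> exp (2 * real M * pi) * (1 / (1 + k\<^sup>2))"
          by (intro mult_right_mono) auto
        then show "ennreal ((cmod (F n (of_real k)))\<^sup>2 * (1 / (1 + k\<^sup>2))) \<le> ennreal (exp (2 * real M * pi)) * ennreal (1 / (1 + k\<^sup>2))"
          unfolding nF by (subst ennreal_mult[symmetric]) (auto intro: ennreal_leI)
      qed
      have "S \<in> null_sets \<sigma>" using null S by (auto simp: null_sets_def sets_sigma borel_compact)
      then have "AE k in \<sigma>. k \<notin> S" by (rule AE_not_in)
      then show "AE k in \<sigma>. (\<lambda>n. ennreal ((cmod (F n (of_real k)))\<^sup>2 * (1 / (1 + k\<^sup>2)))) \<longlonglongrightarrow> ennreal (1 / (1 + k\<^sup>2))"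
      proof eventually_elim
        case (elim k)
        have "(\<lambda>n. Re (h n (of_real k))) \<longlonglongrightarrow> 0" unfolding h_def y_def by (rule Re_cauchy_transform_off_set[OF S elim])
        then have "(\<lambda>n. exp (2 * real M * Re (h n (of_real k))) * (1 / (1 + k\<^sup>2))) \<longlonglongrightarrow> exp (2 * real M * 0) * (1 / (1 + k\<^sup>2))"
          by (intro tendsto_intros)
        from tendsto_ennrealI[OF this] show ?case unfolding nF by simp
      qed
    qed measurable
    then have "X \<longlonglongrightarrow> mass" by (simp add: mass_def)
    then have "(\<lambda>n. ennreal K * X n) \<longlonglongrightarrow> ennreal K * mass"
      by (intro ennreal_tendsto_cmult) auto
    moreover have "ennreal (d * exp (2 * real M * \<eta>)) \<le> ennreal K * X n" for n
    proof -
      have "\<eta> \<le> Re (h n \<i>)" unfolding \<eta>_def h_def by (rule Re_cauchy_transform_i[OF S c(2) y])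
      then have "exp (2 * real M * \<eta>) \<le> (cmod (F n \<i>))\<^sup>2" unfolding nF by (simp add: mult_left_mono)
      then have "ennreal (d * exp (2 * real M * \<eta>)) \<le> ennreal (d * (cmod (F n \<i>))\<^sup>2)"
        using K(2) by (intro ennreal_leI mult_left_mono) auto
      also have "\<dots> \<le> ennreal K * X n" unfolding X_def by (rule ev[OF F])
      finally show ?thesis .
    qed
    ultimately have "ennreal (d * exp (2 * real M * \<eta>)) \<le> ennreal K * mass"
      by (intro LIMSEQ_le_const) auto
    also have "\<dots> = ennreal (K * m)" unfolding m(1) using K m by (intro ennreal_mult[symmetric]) auto
    finally show ?thesis using K m by simp
  qed
  \<comment> \<open>The linear lower bound exp x \<ge> x is enough for the contradiction.\<close>
  obtain M :: nat where M: "real M > K * m / (2 * \<eta> * d)" using reals_Archimedean2 by blast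
  have "K * m < real M * (2 * \<eta> * d)" using M \<eta> K(2) by (simp add: pos_divide_less_eq)
  also have "\<dots> = d * (2 * real M * \<eta>)" by simp
  also have "\<dots> \<le> d * exp (2 * real M * \<eta>)"
    using K(2) exp_ge_add_one_self[of "2 * real M * \<eta>"] by (intro mult_left_mono) linarith+
  finally show False using main[of M] by simp
qed

text \<open>Inner regularity reduces the claim to \<open>compact_null_set\<close>: a bounded piece
  of \<open>N\<close> is exhausted, up to measure e, by a closed subset, which is compact and
  \<sigma>-null.\<close>

lemma lebesgue_absolutely_continuous:
  assumes N: "N \<in> sets borel" "emeasure \<sigma> N = 0"
  shows "emeasure lborel N = 0"
proof -
  define C where "C n = N \<inter> {- real n..real n}" for n
  have Cm: "C n \<in> sets borel" for n unfolding C_def using N by auto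
  have "emeasure lborel (C n) = 0" for n
  proof -
    have "emeasure lborel (C n) \<le> 0 + ennreal e" if e: "e > 0" for e
    proof -
      have "C n \<in> sets lebesgue" using Cm[of n] by simp
      from sets_lebesgue_inner_closed[OF this e]
      obtain T where T: "closed T" "T \<subseteq> C n" "emeasure lebesgue (C n - T) < ennreal e" by metis
      have "T \<subseteq> {- real n..real n}" using T(2) by (auto simp: C_def)
      then have "bounded T" by (rule bounded_subset[OF bounded_closed_interval])
      then have cT: "compact T" using T(1) by (simp add: compact_eq_bounded_closed)
      have "emeasure \<sigma> T \<le> emeasure \<sigma> N" using T(2) N by (intro emeasure_mono) (auto simp: C_def sets_sigma)
      then have "emeasure \<sigma> T = 0" using N by simp
      then have "measure lborel T = 0" by (rule compact_null_set[OF cT])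
      then have T0: "emeasure lborel T = 0"
        using emeasure_compact_finite[OF cT] by (simp add: emeasure_eq_ennreal_measure less_top)
      have "C n = T \<union> (C n - T)" using T by auto
      then have "emeasure lborel (C n) \<le> emeasure lborel T + emeasure lborel (C n - T)"
        using emeasure_subadditive[of T lborel "C n - T"] Cm[of n] T(1) by (auto simp: borel_closed)
      moreover have "emeasure lborel (C n - T) = emeasure lebesgue (C n - T)"
        using Cm[of n] T(1) by (simp add: borel_closed sets.Diff)
      ultimately show ?thesis using T0 T(3) by simp
    qed
    then have "emeasure lborel (C n) \<le> 0" by (rule ennreal_le_epsilon)
    then show ?thesis by simp
  qed
  then have "emeasure lborel (\<Union>n. C n) = 0" using Cm by (intro emeasure_UN_eq_0) (simp_all add: image_subset_iff)
  moreover have "N \<subseteq> (\<Union>n. C n)"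
  proof
    fix x assume "x \<in> N"
    moreover obtain n where "\<bar>x\<bar> \<le> real n" using real_arch_simple by blast
    ultimately have "x \<in> C n" by (auto simp: C_def)
    then show "x \<in> (\<Union>n. C n)" by blast
  qed
  ultimately show ?thesis
    using emeasure_mono[of N "\<Union>n. C n" lborel] Cm by auto
qed

end

section \<open>Convergence almost everywhere\<close>

lemma Cauchy_at_top_imp_convergent:
  fixes f :: "real \<Rightarrow> 'a::banach"
  assumes C: "\<And>e. e > 0 \<Longrightarrow> \<exists>n::nat. \<forall>r1 r2. real n < r1 \<and> r1 < r2 \<longrightarrow> norm (f r2 - f r1) < e"
  shows "\<exists>l. (f \<longlongrightarrow> l) at_top"
proof -
  have sym: "\<exists>n::nat. \<forall>r1>real n. \<forall>r2>real n. norm (f r2 - f r1) < e" if e: "e > 0" for e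
  proof -
    obtain n :: nat where n: "\<And>r1 r2. real n < r1 \<Longrightarrow> r1 < r2 \<Longrightarrow> norm (f r2 - f r1) < e" using C[OF e] by blast
    have "norm (f r2 - f r1) < e" if "r1 > real n" "r2 > real n" for r1 r2
      using n[of r1 r2] n[of r2 r1] that e by (cases r1 r2 rule: linorder_cases) (auto simp: norm_minus_commute)
    then show ?thesis by blast
  qed
  have "Cauchy (\<lambda>n. f (real n))"
  proof (rule CauchyI)
    fix e :: real assume "e > 0"
    then obtain n :: nat where n: "\<forall>r1>real n. \<forall>r2>real n. norm (f r2 - f r1) < e" using sym by blast
    show "\<exists>M. \<forall>m\<ge>M. \<forall>n\<ge>M. norm (f (real m) - f (real n)) < e"
      using n by (intro exI[of _ "Suc n"]) auto
  qed
  then obtain l where l: "(\<lambda>n. f (real n)) \<longlonglongrightarrow> l" using Cauchy_convergent by (auto simp: convergent_def)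
  have "(f \<longlongrightarrow> l) at_top"
  proof (rule tendstoI)
    fix e :: real assume e: "e > 0"
    then obtain n :: nat where n: "\<forall>r1>real n. \<forall>r2>real n. norm (f r2 - f r1) < e/2" using sym[of "e/2"] by auto
    obtain N where N: "\<And>m. m \<ge> N \<Longrightarrow> norm (f (real m) - l) < e/2"
      using LIMSEQ_D[OF l, of "e/2"] e by auto
    define m where "m = max N (Suc n)"
    have "dist (f r) l < e" if r: "r > real n" for r
    proof -
      have "norm (f r - f (real m)) < e/2" using n r by (simp add: m_def)
      moreover have "norm (f (real m) - l) < e/2" using N[of m] by (simp add: m_def)
      moreover have "norm (f r - l) \<le> norm (f r - f (real m)) + norm (f (real m) - l)"
        using norm_triangle_ineq[of "f r - f (real m)" "f (real m) - l"] by simp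
      ultimately show ?thesis by (simp add: dist_norm)
    qed
    then show "\<forall>\<^sub>F r in at_top. dist (f r) l < e"
      by (rule eventually_mono[OF eventually_gt_at_top[of "real n"]])
  qed
  then show ?thesis by blast
qed

text \<open>For finite \<open>D\<close> every f x is at most the root of D/w, so this number bounds
  the supremum before squaring; infinite \<open>D\<close> is trivial.\<close>

lemma square_SUP_le:
  fixes f :: "'a \<Rightarrow> real" and D :: ennreal
  assumes w: "w > 0" and f: "\<And>x. x \<in> S \<Longrightarrow> f x \<ge> 0" and D: "\<And>x. x \<in> S \<Longrightarrow> ennreal ((f x)\<^sup>2 * w) \<le> D"
  shows "(SUP x\<in>S. ennreal (f x))\<^sup>2 * ennreal w \<le> D"
proof (cases D)
  case (real d)
  have "ennreal (f x) \<le> ennreal (sqrt (d / w))" if "x \<in> S" for x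
  proof (rule ennreal_leI)
    have "(f x)\<^sup>2 * w \<le> d" using D[OF that] real by (simp add: ennreal_le_iff)
    then have "(f x)\<^sup>2 \<le> d / w" using w by (simp add: pos_le_divide_eq)
    then show "f x \<le> sqrt (d / w)" by (rule real_le_rsqrt)
  qed
  then have "(SUP x\<in>S. ennreal (f x)) \<le> ennreal (sqrt (d / w))" by (rule SUP_least)
  then have "(SUP x\<in>S. ennreal (f x))\<^sup>2 \<le> (ennreal (sqrt (d / w)))\<^sup>2" by (rule power_mono) simp
  also have "\<dots> = ennreal (d / w)" using real w by (subst ennreal_power) auto
  finally have "(SUP x\<in>S. ennreal (f x))\<^sup>2 * ennreal w \<le> ennreal (d / w) * ennreal w" by (rule mult_right_mono) simp
  also have "\<dots> = D" using real w by (subst ennreal_mult[symmetric]) auto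
  finally show ?thesis .
qed simp

context krein_log
begin

text \<open>The majorant of \<open>maximal_domination\<close> does not depend on the pair of points,
  so \<open>square_SUP_le\<close> applies for each k.\<close>

lemma maximal_inequality:
  assumes "\<rho> \<ge> 0"
  shows "(\<integral>\<^sup>+k. (SUP (r1, r2)\<in>{(r1, r2). \<rho> < r1 \<and> r1 < r2}.
                  ennreal (cmod (Ps r2 (of_real k) - Ps r1 (of_real k))))\<^sup>2
               * ennreal (1 / (1 + k\<^sup>2)) \<partial>\<sigma>) \<le> ennreal (20000 * (1 + normA2) * tail \<rho>)"
proof -
  obtain D where D: "\<And>k r1 r2. \<rho> < r1 \<Longrightarrow> r1 < r2 \<Longrightarrow> ennreal ((cmod (Ps r2 (of_real k) - Ps r1 (of_real k)))\<^sup>2 / (1 + k\<^sup>2)) \<le> D k"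
    and Dint: "(\<integral>\<^sup>+k. D k \<partial>\<sigma>) \<le> ennreal (20000 * (1 + normA2) * tail \<rho>)"
    using maximal_domination[OF assms] by blast
  have "(SUP (r1, r2)\<in>{(r1, r2). \<rho> < r1 \<and> r1 < r2}. ennreal (cmod (Ps r2 (of_real k) - Ps r1 (of_real k))))\<^sup>2
               * ennreal (1 / (1 + k\<^sup>2)) \<le> D k" for k :: real
    unfolding case_prod_unfold
    by (rule square_SUP_le) (use D in \<open>auto simp: add_pos_nonneg\<close>)
  then show ?thesis by (intro order_trans[OF nn_integral_mono Dint])
qed

lemma tail_tendsto_0: "(\<lambda>n. tail (real n)) \<longlonglongrightarrow> 0"
proof -
  have I: "(\<Inter>n. {real n..}) = {}"
  proof -
    have "\<exists>n. x \<notin> {real n..}" for x using reals_Archimedean2[of x] by (auto simp: not_le)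
    then show ?thesis by blast
  qed
  have "(\<lambda>n. tail (real n)) \<longlonglongrightarrow> (LINT x:(\<Inter>n. {real n..})|lborel. (cmod (A x))\<^sup>2 * (ln (2 + x))\<^sup>2)"
    unfolding tail_def by (rule set_integral_cont_down) (use A_log in \<open>auto simp: decseq_def\<close>)
  then show ?thesis unfolding I by (simp add: set_lebesgue_integral_def)
qed

text \<open>The majorants \<open>D n\<close> for the oscillation beyond n have \<sigma>-integrals
  tending to 0, so their infimum vanishes \<sigma>-almost everywhere. At such k the function
  \<open>Ps\<close> is Cauchy at infinity, and \<open>lebesgue_absolutely_continuous\<close>
  transfers the exceptional set.\<close>

lemma Ps_converges_AE: "AE k in lborel. \<exists>l. ((\<lambda>r. Ps r (of_real k)) \<longlongrightarrow> l) at_top"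
proof -
  have "\<forall>n::nat. \<exists>D\<in>borel_measurable borel.
    (\<forall>k r1 r2. real n < r1 \<and> r1 < r2 \<longrightarrow> ennreal ((cmod (Ps r2 (of_real k) - Ps r1 (of_real k)))\<^sup>2 / (1 + k\<^sup>2)) \<le> D k) \<and>
    (\<integral>\<^sup>+k. D k \<partial>\<sigma>) \<le> ennreal (20000 * (1 + normA2) * tail (real n))"
    by (intro allI maximal_domination) simp
  then obtain D where Dm: "\<And>n. D n \<in> borel_measurable borel"
    and D: "\<And>n k r1 r2. real n < r1 \<Longrightarrow> r1 < r2 \<Longrightarrow> ennreal ((cmod (Ps r2 (of_real k) - Ps r1 (of_real k)))\<^sup>2 / (1 + k\<^sup>2)) \<le> D n k"
    and Dint: "\<And>n. (\<integral>\<^sup>+k. D n k \<partial>\<sigma>) \<le> ennreal (20000 * (1 + normA2) * tail (real n))"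
    by metis
  \<comment> \<open>The infimum needs no monotonicity of \<open>D n\<close> in n, and it keeps the
    exceptional set Borel.\<close>
  define I where "I k = (INF n. D n k)" for k
  have Im: "I \<in> borel_measurable borel" unfolding I_def[abs_def] using Dm by measurable
  have "(\<integral>\<^sup>+k. I k \<partial>\<sigma>) \<le> ennreal (20000 * (1 + normA2) * tail (real n))" for n
    by (rule order_trans[OF nn_integral_mono Dint[of n]]) (auto simp: I_def intro: INF_lower)
  moreover have "(\<lambda>n. ennreal (20000 * (1 + normA2) * tail (real n))) \<longlonglongrightarrow> ennreal (20000 * (1 + normA2) * 0)"
    by (intro tendsto_ennrealI tendsto_mult tendsto_const tail_tendsto_0)
  ultimately have "(\<integral>\<^sup>+k. I k \<partial>\<sigma>) \<le> ennreal (20000 * (1 + normA2) * 0)"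
    by (intro LIMSEQ_le_const) auto
  then have I0: "(\<integral>\<^sup>+k. I k \<partial>\<sigma>) = 0" by simp
  define N where "N = {k. I k \<noteq> 0}"
  have Nm: "N \<in> sets borel" unfolding N_def using Im by measurable
  have "I \<in> borel_measurable \<sigma>" using Im unfolding measurable_cong_sets[OF sets_sigma refl] .
  then have "AE k in \<sigma>. I k = 0" using I0 by (simp add: nn_integral_0_iff_AE)
  then have "emeasure \<sigma> N = 0"
    using AE_iff_measurable[of N \<sigma> "\<lambda>k. I k = 0"] Nm by (simp add: N_def sets_sigma)
  then have "emeasure lborel N = 0" by (rule lebesgue_absolutely_continuous[OF Nm])
  then have "N \<in> null_sets lborel" using Nm by (auto simp: null_sets_def)
  then have "AE k in lborel. k \<notin> N" by (rule AE_not_in)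
  then show ?thesis
  proof eventually_elim
    case (elim k)
    then have Ik: "I k = 0" by (simp add: N_def)
    show ?case
    proof (rule Cauchy_at_top_imp_convergent)
      fix e :: real assume e: "e > 0"
      have p: "1 + k\<^sup>2 > 0" by (simp add: add_pos_nonneg)
      have "(INF n. D n k) < ennreal (e\<^sup>2 / (1 + k\<^sup>2))" using Ik e p by (simp add: I_def)
      then obtain n where n: "D n k < ennreal (e\<^sup>2 / (1 + k\<^sup>2))" by (auto simp: INF_less_iff)
      have "norm (Ps r2 (of_real k) - Ps r1 (of_real k)) < e" if r: "real n < r1" "r1 < r2" for r1 r2
      proof -
        have "ennreal ((cmod (Ps r2 (of_real k) - Ps r1 (of_real k)))\<^sup>2 / (1 + k\<^sup>2)) < ennreal (e\<^sup>2 / (1 + k\<^sup>2))"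
          using D[OF r, of k] n by (rule le_less_trans)
        then have "(cmod (Ps r2 (of_real k) - Ps r1 (of_real k)))\<^sup>2 / (1 + k\<^sup>2) < e\<^sup>2 / (1 + k\<^sup>2)"
          by (simp add: ennreal_less_iff)
        then have "(cmod (Ps r2 (of_real k) - Ps r1 (of_real k)))\<^sup>2 < e\<^sup>2"
          using p by (simp add: divide_less_cancel)
        then show ?thesis by (rule power2_less_imp_less) (use e in simp)
      qed
      then show "\<exists>n::nat. \<forall>r1 r2. real n < r1 \<and> r1 < r2 \<longrightarrow> norm (Ps r2 (of_real k) - Ps r1 (of_real k)) < e" by blast
    qed
  qed
qed

end

section \<open>Reduction to a Borel coefficient, and the theorem\<close>

lemma lebesgue_measurable_ex_borel_complex:
  fixes f :: "real \<Rightarrow> complex"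
  assumes "f \<in> borel_measurable lebesgue"
  shows "\<exists>g\<in>borel_measurable borel. AE x in lebesgue. f x = g x"
proof -
  have "(\<lambda>x. Re (f x)) \<in> borel_measurable lebesgue" "(\<lambda>x. Im (f x)) \<in> borel_measurable lebesgue"
    using assms by measurable
  from this[THEN completion_ex_borel_measurable_real]
  obtain u v where uv: "u \<in> borel_measurable lborel" "v \<in> borel_measurable lborel"
    "AE x in lborel. Re (f x) = u x" "AE x in lborel. Im (f x) = v x" by blast
  have m: "(\<lambda>x. Complex (u x) (v x)) \<in> borel_measurable borel"
    unfolding Complex_eq using uv(1,2) by simp
  have "AE x in lborel. f x = Complex (u x) (v x)"
    using uv(3,4) by eventually_elim (simp add: complex_eq_iff)
  from AE_completion[OF this] m show ?thesis by (rule bexI)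
qed

text \<open>Performs a change on a null set and the passage from the completed measure to
  \<open>lborel\<close> together, since f may be merely Lebesgue measurable.\<close>

lemma set_lebesgue_integral_lebesgue_cong_lborel:
  fixes f g :: "real \<Rightarrow> 'a::euclidean_space"
  assumes ae: "AE x in lebesgue. x \<in> S \<longrightarrow> f x = g x" and g: "set_borel_measurable lborel S g"
  shows "(LINT x:S|lebesgue. f x) = (LINT x:S|lborel. g x)"
    and "set_integrable lebesgue S f \<longleftrightarrow> set_integrable lborel S g"
    and "set_borel_measurable lebesgue S f"
proof -
  have gm: "(\<lambda>x. indicat_real S x *\<^sub>R g x) \<in> borel_measurable lebesgue"
    using g unfolding set_borel_measurable_def by (rule measurable_completion)
  have eq: "AE x in lebesgue. indicat_real S x *\<^sub>R g x = indicat_real S x *\<^sub>R f x"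
    using ae by eventually_elim (auto simp: indicator_def)
  have fm: "(\<lambda>x. indicat_real S x *\<^sub>R f x) \<in> borel_measurable lebesgue"
    by (rule borel_measurable_AE[OF gm eq])
  then show "set_borel_measurable lebesgue S f" by (simp add: set_borel_measurable_def)
  have "(LINT x:S|lebesgue. g x) = (LINT x:S|lebesgue. f x)"
    unfolding set_lebesgue_integral_def by (rule Bochner_Integration.integral_cong_AE[OF gm fm eq])
  then show "(LINT x:S|lebesgue. f x) = (LINT x:S|lborel. g x)"
    by (simp add: set_lebesgue_integral_lebesgue_eq_lborel[OF g])
  have "set_integrable lebesgue S g \<longleftrightarrow> set_integrable lebesgue S f"
    unfolding set_integrable_def by (rule integrable_cong_AE[OF gm fm eq])
  then show "set_integrable lebesgue S f \<longleftrightarrow> set_integrable lborel S g"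
    by (simp add: set_integrable_lebesgue_iff_lborel[OF g])
qed

text \<open>Changing the coefficient on a null set affects neither the Krein system nor any of the
  integrals, so that it may be taken Borel measurable.\<close>

lemma borel_coefficient:
  assumes kr: "krein_system A P Ps" and orth: "orthogonality_measure P \<sigma>"
    and log: "(\<lambda>r. A r * of_real (ln (2 + r))) square_integrable_on {0..}"
  obtains A' where "krein_log A' P Ps \<sigma>" "AE x in lebesgue. x \<in> {0..} \<longrightarrow> A x = A' x"
proof -
  \<comment> \<open>Dividing by \<open>ln (2 + r)\<close>, which is positive for r \<ge> 0, recovers
    measurability of \<open>A\<close> on the whole half-line.\<close>
  have "(\<lambda>r. indicat_real {0..} r *\<^sub>R (A r * of_real (ln (2 + r)))) \<in> borel_measurable lebesgue"
    using log by (simp add: square_integrable_on_def set_borel_measurable_def)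
  moreover have "(\<lambda>r. 1 / complex_of_real (ln (2 + r))) \<in> borel_measurable lebesgue"
    by (rule measurable_completion) measurable
  ultimately have "(\<lambda>r. (indicat_real {0..} r *\<^sub>R (A r * of_real (ln (2 + r)))) * (1 / complex_of_real (ln (2 + r)))) \<in> borel_measurable lebesgue"
    by (rule borel_measurable_times)
  moreover have "(indicat_real {0..} r *\<^sub>R (A r * of_real (ln (2 + r)))) * (1 / complex_of_real (ln (2 + r))) = indicat_real {0..} r *\<^sub>R A r" for r
  proof (cases "r \<ge> 0")
    case True
    then have "ln (2 + r) > 0" by simp
    then show ?thesis using True by simp
  qed simp
  ultimately have "(\<lambda>r. indicat_real {0..} r *\<^sub>R A r) \<in> borel_measurable lebesgue" by simp
  then obtain A' where A'm [measurable]: "A' \<in> borel_measurable borel"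
    and A'0: "AE x in lebesgue. indicat_real {0..} x *\<^sub>R A x = A' x"
    using lebesgue_measurable_ex_borel_complex by blast
  have A': "AE x in lebesgue. x \<in> {0..} \<longrightarrow> A x = A' x"
    using A'0 by eventually_elim auto
  have "AE x in lebesgue. x \<in> {0..} \<longrightarrow> (cmod (A x * of_real (ln (2 + x))))\<^sup>2 = (cmod (A' x))\<^sup>2 * (ln (2 + x))\<^sup>2"
    using A' by eventually_elim (auto simp: norm_mult power_mult_distrib)
  from set_lebesgue_integral_lebesgue_cong_lborel(2)[OF this]
  have A_log: "set_integrable lborel {0..} (\<lambda>x. (cmod (A' x))\<^sup>2 * (ln (2 + x))\<^sup>2)"
    using log by (simp add: square_integrable_on_def set_borel_measurable_def)
  \<comment> \<open>On the half-line the logarithm is at least ln 2 \<ge> 2/3, so the weighted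
    hypothesis contains square integrability, with the factor 9/4.\<close>
  have A_L2: "set_integrable lborel {0..} (\<lambda>x. (cmod (A' x))\<^sup>2)"
  proof (rule set_integrable_bound)
    show "set_integrable lborel {0..} (\<lambda>x. 9/4 * ((cmod (A' x))\<^sup>2 * (ln (2 + x))\<^sup>2))"
      using A_log by (rule set_integrable_mult_right)
    show "set_borel_measurable lborel {0..} (\<lambda>x. (cmod (A' x))\<^sup>2)" by (simp add: set_borel_measurable_def)
    have "(cmod (A' x))\<^sup>2 \<le> 9/4 * ((cmod (A' x))\<^sup>2 * (ln (2 + x))\<^sup>2)" if "x \<ge> 0" for x
    proof -
      have "ln 2 \<le> ln (2 + x)" using that by (intro ln_mono) auto
      then have "(2/3)\<^sup>2 \<le> (ln (2 + x))\<^sup>2" using ln2_ge_two_thirds by (intro power_mono) auto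
      then have "1 \<le> 9/4 * (ln (2 + x))\<^sup>2" by (simp add: power2_eq_square)
      from mult_left_mono[OF this, of "(cmod (A' x))\<^sup>2"] show ?thesis by (simp add: mult_ac)
    qed
    then show "AE x in lborel. x \<in> {0..} \<longrightarrow> norm ((cmod (A' x))\<^sup>2) \<le> norm (9/4 * ((cmod (A' x))\<^sup>2 * (ln (2 + x))\<^sup>2))"
      by (auto simp: abs_mult)
  qed
  have "krein_system A' P Ps"
    unfolding krein_system_def
  proof (intro conjI allI impI)
    fix a :: real
    have "set_integrable lborel {0..a} (\<lambda>x. (cmod (A' x))\<^sup>2)"
      by (rule set_integrable_subset[OF A_L2]) auto
    moreover have "set_borel_measurable lebesgue {0..a} A'"
      by (rule set_lebesgue_integral_lebesgue_cong_lborel(3)[of "{0..a}" A' A']) (auto simp: set_borel_measurable_def)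
    ultimately show "A' square_integrable_on {0..a}"
      by (simp add: square_integrable_on_def set_integrable_lebesgue_iff_lborel set_borel_measurable_def)
  next
    fix k
    show "P 0 k = 1" "Ps 0 k = 1" using kr by (auto simp: krein_system_def)
    show "abs_continuous_on {0..a} (\<lambda>r. P r k)" "abs_continuous_on {0..a} (\<lambda>r. Ps r k)" if "a > 0" for a
      using kr that by (auto simp: krein_system_def)
    have "AE r in lebesgue. r \<ge> 0 \<longrightarrow>
           ((\<lambda>r. P r k) has_vector_derivative \<i> * k * P r k - cnj (A r) * Ps r k) (at r within {0..}) \<and>
           ((\<lambda>r. Ps r k) has_vector_derivative - A r * P r k) (at r within {0..})"
      using kr by (auto simp: krein_system_def)
    with A' show "AE r in lebesgue. r \<ge> 0 \<longrightarrow>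
           ((\<lambda>r. P r k) has_vector_derivative \<i> * k * P r k - cnj (A' r) * Ps r k) (at r within {0..}) \<and>
           ((\<lambda>r. Ps r k) has_vector_derivative - A' r * P r k) (at r within {0..})"
      by eventually_elim auto
  qed
  then have "krein_log A' P Ps \<sigma>"
    using A'm A_L2 orth A_log by unfold_locales
  then show ?thesis using A' that by blast
qed

theorem lemma1p5:
  shows "\<exists>C::real. \<forall>(A :: real \<Rightarrow> complex) (P :: real \<Rightarrow> complex \<Rightarrow> complex)
      (Ps :: real \<Rightarrow> complex \<Rightarrow> complex) (\<sigma> :: real measure).
    krein_system A P Ps \<and> orthogonality_measure P \<sigma> \<and>
    (\<lambda>r. A r * of_real (ln (2 + r))) square_integrable_on {0..} \<longrightarrow>
      (\<forall>\<rho>>0.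
        (\<integral>\<^sup>+k. (SUP (r1, r2)\<in>{(r1, r2). \<rho> < r1 \<and> r1 < r2}.
                  ennreal (cmod (LINT x:{r1..r2}|lebesgue. A x * P x (of_real k))))\<^sup>2
               * ennreal (1 / (1 + k\<^sup>2)) \<partial>\<sigma>)
        = (\<integral>\<^sup>+k. (SUP (r1, r2)\<in>{(r1, r2). \<rho> < r1 \<and> r1 < r2}.
                  ennreal (cmod (Ps r2 (of_real k) - Ps r1 (of_real k))))\<^sup>2
               * ennreal (1 / (1 + k\<^sup>2)) \<partial>\<sigma>)
        \<and> (\<integral>\<^sup>+k. (SUP (r1, r2)\<in>{(r1, r2). \<rho> < r1 \<and> r1 < r2}.
                  ennreal (cmod (Ps r2 (of_real k) - Ps r1 (of_real k))))\<^sup>2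
               * ennreal (1 / (1 + k\<^sup>2)) \<partial>\<sigma>)
          \<le> ennreal (C * (1 + (L2_norm_on {0..} A)\<^sup>2)
               * (LINT r:{\<rho>..}|lebesgue. (cmod (A r))\<^sup>2 * (ln (2 + r))\<^sup>2))) \<and>
      (AE k in lebesgue. \<exists>l. ((\<lambda>r. Ps r (of_real k)) \<longlongrightarrow> l) at_top)"
proof (intro exI[of _ 20000] allI impI)
  fix A :: "real \<Rightarrow> complex" and P Ps :: "real \<Rightarrow> complex \<Rightarrow> complex" and \<sigma> :: "real measure"
  assume "krein_system A P Ps \<and> orthogonality_measure P \<sigma> \<and> (\<lambda>r. A r * of_real (ln (2 + r))) square_integrable_on {0..}"
  then obtain A' where loc: "krein_log A' P Ps \<sigma>" and A': "AE x in lebesgue. x \<in> {0..} \<longrightarrow> A x = A' x"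
    by (elim conjE borel_coefficient)
  interpret krein_log A' P Ps \<sigma> by (rule loc)
  have norm: "(L2_norm_on {0..} A)\<^sup>2 = normA2"
  proof -
    have "AE x in lebesgue. x \<in> {0..} \<longrightarrow> (cmod (A x))\<^sup>2 = (cmod (A' x))\<^sup>2"
      using A' by eventually_elim auto
    then have "(LINT x:{0..}|lebesgue. (cmod (A x))\<^sup>2) = normA2"
      unfolding normA2_def by (rule set_lebesgue_integral_lebesgue_cong_lborel(1)) (simp add: set_borel_measurable_def)
    then show ?thesis using normA2_nonneg by (simp add: L2_norm_on_def)
  qed
  have tail: "(LINT r:{\<rho>..}|lebesgue. (cmod (A r))\<^sup>2 * (ln (2 + r))\<^sup>2) = tail \<rho>" if "\<rho> > 0" for \<rho>
  proof -
    have "AE x in lebesgue. x \<in> {\<rho>..} \<longrightarrow> (cmod (A x))\<^sup>2 * (ln (2 + x))\<^sup>2 = (cmod (A' x))\<^sup>2 * (ln (2 + x))\<^sup>2"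
      using A' by eventually_elim (use that in auto)
    then show ?thesis
      unfolding tail_def by (rule set_lebesgue_integral_lebesgue_cong_lborel(1)) (simp add: set_borel_measurable_def)
  qed
  \<comment> \<open>All pairs in the suprema satisfy 0 < \<rho> < r1, so the interval lies in the
    half-line, where \<open>A\<close> and \<open>A'\<close> agree almost everywhere. The two maximal
    functions therefore coincide at every k.\<close>
  have inc: "cmod (LINT x:{r1..r2}|lebesgue. A x * P x k) = cmod (Ps r2 k - Ps r1 k)" if r: "0 < r1" "r1 < r2" for r1 r2 k
  proof -
    have "AE x in lebesgue. x \<in> {r1..r2} \<longrightarrow> A x * P x k = A' x * P x k"
      using A' by eventually_elim (use r in auto)
    moreover have "set_borel_measurable lborel {r1..r2} (\<lambda>x. A' x * P x k)"
    proof -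
      have "set_integrable lborel {r1..r2} (\<lambda>x. A' x * P x k)"
        using r by (intro A_integrable_variants P_continuous') auto
      then show ?thesis unfolding set_integrable_def set_borel_measurable_def by (rule borel_measurable_integrable)
    qed
    ultimately have "(LINT x:{r1..r2}|lebesgue. A x * P x k) = (LINT x:{r1..r2}|lborel. A' x * P x k)"
      by (rule set_lebesgue_integral_lebesgue_cong_lborel(1))
    then show ?thesis using Ps_increment[of r1 r2 k] r by simp
  qed
  show "(\<forall>\<rho>>0.
        (\<integral>\<^sup>+k. (SUP (r1, r2)\<in>{(r1, r2). \<rho> < r1 \<and> r1 < r2}.
                  ennreal (cmod (LINT x:{r1..r2}|lebesgue. A x * P x (of_real k))))\<^sup>2
               * ennreal (1 / (1 + k\<^sup>2)) \<partial>\<sigma>)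
        = (\<integral>\<^sup>+k. (SUP (r1, r2)\<in>{(r1, r2). \<rho> < r1 \<and> r1 < r2}.
                  ennreal (cmod (Ps r2 (of_real k) - Ps r1 (of_real k))))\<^sup>2
               * ennreal (1 / (1 + k\<^sup>2)) \<partial>\<sigma>)
        \<and> (\<integral>\<^sup>+k. (SUP (r1, r2)\<in>{(r1, r2). \<rho> < r1 \<and> r1 < r2}.
                  ennreal (cmod (Ps r2 (of_real k) - Ps r1 (of_real k))))\<^sup>2
               * ennreal (1 / (1 + k\<^sup>2)) \<partial>\<sigma>)
          \<le> ennreal (20000 * (1 + (L2_norm_on {0..} A)\<^sup>2)
               * (LINT r:{\<rho>..}|lebesgue. (cmod (A r))\<^sup>2 * (ln (2 + r))\<^sup>2))) \<and>
      (AE k in lebesgue. \<exists>l. ((\<lambda>r. Ps r (of_real k)) \<longlongrightarrow> l) at_top)"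
  proof (intro conjI allI impI)
    fix \<rho> :: real assume \<rho>: "\<rho> > 0"
    have "(SUP (r1, r2)\<in>{(r1, r2). \<rho> < r1 \<and> r1 < r2}. ennreal (cmod (LINT x:{r1..r2}|lebesgue. A x * P x (of_real k))))
        = (SUP (r1, r2)\<in>{(r1, r2). \<rho> < r1 \<and> r1 < r2}. ennreal (cmod (Ps r2 (of_real k) - Ps r1 (of_real k))))" for k
      by (rule SUP_cong) (use \<rho> inc in auto)
    then show "(\<integral>\<^sup>+k. (SUP (r1, r2)\<in>{(r1, r2). \<rho> < r1 \<and> r1 < r2}.
                  ennreal (cmod (LINT x:{r1..r2}|lebesgue. A x * P x (of_real k))))\<^sup>2
               * ennreal (1 / (1 + k\<^sup>2)) \<partial>\<sigma>)
        = (\<integral>\<^sup>+k. (SUP (r1, r2)\<in>{(r1, r2). \<rho> < r1 \<and> r1 < r2}.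
                  ennreal (cmod (Ps r2 (of_real k) - Ps r1 (of_real k))))\<^sup>2
               * ennreal (1 / (1 + k\<^sup>2)) \<partial>\<sigma>)"
      by simp
    show "(\<integral>\<^sup>+k. (SUP (r1, r2)\<in>{(r1, r2). \<rho> < r1 \<and> r1 < r2}.
                  ennreal (cmod (Ps r2 (of_real k) - Ps r1 (of_real k))))\<^sup>2
               * ennreal (1 / (1 + k\<^sup>2)) \<partial>\<sigma>)
          \<le> ennreal (20000 * (1 + (L2_norm_on {0..} A)\<^sup>2)
               * (LINT r:{\<rho>..}|lebesgue. (cmod (A r))\<^sup>2 * (ln (2 + r))\<^sup>2))"
      unfolding norm tail[OF \<rho>] by (rule maximal_inequality) (use \<rho> in simp)
  next
    show "AE k in lebesgue. \<exists>l. ((\<lambda>r. Ps r (of_real k)) \<longlongrightarrow> l) at_top"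
      by (rule AE_completion[OF Ps_converges_AE])
  qed
qed

end
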